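(* Let $\mathsf{T}$ be a rooted plane tree. The operahedron lattice $\mathrm{MN}(\mathsf{T})$ is trim if and only if the root of $\mathsf{T}$ is covered by at most $2$ elements of $\mathsf{T}$ and every non-root vertex of $\mathsf{T}$ is covered by at most $1$ element of $\mathsf{T}$.
   Context: A rooted plane tree is a rooted tree in which the children of each vertex are linearly ordered from left to right. For a rooted plane tree $\mathsf{T}$ with $n+1$ vertices and vertex set $\mathsf{V}$, view $\mathsf{V}$ as a poset $(\mathsf{V},\leq_\mathsf{T})$ in which the root is the unique minimum and each non-root vertex covers exactly its parent (so the elements covering $v$ are the children of $v$). Identify $\mathsf{V}$ with $\{0,\ldots,n\}$ so that $0,1,\ldots,n$ is the preorder traversal (root first, then subtrees of the root, recursively in preorder, left to right). A tube is a set of vertices inducing a connected subgraph; its root is its $\leq_\mathsf{T}$-minimum. A nesting is a collection $\mathcal N$ of tubes with $\mathsf{V}\in\mathcal N$, each tube of size $\geq 2$, any two tubes nested or disjoint; a maximal nesting has exactly $n$ tubes; $\mathrm{MN}(\mathsf{T})$ is the set of maximal nestings. For $\mathcal N,\mathcal N'\in\mathrm{MN}(\mathsf{T})$ with $\tau\in\mathcal N\setminus\mathcal N'$, $\tau'\in\mathcal N'\setminus\mathcal N$ and $\mathcal N\setminus\{\tau\}=\mathcal N'\setminus\{\tau'\}$, declare $\mathcal N\lessdot\mathcal N'$ if some (equivalently every) element of $\tau\setminus\tau'$ is less than some (equivalently every) element of $\tau'\setminus\tau$ in $\mathbb Z$; the operahedron lattice $\mathrm{MN}(\mathsf{T})$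 is ordered by the reflexive–transitive closure of these relations. For a finite lattice $L$: an element is join-irreducible (resp. meet-irreducible) if it covers (resp. is covered by) exactly one element; the height is the maximum length of a chain; $L$ is extremal if its height equals the number of join-irreducible elements and equals the number of meet-irreducible elements. An element $u$ is left-modular if $(v\vee u)\wedge w=v\vee(u\wedge w)$ for all $v<w$ in $L$; $L$ is left-modular if it has a maximal chain consisting of left-modular elements. $L$ is trim if it is both extremal and left-modular.
   Formalization: The readings "some (equivalently every)" of the flip direction are not equivalent (edges 0-1, 1-2, 0-3: differences {2} and {0,3}); the formal order declares N ⋖ N' when some element of τ∖τ' is less than every element of τ'∖τ. *)

theory Defs
  imports "HOL-Algebra.Lattice"
begin

section \<open>Finite lattices\<close>

definition covered_by :: "('a, 'b) gorder_scheme \<Rightarrow> 'a \<Rightarrow> 'a \<Rightarrow> bool" where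
  "covered_by L x y \<longleftrightarrow>
     x \<in> carrier L \<and> y \<in> carrier L \<and> x \<sqsubset>\<^bsub>L\<^esub> y \<and>
     \<not> (\<exists>z\<in>carrier L. x \<sqsubset>\<^bsub>L\<^esub> z \<and> z \<sqsubset>\<^bsub>L\<^esub> y)"

definition join_irreducibles :: "('a, 'b) gorder_scheme \<Rightarrow> 'a set" where
  "join_irreducibles L = {x \<in> carrier L. \<exists>!y. covered_by L y x}"

definition meet_irreducibles :: "('a, 'b) gorder_scheme \<Rightarrow> 'a set" where
  "meet_irreducibles L = {x \<in> carrier L. \<exists>!y. covered_by L x y}"

text \<open>The length of a chain is one less than its number of elements. The empty chain has
  length 0 by truncated subtraction, so it only matters when the carrier is empty.\<close>

definition height :: "('a, 'b) gorder_scheme \<Rightarrow> nat" where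
  "height L = Max {card C - 1 | C. pred_on.chain (carrier L) (\<lambda>x y. x \<sqsubset>\<^bsub>L\<^esub> y) C}"

definition extremal :: "('a, 'b) gorder_scheme \<Rightarrow> bool" where
  "extremal L \<longleftrightarrow>
     height L = card (join_irreducibles L) \<and> height L = card (meet_irreducibles L)"

definition left_modular_element :: "('a, 'b) gorder_scheme \<Rightarrow> 'a \<Rightarrow> bool" where
  "left_modular_element L u \<longleftrightarrow>
     u \<in> carrier L \<and>
     (\<forall>v\<in>carrier L. \<forall>w\<in>carrier L. v \<sqsubset>\<^bsub>L\<^esub> w \<longrightarrow>
        (v \<squnion>\<^bsub>L\<^esub> u) \<sqinter>\<^bsub>L\<^esub> w = v \<squnion>\<^bsub>L\<^esub> (u \<sqinter>\<^bsub>L\<^esub> w))"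

definition left_modular :: "('a, 'b) gorder_scheme \<Rightarrow> bool" where
  "left_modular L \<longleftrightarrow>
     (\<exists>C. pred_on.maxchain (carrier L) (\<lambda>x y. x \<sqsubset>\<^bsub>L\<^esub> y) C \<and>
          (\<forall>u\<in>C. left_modular_element L u))"

definition trim :: "('a, 'b) gorder_scheme \<Rightarrow> bool" where
  "trim L \<longleftrightarrow> lattice L \<and> finite (carrier L) \<and> extremal L \<and> left_modular L"

section \<open>Rooted plane trees\<close>

datatype plane_tree = Node "plane_tree list"

primrec num_vertices :: "plane_tree \<Rightarrow> nat" where
  "num_vertices (Node ts) = Suc (sum_list (map num_vertices ts))"

text \<open>Vertices are identified with their position in the preorder traversal, so the root is 0.
  The set \<open>tree_edges r T\<close> consists of the (parent, child) pairs of \<open>T\<close> when numbering starts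
  with \<open>r\<close> at the root; \<open>forest_edges p r ts\<close> consists of those of the trees \<open>ts\<close>, numbered
  consecutively from \<open>r\<close> on, together with the edges from the common parent \<open>p\<close> to their
  roots.\<close>

fun tree_edges :: "nat \<Rightarrow> plane_tree \<Rightarrow> (nat \<times> nat) set"
  and forest_edges :: "nat \<Rightarrow> nat \<Rightarrow> plane_tree list \<Rightarrow> (nat \<times> nat) set" where
  "tree_edges r (Node ts) = forest_edges r (Suc r) ts"
| "forest_edges p r [] = {}"
| "forest_edges p r (t # ts) =
     insert (p, r) (tree_edges r t \<union> forest_edges p (r + num_vertices t) ts)"

definition vertices :: "plane_tree \<Rightarrow> nat set" where
  "vertices T = {0..<num_vertices T}"

definition edges :: "plane_tree \<Rightarrow> (nat \<times> nat) set" where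
  "edges T = tree_edges 0 T"

definition tree_poset :: "plane_tree \<Rightarrow> nat gorder" where
  "tree_poset T = \<lparr>carrier = vertices T, eq = (=), le = (\<lambda>u v. (u, v) \<in> (edges T)\<^sup>*)\<rparr>"

section \<open>The operahedron lattice\<close>

definition tube :: "plane_tree \<Rightarrow> nat set \<Rightarrow> bool" where
  "tube T S \<longleftrightarrow>
     S \<subseteq> vertices T \<and> S \<noteq> {} \<and>
     (\<forall>u\<in>S. \<forall>v\<in>S. (u, v) \<in> ((edges T \<union> (edges T)\<inverse>) \<inter> S \<times> S)\<^sup>*)"

definition nesting :: "plane_tree \<Rightarrow> nat set set \<Rightarrow> bool" where
  "nesting T \<N> \<longleftrightarrow>
     vertices T \<in> \<N> \<and>
     (\<forall>\<tau>\<in>\<N>. tube T \<tau> \<and> 2 \<le> card \<tau>) \<and>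
     (\<forall>\<tau>\<in>\<N>. \<forall>\<tau>'\<in>\<N>. \<tau> \<subseteq> \<tau>' \<or> \<tau>' \<subseteq> \<tau> \<or> \<tau> \<inter> \<tau>' = {})"

text \<open>The one-vertex tree has no nestings, because its vertex set has fewer than two
  elements.\<close>

definition maximal_nestings :: "plane_tree \<Rightarrow> nat set set set" where
  "maximal_nestings T = {\<N>. nesting T \<N> \<and> (\<forall>\<M>. nesting T \<M> \<and> \<N> \<subseteq> \<M> \<longrightarrow> \<M> = \<N>)}"

text \<open>The two differences are compared by their minima: some element of the first is less than
  every element of the second. If neither \<open>\<tau> - \<tau>'\<close> nor \<open>\<tau>' - \<tau>\<close> contains the root of
  \<open>\<tau> \<union> \<tau>'\<close>, they lie in disjoint subtrees and all pairs compare in the same way. If one of them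
  does contain that root, it need not lie to one side of the other. For instance, in the tree
  with edges 0-1, 1-2, 0-3 the tubes \<open>\<tau> = {1,2}\<close> and \<open>\<tau>' = {0,1,3}\<close> of the nestings
  \<open>{{0,1,2,3},{1,2},{0,3}}\<close> and \<open>{{0,1,2,3},{0,1,3},{0,3}}\<close> give the differences \<open>{2}\<close> and
  \<open>{0,3}\<close>. Requiring only some pair to be increasing would then relate these two nestings in
  both directions, and requiring every pair to be increasing would not relate them at all.\<close>

definition flip_up :: "plane_tree \<Rightarrow> (nat set set \<times> nat set set) set" where
  "flip_up T =
     {(\<N>, \<N>'). \<N> \<in> maximal_nestings T \<and> \<N>' \<in> maximal_nestings T \<and>
        (\<exists>\<tau> \<tau>'. \<tau> \<in> \<N> - \<N>' \<and> \<tau>' \<in> \<N>' - \<N> \<and> \<N> - {\<tau>} = \<N>' - {\<tau>'} \<and>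
           (\<exists>x\<in>\<tau> - \<tau>'. \<forall>y\<in>\<tau>' - \<tau>. x < y))}"

definition operahedron_lattice :: "plane_tree \<Rightarrow> nat set set gorder" where
  "operahedron_lattice T =
     \<lparr>carrier = maximal_nestings T, eq = (=), le = (\<lambda>\<N> \<N>'. (\<N>, \<N>') \<in> (flip_up T)\<^sup>*)\<rparr>"

end

theory Submission
  imports Defs
begin

text \<open>Name each edge of the tree by its child vertex. A maximal nesting is determined by the function
  sending a tube \<open>P\<close> with at least two vertices to its top edge, and the functions that arise are those
  with the consistency property that the top edge of \<open>P\<close> is also the top edge of every smaller tube
  containing it. A flip up replaces the top edge \<open>f\<close> of some tubes by a smaller edge \<open>e\<close>, and
  conversely one can always flip towards a given componentwise smaller top function; hence the
  operahedron order is the reversed componentwise order of top functions.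

  A vertex with three incident edges yields an interval isomorphic to the weak order on three letters,
  and a lattice with a hexagonal interval has no maximal chain of left modular elements. So the tree of
  a trim operahedron lattice is a path with the root somewhere on it.

  For such a path, maximal nestings correspond to inversion sets closed under two implications, ordered
  by inclusion. Adding the pairs one by one in a suitable order produces a maximal chain of closed sets.
  Closures of single pairs are exactly the join-irreducibles, each pair \<open>q\<close> has a largest closed set
  that avoids it and contains its predecessors, and these are exactly the meet-irreducibles. The chain is
  left modular because adjoining the predecessors of the first pair in which two closed sets
  \<open>v \<subseteq> w\<close> differ to \<open>v\<close> gives a closed set.\<close>

section \<open>Subtrees of a rooted tree\<close>

text \<open>The order is studied for an arbitrary numbering in which parents precede their children;
  that it is a preorder is used only to see that each leg of a path is numbered consecutively. Top
  functions make the order tractable because a flip just exchanges two successive cuts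
  \<open>f\<close>, \<open>e\<close> of one tube, whatever their position in the tree, and the
  asymmetric comparison of set differences then reads \<open>e < f\<close>.

  For trimness the obstacle is that unions of closed inversion sets need not be closed, so joins are
  not explicit. The arguments therefore look at the first pair, in a fixed linear order of all
  pairs, at which two closed sets differ. In that order (i, k) stands between (i, j) and (j, k)
  whenever i < j < k, and the pairs that closure derives from (i, k) alone come before it.

  For the hexagon the point is that a left modular element on a maximal chain projects only onto the
  two ends of the interval, whereas a jump of the chain from one end to the other leaves room for
  one more element.\<close>

locale parent_tree =
  fixes n :: nat and par :: "nat \<Rightarrow> nat"
  assumes par_less: "0 < v \<Longrightarrow> v \<le> n \<Longrightarrow> par v < v"
begin

definition arcs :: "(nat \<times> nat) set" where
  "arcs = {(par v, v) | v. 0 < v \<and> v \<le> n}"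

definition desc :: "nat \<Rightarrow> nat \<Rightarrow> bool" where
  "desc e x \<longleftrightarrow> (e, x) \<in> arcs\<^sup>*"

text \<open>Parents are smaller than children, so the root of a subtree is its minimum, and
  containing the parent of every other vertex replaces walks in the induced subgraph.
  \<open>tube_iff_conn\<close> relates this to tubes.\<close>

definition conn :: "nat set \<Rightarrow> bool" where
  "conn S \<longleftrightarrow> S \<subseteq> {0..n} \<and> S \<noteq> {} \<and> (\<forall>v\<in>S. v \<noteq> Min S \<longrightarrow> par v \<in> S)"

text \<open>A non-root vertex stands for the edge to its parent, so \<open>inner S\<close> is the set of edges of
  the subtree induced by \<open>S\<close>.\<close>

definition inner :: "nat set \<Rightarrow> nat set" where
  "inner S = S - {Min S}"

definition big :: "nat set \<Rightarrow> bool" where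
  "big S \<longleftrightarrow> conn S \<and> inner S \<noteq> {}"

lemma desc_refl [simp]: "desc e e"
  by (simp add: desc_def)

lemma desc_trans: "desc a b \<Longrightarrow> desc b c \<Longrightarrow> desc a c"
  by (auto simp: desc_def)

lemma desc_le: "desc e x \<Longrightarrow> e \<le> x"
  unfolding desc_def
  by (induction rule: rtrancl_induct) (auto simp: arcs_def dest: par_less)

lemma desc_par: "0 < v \<Longrightarrow> v \<le> n \<Longrightarrow> desc (par v) v"
  unfolding desc_def arcs_def by auto

lemma desc_parD: "desc e x \<Longrightarrow> x \<noteq> e \<Longrightarrow> desc e (par x)"
  unfolding desc_def by (erule rtranclE) (auto simp: arcs_def)

text \<open>The edge \<open>e\<close> is the only one that joins the descendants of \<open>e\<close>
  to the other vertices.\<close>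

lemma desc_par_iff: "0 < v \<Longrightarrow> v \<le> n \<Longrightarrow> v \<noteq> e \<Longrightarrow> desc e (par v) \<longleftrightarrow> desc e v"
  using desc_parD desc_par desc_trans by blast

lemma conn_finite: "conn S \<Longrightarrow> finite S"
  unfolding conn_def by (meson finite_atLeastAtMost finite_subset)

lemma conn_Min: "conn S \<Longrightarrow> Min S \<in> S"
  using conn_finite[of S] unfolding conn_def by auto

lemma conn_Min_le: "conn S \<Longrightarrow> v \<in> S \<Longrightarrow> Min S \<le> v"
  using conn_finite by auto

lemma innerD:
  assumes "conn S" "v \<in> inner S"
  shows "v \<in> S" "par v \<in> S" "0 < v" "v \<le> n" "par v < v" "Min S < v"
proof -
  show 1: "v \<in> S" "par v \<in> S" using assms by (auto simp: inner_def conn_def)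
  show "Min S < v"
    using conn_Min_le[OF assms(1) 1(1)] assms(2) by (auto simp: inner_def)
  then show 2: "0 < v" by linarith
  show "v \<le> n" using 1 assms(1) by (auto simp: conn_def)
  then show "par v < v" using par_less 2 by blast
qed

text \<open>The root of the larger subtree is at most that of the smaller one, hence is not a
  non-root vertex of it.\<close>

lemma inner_mono: "conn P \<Longrightarrow> conn Q \<Longrightarrow> P \<subseteq> Q \<Longrightarrow> inner P \<subseteq> inner Q"
  using conn_Min_le conn_Min unfolding inner_def
  by (smt (verit, ccfv_threshold) DiffE DiffI insert_iff le_antisym subset_iff singletonD)

lemma conn_desc_Min: "conn S \<Longrightarrow> x \<in> S \<Longrightarrow> desc (Min S) x"
proof (induction x rule: less_induct)
  case (less x)
  show ?case
  proof (cases "x = Min S")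
    case False
    then have "x \<in> inner S" using less by (auto simp: inner_def)
    note D = innerD[OF less(2) this]
    then show ?thesis using less.IH[of "par x"] less.prems desc_par desc_trans by blast
  qed simp
qed

text \<open>Climbing to parents decreases and can stop only at \<open>r\<close>, so naming a root is
  enough and no minimum has to be computed.\<close>

lemma connI:
  assumes "S \<subseteq> {0..n}" "r \<in> S" "\<And>v. v \<in> S \<Longrightarrow> v \<noteq> r \<Longrightarrow> par v \<in> S \<and> 0 < v"
  shows "conn S \<and> Min S = r"
proof -
  have fin: "finite S" using assms(1) finite_subset by blast
  have "r \<le> v" if "v \<in> S" for v
    using that
  proof (induction v rule: less_induct)
    case (less v)
    show ?case
    proof (cases "v = r")
      case False
      with less.prems assms(3) have "par v \<in> S" "0 < v" by auto
      moreover have "v \<le> n" using less.prems assms(1) by auto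
      ultimately show ?thesis using less.IH[of "par v"] par_less[of v] by linarith
    qed simp
  qed
  then have "Min S = r" using assms(2) fin by (intro Min_eqI) auto
  then show ?thesis using assms by (auto simp: conn_def)
qed

lemma conn_UNIV: "conn {0..n}"
proof -
  have "par v \<le> n" if "0 < v" "v \<le> n" for v using par_less[OF that] that by linarith
  then show ?thesis using connI[of "{0..n}" 0] by auto
qed

lemma big_iff_card: "big S \<longleftrightarrow> conn S \<and> 2 \<le> card S"
proof (cases "conn S")
  case True
  have "card (inner S) = card S - 1"
    unfolding inner_def using conn_Min[OF True] conn_finite[OF True] by simp
  moreover have "finite (inner S)" using conn_finite[OF True] by (simp add: inner_def)
  ultimately show ?thesis using True unfolding big_def
    by (metis One_nat_def Suc_1 card_gt_0_iff less_eq_Suc_le zero_less_diff)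
qed (simp add: big_def)

lemma not_big_conn: "conn S \<Longrightarrow> \<not> big S \<Longrightarrow> S = {Min S}"
  using conn_Min unfolding big_def inner_def by blast

text \<open>The two components of \<open>S\<close> left after deleting the edge \<open>e\<close>.\<close>

definition lower :: "nat set \<Rightarrow> nat \<Rightarrow> nat set" where
  "lower S e = {x\<in>S. desc e x}"

definition upper :: "nat set \<Rightarrow> nat \<Rightarrow> nat set" where
  "upper S e = {x\<in>S. \<not> desc e x}"

context
  fixes S e
  assumes S: "conn S" and e: "e \<in> inner S"
begin

lemma lower_conn: "conn (lower S e) \<and> Min (lower S e) = e"
proof (rule connI)
  show "lower S e \<subseteq> {0..n}" using S by (auto simp: lower_def conn_def)
  show "e \<in> lower S e" using innerD[OF S e] by (simp add: lower_def)
  fix v assume v: "v \<in> lower S e" "v \<noteq> e"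
  then have "v \<in> S" "desc e v" by (auto simp: lower_def)
  moreover have "Min S < e" using innerD[OF S e] by blast
  ultimately have "v \<in> inner S" using desc_le[of e v] by (auto simp: inner_def)
  from innerD[OF S this] \<open>desc e v\<close> v(2)
  show "par v \<in> lower S e \<and> 0 < v" by (auto simp: lower_def intro: desc_parD)
qed

lemma upper_conn: "conn (upper S e) \<and> Min (upper S e) = Min S"
proof (rule connI)
  show "upper S e \<subseteq> {0..n}" using S by (auto simp: upper_def conn_def)
  show "Min S \<in> upper S e"
    using innerD(6)[OF S e] conn_Min[OF S] desc_le[of e "Min S"] by (auto simp: upper_def)
  fix v assume v: "v \<in> upper S e" "v \<noteq> Min S"
  then have v': "v \<in> inner S" "\<not> desc e v" by (auto simp: upper_def inner_def)
  then have "v \<noteq> e" by auto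
  then show "par v \<in> upper S e \<and> 0 < v"
    using innerD[OF S v'(1)] v'(2) desc_par_iff by (auto simp: upper_def)
qed

lemma inner_split:
  shows "inner S = insert e (inner (lower S e) \<union> inner (upper S e))"
    and "e \<notin> inner (lower S e)" and "e \<notin> inner (upper S e)"
    and "inner (lower S e) \<inter> inner (upper S e) = {}"
proof -
  note L = lower_conn[THEN conjunct2] upper_conn[THEN conjunct2]
  have "e \<in> S" "Min S < e" using innerD[OF S e] by auto
  then show "inner S = insert e (inner (lower S e) \<union> inner (upper S e))"
    using L desc_le[of e e] conn_Min[OF S] desc_le[of e "Min S"]
    unfolding inner_def by (auto simp: lower_def upper_def)
  show "e \<notin> inner (lower S e)" using L by (auto simp: inner_def)
  show "e \<notin> inner (upper S e)" by (auto simp: inner_def upper_def)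
  show "inner (lower S e) \<inter> inner (upper S e) = {}"
    by (auto simp: inner_def upper_def lower_def)
qed

text \<open>Being a descendant of \<open>e\<close> does not change along any edge other than
  \<open>e\<close>, so it is constant on a subtree that lacks this edge.\<close>

lemma part_cases:
  assumes P: "conn P" "P \<subseteq> S" "e \<notin> inner P"
  shows "P \<subseteq> lower S e \<or> P \<subseteq> upper S e"
proof (cases "desc e (Min P)")
  case True
  then show ?thesis using conn_desc_Min[OF P(1)] P(2) desc_trans by (auto simp: lower_def)
next
  case False
  have "\<not> desc e x" if "x \<in> P" for x
    using that
  proof (induction x rule: less_induct)
    case (less x)
    show ?case
    proof (cases "x = Min P")
      case x: False
      then have xi: "x \<in> inner P" using less.prems by (auto simp: inner_def)
      note D = innerD[OF P(1) xi]
      have "x \<noteq> e" using xi P(3) by auto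
      then show ?thesis using less.IH[OF D(5) D(2)] D desc_par_iff by blast
    qed (use False in simp)
  qed
  then show ?thesis using P(2) by (auto simp: upper_def)
qed

lemma parts_proper:
  "lower S e \<subset> S" "upper S e \<subset> S" "lower S e \<union> upper S e = S" "lower S e \<inter> upper S e = {}"
  "e \<in> lower S e" "par e \<in> upper S e"
proof -
  note D = innerD[OF S e]
  show "e \<in> lower S e" using D by (simp add: lower_def)
  show "par e \<in> upper S e" using D desc_le[of e "par e"] by (auto simp: upper_def)
  show "lower S e \<union> upper S e = S" "lower S e \<inter> upper S e = {}"
    by (auto simp: lower_def upper_def)
  then show "lower S e \<subset> S" "upper S e \<subset> S"
    using \<open>e \<in> lower S e\<close> \<open>par e \<in> upper S e\<close> by blast+
qed

end

text \<open>Let P have the smaller root. Climbing inside P from a common vertex towards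
  \<open>Min P\<close> passes the root of Q, which therefore lies in P; so the union is rooted at
  \<open>Min P\<close> and has no further edges.\<close>

lemma conn_union:
  assumes "conn P" "conn Q" "P \<inter> Q \<noteq> {}"
  shows "conn (P \<union> Q)" and "inner (P \<union> Q) = inner P \<union> inner Q"
proof -
  have *: "conn (P \<union> Q) \<and> inner (P \<union> Q) = inner P \<union> inner Q"
    if P: "conn P" and Q: "conn Q" and ne: "P \<inter> Q \<noteq> {}" and le: "Min P \<le> Min Q" for P Q
  proof -
    obtain w where w: "w \<in> P" "w \<in> Q" using ne by auto
    have up: "Min Q \<in> P"
    proof -
      have "desc (Min Q) x \<Longrightarrow> x \<in> P \<Longrightarrow> Min Q \<in> P" for x
      proof (induction x rule: less_induct)
        case (less x)
        show ?case
        proof (cases "x = Min P \<or> x = Min Q")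
          case True
          then show ?thesis using less.prems desc_le[of "Min Q" x] le by auto
        next
          case False
          then have "x \<in> inner P" using less.prems by (auto simp: inner_def)
          note D = innerD[OF P this]
          then show ?thesis using less.IH[OF D(5)] less.prems False desc_parD by blast
        qed
      qed
      then show ?thesis using conn_desc_Min[OF Q w(2)] w(1) by blast
    qed
    have "conn (P \<union> Q) \<and> Min (P \<union> Q) = Min P"
    proof (rule connI)
      show "P \<union> Q \<subseteq> {0..n}" using P Q by (auto simp: conn_def)
      show "Min P \<in> P \<union> Q" using conn_Min[OF P] by auto
      fix v assume v: "v \<in> P \<union> Q" "v \<noteq> Min P"
      show "par v \<in> P \<union> Q \<and> 0 < v"
      proof (cases "v \<in> P")
        case True
        then have "v \<in> inner P" using v by (auto simp: inner_def)
        then show ?thesis using innerD[OF P] by blast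
      next
        case False
        then have "v \<in> inner Q" using v up by (auto simp: inner_def)
        then show ?thesis using innerD[OF Q] by blast
      qed
    qed
    moreover have "P \<union> Q - {Min P} = (P - {Min P}) \<union> (Q - {Min Q})"
      using up conn_Min_le[OF Q, of "Min P"] le by auto
    ultimately show ?thesis by (auto simp: inner_def)
  qed
  have "Min P \<le> Min Q \<or> Min Q \<le> Min P" by linarith
  then show "conn (P \<union> Q)" and "inner (P \<union> Q) = inner P \<union> inner Q"
    using *[of P Q] *[of Q P] assms by (auto simp: Un_commute Int_commute)
qed

section \<open>Maximal nestings and top edges\<close>

definition nest :: "nat set set \<Rightarrow> bool" where
  "nest N \<longleftrightarrow> {0..n} \<in> N \<and> (\<forall>S\<in>N. big S) \<and>
     (\<forall>S\<in>N. \<forall>S'\<in>N. S \<subseteq> S' \<or> S' \<subseteq> S \<or> S \<inter> S' = {})"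

definition max_nest :: "nat set set \<Rightarrow> bool" where
  "max_nest N \<longleftrightarrow> nest N \<and> (\<forall>M. nest M \<and> N \<subseteq> M \<longrightarrow> M = N)"

text \<open>In the language of choice functions the second condition is independence of irrelevant
  alternatives, restricted to subtrees.\<close>

definition choice :: "(nat set \<Rightarrow> nat) \<Rightarrow> bool" where
  "choice c \<longleftrightarrow> (\<forall>P. big P \<longrightarrow> c P \<in> inner P) \<and>
     (\<forall>P Q. big P \<longrightarrow> big Q \<longrightarrow> Q \<subseteq> P \<longrightarrow> c P \<in> inner Q \<longrightarrow> c Q = c P)"

text \<open>The tubes met when the tree is cut at its top edge, each part at its own top edge, and
  so on, described without recursion: no subtree properly containing S is cut inside S.\<close>

definition of_choice :: "(nat set \<Rightarrow> nat) \<Rightarrow> nat set set" where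
  "of_choice c = {S. big S \<and> (\<forall>P. big P \<longrightarrow> S \<subset> P \<longrightarrow> c P \<notin> inner S)}"

text \<open>The edge of \<open>P\<close> that is cut when the smallest tube of \<open>N\<close> containing \<open>P\<close> is split into its
  maximal proper subtubes.\<close>

definition is_top :: "nat set set \<Rightarrow> nat set \<Rightarrow> nat \<Rightarrow> bool" where
  "is_top N P e \<longleftrightarrow> e \<in> inner P \<and> (\<forall>S\<in>N. e \<in> inner S \<longrightarrow> P \<subseteq> S)"

definition top :: "nat set set \<Rightarrow> nat set \<Rightarrow> nat" where
  "top N P = (THE e. is_top N P e)"

lemma big_conn: "big S \<Longrightarrow> conn S"
  by (simp add: big_def)

lemma big_subset: "big S \<Longrightarrow> S \<subseteq> {0..n}"
  by (simp add: big_def conn_def)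

lemma big_mono: "big P \<Longrightarrow> conn Q \<Longrightarrow> P \<subseteq> Q \<Longrightarrow> big Q"
  using inner_mono unfolding big_def by blast

lemma nest_finite: "nest N \<Longrightarrow> finite N"
  unfolding nest_def by (meson Pow_iff big_subset finite_Pow_iff finite_atLeastAtMost finite_subset subsetI)

lemma big_UNIV: "0 < n \<Longrightarrow> big {0..n}"
proof -
  assume "0 < n"
  moreover have "Min {0..n} = 0" by (rule Min_eqI) auto
  ultimately have "n \<in> inner {0..n}" by (auto simp: inner_def)
  then show ?thesis using conn_UNIV by (auto simp: big_def)
qed

lemma choice_inner: "choice c \<Longrightarrow> big P \<Longrightarrow> c P \<in> inner P"
  unfolding choice_def by blast

lemma choice_sub: "choice c \<Longrightarrow> big P \<Longrightarrow> conn Q \<Longrightarrow> Q \<subseteq> P \<Longrightarrow> c P \<in> inner Q \<Longrightarrow> c Q = c P"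
  unfolding choice_def big_def by blast

lemma of_choice_big: "S \<in> of_choice c \<Longrightarrow> big S"
  unfolding of_choice_def by blast

text \<open>If two members crossed, the top edge of their union would be an edge of one of them,
  because a union of overlapping subtrees has no further edges; that member would be cut by a larger
  subtree.\<close>

lemma of_choice_nest:
  assumes c: "choice c" and n: "0 < n"
  shows "nest (of_choice c)"
  unfolding nest_def
proof (intro conjI ballI)
  show "{0..n} \<in> of_choice c"
    using big_UNIV[OF n] big_subset by (auto simp: of_choice_def)
  show "big S" if "S \<in> of_choice c" for S using of_choice_big[OF that] .
  fix S S' assume S: "S \<in> of_choice c" "S' \<in> of_choice c"
  then have b: "big S" "big S'" using of_choice_big by blast+
  show "S \<subseteq> S' \<or> S' \<subseteq> S \<or> S \<inter> S' = {}"
  proof (rule ccontr)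
    assume A: "\<not> ?thesis"
    have "S \<inter> S' \<noteq> {}" using A by auto
    note U = conn_union[OF big_conn[OF b(1)] big_conn[OF b(2)] this]
    have bU: "big (S \<union> S')" using big_mono[OF b(1) U(1)] by blast
    have "c (S \<union> S') \<in> inner S \<union> inner S'" using choice_inner[OF c bU] U(2) by simp
    moreover have "S \<subset> S \<union> S'" "S' \<subset> S \<union> S'" using A by auto
    ultimately show False using S bU by (auto simp: of_choice_def)
  qed
qed

text \<open>Suppose a larger subtree P is cut inside the part Q, and look at the top edge of
  \<open>S \<union> P\<close>. If it lies in S, then P is contained in S, since S survives, and P
  cannot contain the edge \<open>c S\<close>, so P stays inside Q. Otherwise it is the top edge of P
  by consistency, yet that edge lies in Q and so in S.\<close>

lemma of_choice_parts:
  assumes c: "choice c" and S: "S \<in> of_choice c"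
    and Q: "Q = lower S (c S) \<or> Q = upper S (c S)" and bQ: "big Q"
  shows "Q \<in> of_choice c"
proof -
  have bS: "big S" using of_choice_big[OF S] .
  note cS = big_conn[OF bS]
  note e = choice_inner[OF c bS]
  note parts = parts_proper[OF cS e]
  have Qsub: "Q \<subset> S" using Q parts by auto
  have eQ: "c S \<notin> inner Q" using Q inner_split[OF cS e] by auto
  have "c P \<notin> inner Q" if P: "big P" "Q \<subset> P" for P
  proof
    assume cP: "c P \<in> inner Q"
    have "P \<inter> S \<noteq> {}" using Qsub P(2) conn_Min[OF big_conn[OF bQ]] by auto
    note U = conn_union[OF cS big_conn[OF P(1)]] this
    have "conn (S \<union> P)" and iU: "inner (S \<union> P) = inner S \<union> inner P" using U by auto
    then have bU: "big (S \<union> P)" using big_mono[OF bS] by blast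
    note cU = choice_inner[OF c bU]
    show False
    proof (cases "c (S \<union> P) \<in> inner S")
      case True
      then have SU: "S \<union> P = S" using S bU unfolding of_choice_def by blast
      then have "P \<subseteq> S" by auto
      have "c S \<notin> inner P"
      proof
        assume "c S \<in> inner P"
        then have "c P = c S" using choice_sub[OF c bS big_conn[OF P(1)] \<open>P \<subseteq> S\<close>] by simp
        then show False using cP eQ by simp
      qed
      then have "P \<subseteq> lower S (c S) \<or> P \<subseteq> upper S (c S)"
        using part_cases[OF cS e big_conn[OF P(1)] \<open>P \<subseteq> S\<close>] by blast
      then show False using Q P(2) parts conn_Min[OF big_conn[OF bQ]] by blast
    next
      case False
      then have "c (S \<union> P) \<in> inner P" using cU iU by auto
      then have "c P = c (S \<union> P)" using choice_sub[OF c bU big_conn[OF P(1)]] by auto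
      moreover have "c P \<in> inner S"
        using cP inner_mono[OF big_conn[OF bQ] cS] Qsub by auto
      ultimately show False using False by simp
    qed
  qed
  then show ?thesis using bQ by (simp add: of_choice_def)
qed

text \<open>Let R be compatible with the family and S the smallest member containing R. If R has the
  edge \<open>c S\<close>, it meets both parts of S and must swallow both; if not, it lies in one
  part, which is a smaller member.\<close>

lemma of_choice_max_nest:
  assumes c: "choice c" and n: "0 < n"
  shows "max_nest (of_choice c)"
  unfolding max_nest_def
proof (intro conjI allI impI)
  show N: "nest (of_choice c)" by (rule of_choice_nest[OF assms])
  fix M assume M: "nest M \<and> of_choice c \<subseteq> M"
  have "R \<in> of_choice c" if R: "R \<in> M" for R
  proof (rule ccontr)
    assume nR: "R \<notin> of_choice c"
    have bR: "big R" using M R by (auto simp: nest_def)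
    let ?F = "{S \<in> of_choice c. R \<subseteq> S}"
    have "{0..n} \<in> ?F" using N big_subset[OF bR] by (auto simp: nest_def)
    moreover have "finite ?F" using nest_finite[OF N] by auto
    ultimately obtain S where S: "S \<in> ?F" and "\<forall>S'\<in>?F. S' \<subseteq> S \<longrightarrow> S = S'"
      using finite_has_minimal[of ?F] by blast
    then have min: "\<And>S'. S' \<in> ?F \<Longrightarrow> S' \<subseteq> S \<Longrightarrow> S' = S" by metis
    have SN: "S \<in> of_choice c" and RS: "R \<subset> S" using S nR by auto
    have bS: "big S" using of_choice_big[OF SN] .
    note cS = big_conn[OF bS]
    note e = choice_inner[OF c bS]
    note parts = parts_proper[OF cS e]
    \<comment> \<open>A part that is a single vertex does not belong to the nesting, so laminarity
      says nothing about it; but meeting it already means containing it.\<close>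
    have part: "Q \<subseteq> R" if Q: "Q = lower S (c S) \<or> Q = upper S (c S)" and ne: "R \<inter> Q \<noteq> {}"
      and nsub: "\<not> R \<subseteq> Q" for Q
    proof (cases "big Q")
      case True
      then have "Q \<in> M" using of_choice_parts[OF c SN Q] M by auto
      then show ?thesis using M R ne nsub unfolding nest_def by blast
    next
      case False
      moreover have "conn Q" using Q lower_conn[OF cS e] upper_conn[OF cS e] by auto
      ultimately obtain m where "Q = {m}" using not_big_conn by blast
      then show ?thesis using ne by simp
    qed
    show False
    proof (cases "c S \<in> inner R")
      case True
      then have "c S \<in> R" "par (c S) \<in> R" using innerD[OF big_conn[OF bR]] by auto
      then have ne: "R \<inter> lower S (c S) \<noteq> {}" "R \<inter> upper S (c S) \<noteq> {}"
        using parts(5,6) by blast+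
      then have "\<not> R \<subseteq> upper S (c S)" "\<not> R \<subseteq> lower S (c S)" using parts(4) by auto
      then have "lower S (c S) \<subseteq> R" "upper S (c S) \<subseteq> R" using part ne by simp_all
      then show False using RS parts(3) by auto
    next
      case False
      then obtain Q where Q: "Q = lower S (c S) \<or> Q = upper S (c S)" "R \<subseteq> Q"
        using part_cases[OF cS e big_conn[OF bR]] RS by blast
      have "conn Q" using Q lower_conn[OF cS e] upper_conn[OF cS e] by auto
      then have "big Q" using big_mono[OF bR _ Q(2)] by blast
      then have "Q \<in> of_choice c" using of_choice_parts[OF c SN Q(1)] by blast
      then show False using min[of Q] Q parts by auto
    qed
  qed
  then show "M = of_choice c" using M by auto
qed

lemma max_nest_add:
  assumes N: "max_nest N" and bD: "big D"
    and D: "\<And>S. S \<in> N \<Longrightarrow> S \<subseteq> D \<or> D \<subseteq> S \<or> S \<inter> D = {}"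
  shows "D \<in> N"
proof -
  have nN: "nest N" using N by (simp only: max_nest_def)
  have "nest (insert D N)"
    unfolding nest_def
  proof (intro conjI ballI)
    fix A B assume "A \<in> insert D N" "B \<in> insert D N"
    then show "A \<subseteq> B \<or> B \<subseteq> A \<or> A \<inter> B = {}"
      using D nN unfolding nest_def by (metis Int_commute insertE subset_refl)
  next
    show "{0..n} \<in> insert D N" using nN by (simp add: nest_def)
    show "big S" if "S \<in> insert D N" for S using that nN bD by (auto simp: nest_def)
  qed
  then have "insert D N = N" using N unfolding max_nest_def by blast
  then show ?thesis by auto
qed

text \<open>If S has proper subtubes, let \<open>e\<close> join a maximal one, M, to the rest of S:
  a proper subtube with this edge would meet M without lying in M, hence contain M. Cutting S at
  \<open>e\<close> therefore breaks no smaller tube, and the parts can be added to N.\<close>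

lemma max_nest_split:
  assumes N: "max_nest N" and S: "S \<in> N"
  obtains e where "e \<in> inner S"
    "\<And>S'. S' \<in> N \<Longrightarrow> e \<in> inner S' \<Longrightarrow> S \<subseteq> S'"
    "big (lower S e) \<Longrightarrow> lower S e \<in> N" "big (upper S e) \<Longrightarrow> upper S e \<in> N"
proof -
  have nN: "nest N" using N by (simp only: max_nest_def)
  have lam: "\<And>A B. A \<in> N \<Longrightarrow> B \<in> N \<Longrightarrow> A \<subseteq> B \<or> B \<subseteq> A \<or> A \<inter> B = {}"
    using nN by (simp add: nest_def)
  have bN: "\<And>A. A \<in> N \<Longrightarrow> big A" using nN by (simp add: nest_def)
  note cS = big_conn[OF bN[OF S]]
  let ?F = "{M \<in> N. M \<subset> S}"
  have fF: "finite ?F" using nest_finite[OF nN] by auto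
  obtain e where e: "e \<in> inner S" and eF: "\<And>M. M \<in> ?F \<Longrightarrow> e \<notin> inner M"
  proof (cases "?F = {}")
    case True
    then show ?thesis using that bN[OF S] unfolding big_def by blast
  next
    case False
    then obtain M where M: "M \<in> ?F" and "\<forall>M'\<in>?F. M \<subseteq> M' \<longrightarrow> M = M'"
      using finite_has_maximal[OF fF] by blast
    then have max: "\<And>M'. M' \<in> ?F \<Longrightarrow> M \<subseteq> M' \<Longrightarrow> M' = M" by metis
    have MN: "M \<in> N" "M \<subset> S" using M by auto
    note cM = big_conn[OF bN[OF MN(1)]]
    \<comment> \<open>If no edge of S left M, membership in M would agree for a vertex and its
      parent, hence be constant on S.\<close>
    obtain e where e: "e \<in> inner S" "e \<in> M \<longleftrightarrow> par e \<notin> M"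
    proof (rule ccontr)
      assume "\<not> thesis"
      then have A: "\<And>e. e \<in> inner S \<Longrightarrow> e \<in> M \<longleftrightarrow> par e \<in> M" using that by blast
      have B: "x \<in> M \<longleftrightarrow> Min S \<in> M" if "x \<in> S" for x
        using that
      proof (induction x rule: less_induct)
        case (less x)
        show ?case
        proof (cases "x = Min S")
          case False
          then have "x \<in> inner S" using less.prems by (auto simp: inner_def)
          then show ?thesis using innerD(2,5)[OF cS] less.IH[of "par x"] A[of x] by simp
        qed simp
      qed
      then show False using MN(2) conn_Min[OF cM] by blast
    qed
    have "e \<notin> inner M'" if M': "M' \<in> ?F" for M'
    proof
      assume eM': "e \<in> inner M'"
      have bM': "big M'" using bN M' by auto
      have "e \<in> M'" "par e \<in> M'" using innerD[OF big_conn[OF bM'] eM'] by auto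
      then have "M' \<inter> M \<noteq> {}" "\<not> M' \<subseteq> M" using e(2) by auto
      then have "M \<subseteq> M'" using lam[of M M'] MN M' by blast
      then show False using max[OF M'] \<open>\<not> M' \<subseteq> M\<close> by simp
    qed
    then show ?thesis using that e(1) by blast
  qed
  have eS: "e \<in> S" "par e \<in> S" using innerD[OF cS e] by auto
  have sup: "S \<subseteq> S'" if "S' \<in> N" "e \<in> inner S'" for S'
  proof -
    have "e \<in> S'" using that(2) by (simp add: inner_def)
    then have "S' \<inter> S \<noteq> {}" using eS by auto
    moreover have "\<not> S' \<subset> S" using eF that by auto
    ultimately show ?thesis using lam[OF that(1) S] by blast
  qed
  have part: "Q \<in> N" if Q: "Q = lower S e \<or> Q = upper S e" and bQ: "big Q" for Q
  proof (rule max_nest_add[OF N bQ], goal_cases)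
    case (1 A)
    then have A: "A \<in> N" .
    have QS: "Q \<subset> S" using Q parts_proper[OF cS e] by auto
    consider "S \<subseteq> A" | "A \<inter> S = {}" | "A \<subset> S" using lam[OF A S] by blast
    then show "A \<subseteq> Q \<or> Q \<subseteq> A \<or> A \<inter> Q = {}"
    proof cases
      case 3
      then have "e \<notin> inner A" using eF A by auto
      then have "A \<subseteq> lower S e \<or> A \<subseteq> upper S e"
        using part_cases[OF cS e big_conn[OF bN[OF A]]] 3 by auto
      then show ?thesis using Q parts_proper[OF cS e] by blast
    qed (use QS in auto)
  qed
  show ?thesis using that[OF e sup] part by blast
qed

lemma max_nestD:
  assumes N: "max_nest N"
  shows "nest N" "{0..n} \<in> N" "\<And>S. S \<in> N \<Longrightarrow> big S" "\<And>S. S \<in> N \<Longrightarrow> conn S"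
    "\<And>A B. A \<in> N \<Longrightarrow> B \<in> N \<Longrightarrow> A \<subseteq> B \<or> B \<subseteq> A \<or> A \<inter> B = {}" "finite N"
proof -
  show nN: "nest N" using N by (simp only: max_nest_def)
  then show "{0..n} \<in> N" "\<And>S. S \<in> N \<Longrightarrow> big S" "finite N"
    "\<And>A B. A \<in> N \<Longrightarrow> B \<in> N \<Longrightarrow> A \<subseteq> B \<or> B \<subseteq> A \<or> A \<inter> B = {}"
    using nest_finite unfolding nest_def by blast+
  then show "\<And>S. S \<in> N \<Longrightarrow> conn S" by (blast intro: big_conn)
qed

section \<open>The top function of a maximal nesting\<close>

lemma minimal_tube:
  assumes N: "max_nest N" and "S0 \<in> N" "Q S0"
  obtains S where "S \<in> N" "Q S" "\<And>S'. S' \<in> N \<Longrightarrow> Q S' \<Longrightarrow> S' \<subseteq> S \<Longrightarrow> S' = S"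
proof -
  have "finite {S\<in>N. Q S}" "{S\<in>N. Q S} \<noteq> {}" using assms max_nestD(6)[OF N] by auto
  then obtain S where "S \<in> {S\<in>N. Q S}" "\<forall>S'\<in>{S\<in>N. Q S}. S' \<subseteq> S \<longrightarrow> S = S'"
    using finite_has_minimal[of "{S\<in>N. Q S}"] by blast
  then show ?thesis using that[of S] by blast
qed

text \<open>The edge is the cut \<open>e\<close> of the smallest tube S containing P: if P missed
  \<open>e\<close>, it would lie in a part of S, a smaller tube. Any other edge of P lies in a part
  of S, which is a tube without the edge \<open>e\<close> and so does not contain P.\<close>

lemma ex1_top:
  assumes N: "max_nest N" and P: "big P"
  shows "\<exists>!e. is_top N P e"
proof -
  note D = max_nestD[OF N]
  obtain S where S: "S \<in> N" "P \<subseteq> S" and min: "\<And>S'. S' \<in> N \<Longrightarrow> P \<subseteq> S' \<Longrightarrow> S' \<subseteq> S \<Longrightarrow> S' = S"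
    using minimal_tube[OF N D(2), of "\<lambda>S. P \<subseteq> S"] big_subset[OF P] by metis
  obtain e where e: "e \<in> inner S" and sup: "\<And>S'. S' \<in> N \<Longrightarrow> e \<in> inner S' \<Longrightarrow> S \<subseteq> S'"
    and parts: "big (lower S e) \<Longrightarrow> lower S e \<in> N" "big (upper S e) \<Longrightarrow> upper S e \<in> N"
    using max_nest_split[OF N S(1)] by metis
  note cS = D(4)[OF S(1)]
  have eP: "e \<in> inner P"
  proof (rule ccontr)
    assume "e \<notin> inner P"
    then obtain Q where Q: "Q = lower S e \<or> Q = upper S e" "P \<subseteq> Q"
      using part_cases[OF cS e big_conn[OF P] S(2)] by blast
    have "conn Q" using Q lower_conn[OF cS e] upper_conn[OF cS e] by auto
    then have "Q \<in> N" using big_mono[OF P _ Q(2)] Q(1) parts by blast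
    then show False using min[of Q] Q parts_proper[OF cS e] by auto
  qed
  show ?thesis
  proof
    show "is_top N P e" using eP sup S(2) unfolding is_top_def by blast
    fix e' assume e': "is_top N P e'"
    show "e' = e"
    proof (rule ccontr)
      assume ne: "e' \<noteq> e"
      have "e' \<in> inner S" using e' inner_mono[OF big_conn[OF P] cS S(2)] by (auto simp: is_top_def)
      then obtain Q where Q: "Q = lower S e \<or> Q = upper S e" "e' \<in> inner Q"
        using inner_split(1)[OF cS e] ne by auto
      have "conn Q" using Q lower_conn[OF cS e] upper_conn[OF cS e] by auto
      then have "Q \<in> N" using Q parts unfolding big_def by blast
      then have PQ: "P \<subseteq> Q" using e' Q(2) by (simp add: is_top_def)
      have "e \<in> inner Q" using eP inner_mono[OF big_conn[OF P] \<open>conn Q\<close> PQ] by auto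
      then show False using Q(1) inner_split[OF cS e] by auto
    qed
  qed
qed

lemma is_top_top: "max_nest N \<Longrightarrow> big P \<Longrightarrow> is_top N P (top N P)"
  unfolding top_def by (rule theI'[OF ex1_top])

lemma top_eqI: "max_nest N \<Longrightarrow> big P \<Longrightarrow> e \<in> inner P \<Longrightarrow>
    (\<And>S. S \<in> N \<Longrightarrow> e \<in> inner S \<Longrightarrow> P \<subseteq> S) \<Longrightarrow> top N P = e"
  unfolding top_def by (rule the1_equality[OF ex1_top]) (simp_all add: is_top_def)

lemma top_inner: "max_nest N \<Longrightarrow> big P \<Longrightarrow> top N P \<in> inner P"
  using is_top_top by (simp add: is_top_def)

lemma top_subset: "max_nest N \<Longrightarrow> big P \<Longrightarrow> S \<in> N \<Longrightarrow> top N P \<in> inner S \<Longrightarrow> P \<subseteq> S"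
  using is_top_top by (simp add: is_top_def)

lemma top_choice: "max_nest N \<Longrightarrow> choice (top N)"
  unfolding choice_def
proof (intro conjI allI impI)
  assume N: "max_nest N"
  show "top N P \<in> inner P" if "big P" for P using N that by (rule top_inner)
  fix P Q assume "big P" "big Q" "Q \<subseteq> P" "top N P \<in> inner Q"
  then show "top N Q = top N P" using N
    by (intro top_eqI) (auto dest: top_subset)
qed

text \<open>One inclusion suffices, since both sides are nestings and N is maximal. The case n = 0
  is void: a single vertex carries no edge, so there is no nesting.\<close>

lemma of_choice_top:
  assumes N: "max_nest N"
  shows "of_choice (top N) = N"
proof -
  note D = max_nestD[OF N]
  have "0 < n"
  proof (rule ccontr)
    assume "\<not> 0 < n"
    then have "big {0}" using D(3)[OF D(2)] by simp
    then show False by (simp add: big_def inner_def)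
  qed
  then have "max_nest (of_choice (top N))" using of_choice_max_nest top_choice[OF N] by blast
  moreover have "N \<subseteq> of_choice (top N)"
    using D(3) top_subset[OF N] unfolding of_choice_def by blast
  ultimately show ?thesis using N unfolding max_nest_def by blast
qed

text \<open>Together with \<open>of_choice_top\<close> this makes top functions and maximal nestings
  equivalent. If a member S has the edge \<open>c P\<close>, the top edge of
  \<open>P \<union> S\<close> lies in S, since otherwise it would be the top edge of P; as S
  survives, the union is S.\<close>

lemma top_of_choice:
  assumes c: "choice c" and n: "0 < n" and P: "big P"
  shows "top (of_choice c) P = c P"
proof (rule top_eqI[OF of_choice_max_nest[OF c n] P choice_inner[OF c P]])
  fix S assume S: "S \<in> of_choice c" and cS: "c P \<in> inner S"
  have bS: "big S" using of_choice_big[OF S] .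
  have "P \<inter> S \<noteq> {}" using cS choice_inner[OF c P] by (auto simp: inner_def)
  note U = conn_union[OF big_conn[OF P] big_conn[OF bS] this]
  have bU: "big (P \<union> S)" using big_mono[OF P U(1)] by blast
  have "c (P \<union> S) \<in> inner S"
  proof (rule ccontr)
    assume *: "c (P \<union> S) \<notin> inner S"
    then have "c (P \<union> S) \<in> inner P" using choice_inner[OF c bU] U(2) by auto
    then have "c P = c (P \<union> S)" using choice_sub[OF c bU big_conn[OF P]] by auto
    then show False using * cS by simp
  qed
  then have "\<not> S \<subset> P \<union> S" using S bU unfolding of_choice_def by blast
  then show "P \<subseteq> S" by auto
qed

section \<open>The order on maximal nestings\<close>

definition nest_le :: "nat set set \<Rightarrow> nat set set \<Rightarrow> bool" where
  "nest_le N N' \<longleftrightarrow> (\<forall>P. big P \<longrightarrow> top N' P \<le> top N P)"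

definition flip :: "(nat set set \<times> nat set set) set" where
  "flip = {(N, N'). max_nest N \<and> max_nest N' \<and>
     (\<exists>S S'. S \<in> N - N' \<and> S' \<in> N' - N \<and> N - {S} = N' - {S'} \<and>
        (\<exists>x\<in>S - S'. \<forall>y\<in>S' - S. x < y))}"

lemma nest_le_refl: "nest_le N N"
  by (simp add: nest_le_def)

lemma nest_le_trans: "nest_le N M \<Longrightarrow> nest_le M K \<Longrightarrow> nest_le N K"
  unfolding nest_le_def by (meson le_trans)

lemma of_choice_cong: "(\<And>P. big P \<Longrightarrow> c P = d P) \<Longrightarrow> of_choice c = of_choice d"
  unfolding of_choice_def by auto

lemma nest_le_antisym:
  assumes "max_nest N" "max_nest M" "nest_le N M" "nest_le M N"
  shows "N = M"
proof -
  have "top N P = top M P" if "big P" for P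
    using assms(3,4) that unfolding nest_le_def by (simp add: le_antisym)
  then have "of_choice (top N) = of_choice (top M)" by (rule of_choice_cong)
  then show ?thesis using of_choice_top assms(1,2) by simp
qed

lemma finite_max_nests: "finite {N. max_nest N}"
proof (rule finite_subset)
  show "{N. max_nest N} \<subseteq> Pow (Pow {0..n})"
    using max_nestD(3) big_subset by blast
qed simp

lemma part_in:
  assumes N: "max_nest N" and S: "S \<in> N" and Q: "Q = lower S (top N S) \<or> Q = upper S (top N S)"
    and bQ: "big Q"
  shows "Q \<in> N"
  using of_choice_parts[OF top_choice[OF N], of S Q] of_choice_top[OF N] S Q bQ by simp

text \<open>The tubes form a binary tree of successive cuts, in which S is the parent of T. The cut
  of S misses T, so T lies in a part of S, and minimality of S makes it equal to that part.\<close>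

lemma parent_tube:
  assumes N: "max_nest N" and T: "T \<in> N" "T \<noteq> {0..n}"
  obtains S where "S \<in> N" "T \<subset> S" "T = lower S (top N S) \<or> T = upper S (top N S)"
    "\<And>S'. S' \<in> N \<Longrightarrow> T \<subset> S' \<Longrightarrow> S \<subseteq> S'"
proof -
  note D = max_nestD[OF N]
  have "T \<subset> {0..n}" using T big_subset[OF D(3)[OF T(1)]] by auto
  then obtain S where S: "S \<in> N" "T \<subset> S" and min: "\<And>S'. S' \<in> N \<Longrightarrow> T \<subset> S' \<Longrightarrow> S' \<subseteq> S \<Longrightarrow> S' = S"
    using minimal_tube[OF N D(2), of "\<lambda>S. T \<subset> S"] by metis
  have bS: "big S" and bT: "big T" using D(3) S T by auto
  note cS = big_conn[OF bS] and cT = big_conn[OF bT]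
  note t = top_inner[OF N bS]
  have "top N S \<notin> inner T" using top_subset[OF N bS T(1)] S(2) by auto
  then obtain Q where Q: "Q = lower S (top N S) \<or> Q = upper S (top N S)" "T \<subseteq> Q"
    using part_cases[OF cS t cT] S(2) by blast
  have "conn Q" using Q lower_conn[OF cS t] upper_conn[OF cS t] by auto
  then have "Q \<in> N" using part_in[OF N S(1) Q(1)] big_mono[OF bT _ Q(2)] by blast
  moreover have "Q \<subset> S" using Q(1) parts_proper(1,2)[OF cS t] by auto
  ultimately have "T = Q" using min[of Q] Q(2) by auto
  moreover have "S \<subseteq> S'" if S': "S' \<in> N" "T \<subset> S'" for S'
  proof -
    have "T \<noteq> {}" using conn_Min[OF cT] by auto
    then have "S \<inter> S' \<noteq> {}" using S(2) S'(2) by auto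
    then show ?thesis using D(5)[OF S(1) S'(1)] min[OF S'] by auto
  qed
  ultimately show ?thesis using that[OF S] Q(1) by blast
qed

lemma part_absorb:
  assumes S: "conn S" "e \<in> inner S" and Q: "Q = lower S e \<or> Q = upper S e"
    and R: "conn R" "R \<subseteq> S" "e \<notin> inner R" "g \<in> inner R" "g \<in> inner Q"
  shows "R \<subseteq> Q"
proof -
  obtain Q' where Q': "Q' = lower S e \<or> Q' = upper S e" "R \<subseteq> Q'"
    using part_cases[OF S R(1-3)] by blast
  have "conn Q'" using Q'(1) lower_conn[OF S] upper_conn[OF S] by auto
  then have "g \<in> inner Q'" using inner_mono[OF R(1) _ Q'(2)] R(4) by auto
  then have "Q' = Q" using Q Q'(1) R(5) inner_split(4)[OF S] by auto
  then show ?thesis using Q'(2) by simp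
qed

lemma part_of_inner:
  assumes S: "conn S" "e \<in> inner S" and g: "g \<in> inner S" "g \<noteq> e"
  obtains Q where "Q = lower S e \<or> Q = upper S e" "g \<in> inner Q" "big Q" "Q \<subset> S" "e \<notin> inner Q"
proof -
  obtain Q where Q: "Q = lower S e \<or> Q = upper S e" "g \<in> inner Q"
    using inner_split(1)[OF S] g by auto
  moreover have "conn Q" using Q lower_conn[OF S] upper_conn[OF S] by auto
  moreover have "Q \<subset> S" using Q(1) parts_proper(1,2)[OF S] by auto
  moreover have "e \<notin> inner Q" using Q(1) inner_split(2,3)[OF S] by auto
  ultimately show ?thesis using that unfolding big_def by blast
qed

text \<open>Here S is cut at \<open>f\<close> and then at \<open>e\<close>, or the other way round;
  \<open>T\<close> and \<open>T'\<close> are the intermediate tubes. The part below \<open>f\<close>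
  has only edges greater than \<open>f\<close>, so for \<open>e < f\<close> the tube
  \<open>T\<close> is the upper part, and \<open>T - T'\<close> contains the root of S or
  \<open>e\<close> itself, which is less than everything in \<open>T' - T\<close>.\<close>

lemma swap_order_iff:
  assumes S: "conn S" "e \<in> inner S" "f \<in> inner S" "e \<noteq> f"
    and T: "T = lower S f \<or> T = upper S f" "e \<in> inner T"
    and T': "T' = lower S e \<or> T' = upper S e" "f \<in> inner T'"
  shows "(\<exists>x\<in>T - T'. \<forall>y\<in>T' - T. x < y) \<longleftrightarrow> e < f"
proof -
  note le = lower_conn[OF S(1,2)] and lf = lower_conn[OF S(1,3)]
  have Me: "Min S < e" and Mf: "Min S < f" using innerD(6)[OF S(1)] S(2,3) by auto
  have Mup: "Min S \<in> upper S e" "Min S \<in> upper S f" "Min S \<notin> lower S e" "Min S \<notin> lower S f"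
    using conn_Min[OF S(1)] desc_le[of e "Min S"] desc_le[of f "Min S"] Me Mf
    by (auto simp: upper_def lower_def)
  have fe: "f < e" if "T = lower S f" using innerD(6)[OF _ T(2)] that lf by auto
  have ef: "e < f" if "T' = lower S e" using innerD(6)[OF _ T'(2)] that le by auto
  have up: "T = upper S f" if "e < f" using fe T(1) that by auto
  have inT: "e \<in> T" "f \<in> T'" using T(2) T'(2) by (auto simp: inner_def)
  show ?thesis
  proof
    assume "\<exists>x\<in>T - T'. \<forall>y\<in>T' - T. x < y"
    then obtain x where x: "x \<in> T" "x \<notin> T'" "\<And>y. y \<in> T' \<Longrightarrow> y \<notin> T \<Longrightarrow> x < y" by blast
    have xS: "x \<in> S" using x(1) T(1) by (auto simp: lower_def upper_def)
    show "e < f"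
    proof (cases "T' = lower S e")
      case False
      then have T': "T' = upper S e" using T'(1) by simp
      have "T \<noteq> lower S f"
        using x(3)[of "Min S"] T' Mup conn_Min_le[OF S(1) xS] by auto
      then have "f \<notin> T" using T(1) by (auto simp: upper_def)
      then have "x < f" using x(3) inT(2) by simp
      moreover have "desc e x" using x(2) T' xS by (auto simp: upper_def)
      ultimately show ?thesis using desc_le[of e x] by simp
    qed (rule ef)
  next
    assume less: "e < f"
    note T = up[OF less]
    show "\<exists>x\<in>T - T'. \<forall>y\<in>T' - T. x < y"
    proof (cases "T' = lower S e")
      case True
      then have "Min S \<in> T - T'" using Mup T by simp
      moreover have "Min S < y" if "y \<in> T' - T" for y
        using that True Me desc_le[of e y] by (auto simp: lower_def)
      ultimately show ?thesis by blast
    next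
      case False
      then have T': "T' = upper S e" using T'(1) by simp
      then have "e \<in> T - T'" using inT by (auto simp: upper_def)
      moreover have "e < y" if "y \<in> T' - T" for y
      proof -
        have "desc f y" using that T T' by (auto simp: upper_def)
        then show ?thesis using desc_le[of f y] less by simp
      qed
      ultimately show ?thesis by blast
    qed
  qed
qed

text \<open>Let S be the parent of the removed tube T, with cuts \<open>f\<close> of S and
  \<open>e\<close> of T. The flip exchanges these two cuts, so a top edge changes only for the
  subtrees with top edge \<open>f\<close> that contain \<open>e\<close>, where it becomes the
  smaller edge \<open>e\<close>.\<close>

lemma flip_nest_le:
  assumes "(N, N') \<in> flip"
  shows "nest_le N N'"
proof -
  from assms have N: "max_nest N" "max_nest N'" by (auto simp: flip_def)
  from assms obtain T T' where T: "T \<in> N" "T \<notin> N'" and T': "T' \<in> N'" "T' \<notin> N"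
    and eq: "N - {T} = N' - {T'}" and ord: "\<exists>x\<in>T - T'. \<forall>y\<in>T' - T. x < y"
    by (auto simp: flip_def)
  note D = max_nestD[OF N(1)] and D' = max_nestD[OF N(2)]
  have both: "A \<in> N' \<longleftrightarrow> A \<in> N" if "A \<noteq> T" "A \<noteq> T'" for A using eq that by blast
  have "T \<noteq> {0..n}" using T(2) D'(2) by auto
  then obtain S where S: "S \<in> N" "T \<subset> S"
    and TS: "T = lower S (top N S) \<or> T = upper S (top N S)"
    using parent_tube[OF N(1) T(1)] by metis
  have S': "S \<in> N'" using both[of S] S T' by auto
  define e f where "e = top N T" and "f = top N S"
  have bS: "big S" and bT: "big T" using D(3) S T by auto
  note cS = big_conn[OF bS] and cT = big_conn[OF bT]
  have f: "f \<in> inner S" and e: "e \<in> inner T"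
    using top_inner[OF N(1)] bS bT by (simp_all add: e_def f_def)
  have eS: "e \<in> inner S" using inner_mono[OF cT cS] S(2) e by auto
  have fT: "f \<notin> inner T" using top_subset[OF N(1) bS T(1)] S(2) by (auto simp: f_def)
  have ef: "e \<noteq> f" using e fT by auto
  have not_top': "top N' S \<notin> inner B" if B: "B \<in> N" "B \<subset> S" "B \<noteq> T" for B
  proof
    assume "top N' S \<in> inner B"
    moreover have "B \<in> N'" using both[of B] B T' by auto
    ultimately show False using top_subset[OF N(2) bS] B(2) by blast
  qed
  \<comment> \<open>The tubes of N below S other than T survive, so none of them may contain the new
    cut of S. This leaves \<open>f\<close> and \<open>e\<close>; with \<open>f\<close> the tube T
    would reappear as a part of S.\<close>
  have "top N' S = e"
  proof (rule ccontr)
    assume ne: "top N' S \<noteq> e"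
    have t: "top N' S \<in> inner S" using top_inner[OF N(2) bS] .
    have "top N' S \<noteq> f"
      using part_in[OF N(2) S', of T] TS bT T(2) by (auto simp: f_def)
    then obtain Q where Q: "Q = lower S f \<or> Q = upper S f" "top N' S \<in> inner Q" "big Q" "Q \<subset> S"
      using part_of_inner[OF cS f t] by metis
    then have "Q \<in> N" using part_in[OF N(1) S(1)] by (simp add: f_def)
    then have "Q = T" using not_top' Q by blast
    then have "top N' S \<in> inner T" using Q by simp
    then obtain B where B: "B = lower T e \<or> B = upper T e" "top N' S \<in> inner B" "big B" "B \<subset> T"
      using part_of_inner[OF cT e _ ne] by metis
    then have "B \<in> N" using part_in[OF N(1) T(1)] by (simp add: e_def)
    then show False using not_top' B S(2) by blast
  qed
  note e' = this
  obtain Q where Q: "Q = lower S e \<or> Q = upper S e" "f \<in> inner Q" "big Q" "Q \<subset> S" "e \<notin> inner Q"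
    using part_of_inner[OF cS eS f] ef by metis
  have "Q \<in> N'" using part_in[OF N(2) S'] Q e' by simp
  moreover have "Q \<notin> N" using top_subset[OF N(1) bS] Q by (auto simp: f_def)
  ultimately have QT': "Q = T'" using both[of Q] T by auto
  have less: "e < f"
    using swap_order_iff[OF cS eS f ef TS[folded f_def] e, of T'] Q(1,2) ord by (simp add: QT')
  show ?thesis unfolding nest_le_def
  proof (intro allI impI)
    fix P assume P: "big P"
    define g where "g = top N P"
    note cP = big_conn[OF P]
    have g: "g \<in> inner P" using top_inner[OF N(1) P] by (simp add: g_def)
    have gsub: "P \<subseteq> A" if "A \<in> N" "g \<in> inner A" for A
      using top_subset[OF N(1) P that(1)] that(2) by (simp add: g_def)
    show "top N' P \<le> top N P"
    proof (cases "g = f \<and> e \<in> inner P")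
      case True
      then have "P \<subseteq> S" using gsub[OF S(1)] f by simp
      then have "top N' P = e"
        using choice_sub[OF top_choice[OF N(2)] bS cP] e' True by simp
      then show ?thesis using less True by (simp add: g_def)
    next
      case nc: False
      have "top N' P = g"
      proof (rule top_eqI[OF N(2) P g])
        fix A assume A: "A \<in> N'" "g \<in> inner A"
        show "P \<subseteq> A"
        proof (cases "A = T'")
          case False
          moreover have "A \<noteq> T" using A(1) T(2) by auto
          ultimately show ?thesis using gsub A both by blast
        next
          case True
          then have gQ: "g \<in> inner Q" using A QT' by simp
          have gS: "g \<in> inner S" using gQ inner_mono[OF big_conn[OF Q(3)] cS] Q(4) by auto
          \<comment> \<open>P is placed in Q through a subtree R between P and S that avoids
            \<open>e\<close>: P itself, a part of S cut at \<open>f\<close>, or a part of T cut at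
            \<open>e\<close>, according to the position of \<open>g\<close>.\<close>
          have *: "P \<subseteq> Q" if "conn R" "R \<subseteq> S" "e \<notin> inner R" "g \<in> inner R" "P \<subseteq> R" for R
            using part_absorb[OF cS eS Q(1) that(1-4) gQ] that(5) by simp
          have "P \<subseteq> Q"
          proof (cases "g = f")
            case True
            then show ?thesis using *[of P] cP gsub[OF S(1) gS] g nc by simp
          next
            case False
            then obtain C where C: "C = lower S f \<or> C = upper S f" "g \<in> inner C" "big C" "C \<subset> S"
              using part_of_inner[OF cS f gS] by metis
            have CN: "C \<in> N" using part_in[OF N(1) S(1)] C by (simp add: f_def)
            show ?thesis
            proof (cases "C = T")
              case CT: False
              have "inner C \<inter> inner T = {}"
                using CT C(1) TS[folded f_def] inner_split(4)[OF cS f] by auto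
              then have "e \<notin> inner C" using e by auto
              then show ?thesis using *[of C] big_conn[OF C(3)] C gsub[OF CN] by auto
            next
              case True
              have "g \<noteq> e" using gQ Q(5) by auto
              then obtain B where B: "B = lower T e \<or> B = upper T e" "g \<in> inner B" "big B" "B \<subset> T"
                  "e \<notin> inner B"
                using part_of_inner[OF cT e, of g] C(2) True by metis
              have BN: "B \<in> N" using part_in[OF N(1) T(1)] B by (simp add: e_def)
              then show ?thesis using *[of B] big_conn[OF B(3)] B gsub[OF BN] S(2) by auto
            qed
          qed
          then show ?thesis using True QT' by simp
        qed
      qed
      then show ?thesis by (simp add: g_def)
    qed
  qed
qed

text \<open>Take a common tube S whose top edges differ and let \<open>g\<close> be its top edge in
  \<open>N'\<close>. In N the edge \<open>g\<close> cuts some tube R below S; let \<open>h\<close>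
  cut the parent U of R. Exchanging the cuts \<open>h\<close> and \<open>g\<close> is the required
  flip: \<open>g < h\<close> because \<open>N'\<close> has the smaller tops, and the flip does not
  overshoot because \<open>N'\<close> cuts every subtree of U containing the edge \<open>g\<close>
  at \<open>g\<close>.\<close>

lemma exists_flip_below:
  assumes N: "max_nest N" "max_nest N'" and le: "nest_le N N'" and ne: "N \<noteq> N'"
  obtains M where "(N, M) \<in> flip" "nest_le M N'"
proof -
  note D = max_nestD[OF N(1)] and D' = max_nestD[OF N(2)]
  have n: "0 < n"
    using D(3)[OF D(2)] innerD(3,4)[OF big_conn] unfolding big_def
    by (metis all_not_in_conv less_le_trans)
  \<comment> \<open>If all common tubes had the same cut in both nestings, a maximal tube of
    \<open>N - N'\<close> would be a part of its parent in \<open>N'\<close> as well.\<close>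
  obtain S where S: "S \<in> N" "S \<in> N'" "top N S \<noteq> top N' S"
  proof (rule ccontr)
    assume "\<not> thesis"
    then have same: "\<And>S. S \<in> N \<Longrightarrow> S \<in> N' \<Longrightarrow> top N S = top N' S" using that by blast
    have "\<not> N \<subseteq> N'"
      using N ne D'(1) unfolding max_nest_def by blast
    then have "N - N' \<noteq> {}" by auto
    moreover have "finite (N - N')" using D(6) by simp
    ultimately obtain T where T: "T \<in> N - N'" and maxT: "\<forall>A\<in>N - N'. T \<subseteq> A \<longrightarrow> T = A"
      using finite_has_maximal[of "N - N'"] by blast
    have "T \<noteq> {0..n}" using T D'(2) by auto
    then obtain S where S: "S \<in> N" "T \<subset> S" "T = lower S (top N S) \<or> T = upper S (top N S)"
      using parent_tube[OF N(1), of T] T by (metis DiffE)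
    then have S': "S \<in> N'" using maxT by blast
    have "T \<in> N'"
      using part_in[OF N(2) S', of T] S(3) same[OF S(1) S'] D(3)[of T] T by simp
    then show False using T by simp
  qed
  have bS: "big S" using D(3) S by auto
  define g where "g = top N' S"
  have gS: "g \<in> inner S" using top_inner[OF N(2) bS] by (simp add: g_def)
  obtain R where R: "R \<in> N" "g \<in> inner R"
    and minR: "\<And>A. A \<in> N \<Longrightarrow> g \<in> inner A \<Longrightarrow> A \<subseteq> R \<Longrightarrow> A = R"
    using minimal_tube[OF N(1) S(1), of "\<lambda>A. g \<in> inner A"] gS by metis
  have leastR: "R \<subseteq> A" if "A \<in> N" "g \<in> inner A" for A
  proof -
    have "R \<inter> A \<noteq> {}" using R(2) that(2) by (auto simp: inner_def)
    then show ?thesis using D(5)[OF R(1) that(1)] minR[OF that] by auto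
  qed
  have bR: "big R" using D(3) R by auto
  have topR: "top N R = g" using top_eqI[OF N(1) bR R(2)] leastR by blast
  have RS: "R \<subset> S" using leastR[OF S(1) gS] topR S(3) by (auto simp: g_def)
  then have "R \<noteq> {0..n}" using big_subset[OF bS] by auto
  then obtain U where U: "U \<in> N" "R \<subset> U" "R = lower U (top N U) \<or> R = upper U (top N U)"
    and minU: "\<And>A. A \<in> N \<Longrightarrow> R \<subset> A \<Longrightarrow> U \<subseteq> A"
    using parent_tube[OF N(1) R(1)] by metis
  have US: "U \<subseteq> S" using minU[OF S(1) RS] .
  have bU: "big U" using D(3) U by auto
  note cU = big_conn[OF bU] and cR = big_conn[OF bR]
  define h where "h = top N U"
  have h: "h \<in> inner U" using top_inner[OF N(1) bU] by (simp add: h_def)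
  have hR: "h \<notin> inner R" using top_subset[OF N(1) bU R(1)] U(2) by (auto simp: h_def)
  have gh: "g \<noteq> h" using R(2) hR by auto
  have gU: "g \<in> inner U" using inner_mono[OF cR cU] U(2) R(2) by auto
  have top': "top N' P = g" if "conn P" "P \<subseteq> U" "g \<in> inner P" for P
    using choice_sub[OF top_choice[OF N(2)] bS that(1)] that US by (simp add: g_def)
  have less: "g < h"
    using le bU top'[OF cU] gU gh unfolding nest_le_def h_def by force
  \<comment> \<open>The top function of the nesting to be reached: the cut \<open>h\<close> yields
    to \<open>g\<close> wherever \<open>g\<close> is available.\<close>
  define c where "c P = (if top N P = h \<and> g \<in> inner P then g else top N P)" for P
  have hsub: "P \<subseteq> U" if "big P" "top N P = h" for P
    using top_subset[OF N(1) that(1) U(1)] that(2) h by simp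
  note tc = top_choice[OF N(1)]
  have cc: "choice c" unfolding choice_def
  proof (intro conjI allI impI)
    fix P assume "big P"
    then show "c P \<in> inner P" using top_inner[OF N(1)] by (simp add: c_def)
  next
    fix P Q assume P: "big P" and Q: "big Q" and QP: "Q \<subseteq> P" and cP: "c P \<in> inner Q"
    have tQ: "top N Q = top N P" if "top N P \<in> inner Q"
      using choice_sub[OF tc P big_conn[OF Q] QP that] .
    show "c Q = c P"
    proof (cases "top N P = h \<and> g \<in> inner P")
      case True
      then have gQ: "g \<in> inner Q" using cP by (simp add: c_def)
      show ?thesis
      proof (cases "h \<in> inner Q")
        case hQ: True
        then show ?thesis using tQ True gQ by (simp add: c_def)
      next
        case False
        have "Q \<subseteq> R"
          using part_absorb[OF cU h _ big_conn[OF Q] _ False gQ R(2)] U(3) QP hsub[OF P] True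
          by (auto simp: h_def)
        then have "top N Q = g"
          using choice_sub[OF tc bR big_conn[OF Q]] topR gQ by simp
        then show ?thesis using True gh by (simp add: c_def)
      qed
    next
      case False
      then have "c P = top N P" by (auto simp: c_def)
      moreover have "top N Q = top N P" using tQ cP calculation by simp
      moreover have "g \<in> inner P" if "g \<in> inner Q"
        using that inner_mono[OF big_conn[OF Q] big_conn[OF P] QP] by auto
      ultimately show ?thesis using False by (auto simp: c_def)
    qed
  qed
  define M where "M = of_choice c"
  have M: "max_nest M" unfolding M_def by (rule of_choice_max_nest[OF cc n])
  have topM: "top M P = c P" if "big P" for P
    unfolding M_def by (rule top_of_choice[OF cc n that])
  have cU': "c U = g" using gU by (simp add: c_def h_def)
  obtain R' where R': "R' = lower U g \<or> R' = upper U g" "h \<in> inner R'" "big R'" "R' \<subset> U"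
      "g \<notin> inner R'"
    using part_of_inner[OF cU gU h] gh by metis
  have RM: "R \<notin> M" using bU U(2) cU' R(2) unfolding M_def of_choice_def by auto
  have sub: "A \<in> M" if A: "A \<in> N" "A \<noteq> R" for A
    unfolding M_def of_choice_def
  proof (intro CollectI conjI allI impI notI)
    show "big A" using D(3) A by auto
    fix P assume P: "big P" "A \<subset> P" and cA: "c P \<in> inner A"
    have nt: "top N P \<notin> inner A" using top_subset[OF N(1) P(1) A(1)] P(2) by auto
    then have P': "top N P = h" "g \<in> inner P" "c P = g" using cA by (auto simp: c_def split: if_splits)
    then have "R \<subset> A" using leastR[OF A(1)] cA A(2) by auto
    then have "U \<subseteq> A" using minU A(1) by blast
    then have "h \<in> inner A" using h inner_mono[OF cU big_conn[OF \<open>big A\<close>]] by auto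
    then show False using nt P' by simp
  qed
  have R'M: "R' \<in> M"
    unfolding M_def
  proof (rule of_choice_parts[OF cc _ _ R'(3)])
    show "U \<in> of_choice c" using sub[OF U(1)] U(2) by (auto simp: M_def)
    show "R' = lower U (c U) \<or> R' = upper U (c U)" using R'(1) cU' by simp
  qed
  have R'N: "R' \<notin> N" using top_subset[OF N(1) bU] R'(2,4) by (auto simp: h_def)
  have sub': "A \<in> N" if A: "A \<in> M" "A \<noteq> R'" for A
  proof -
    have bA: "big A" using A max_nestD(3)[OF M] by auto
    have "A \<in> of_choice (top N)"
      unfolding of_choice_def
    proof (intro CollectI conjI allI impI notI)
      fix P assume P: "big P" "A \<subset> P" and tA: "top N P \<in> inner A"
      have "c P \<notin> inner A" using A P unfolding M_def of_choice_def by auto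
      then have P': "top N P = h" "g \<notin> inner A"
        using tA by (auto simp: c_def split: if_splits)
      then have hA: "h \<in> inner A" using tA by simp
      have "A \<subseteq> U" using hsub[OF P(1) P'(1)] P(2) by auto
      then have "A \<subset> R'"
        using part_absorb[OF cU gU R'(1) big_conn[OF bA] _ P'(2) hA R'(2)] A(2) by auto
      moreover have "top N R' = h"
        using choice_sub[OF tc bU big_conn[OF R'(3)]] R'(2,4) by (auto simp: h_def)
      then have "c R' = h" using R'(5) by (simp add: c_def)
      ultimately show False using A hA R'(3) unfolding M_def of_choice_def by auto
    qed (rule bA)
    then show ?thesis using of_choice_top[OF N(1)] by simp
  qed
  have "N - {R} = M - {R'}" using sub sub' RM R'N by blast
  moreover have "\<exists>x\<in>R - R'. \<forall>y\<in>R' - R. x < y"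
    using swap_order_iff[OF cU gU h gh U(3)[folded h_def] R(2) R'(1,2)] less by simp
  ultimately have "(N, M) \<in> flip"
    using N(1) M R(1) RM R'M R'N unfolding flip_def by blast
  moreover have "nest_le M N'"
    unfolding nest_le_def
  proof (intro allI impI)
    fix P assume P: "big P"
    show "top N' P \<le> top M P"
    proof (cases "top N P = h \<and> g \<in> inner P")
      case True
      then show ?thesis using top'[OF big_conn[OF P]] hsub[OF P] topM[OF P] by (simp add: c_def)
    next
      case False
      then have "top M P = top N P" using topM[OF P] by (auto simp: c_def)
      then show ?thesis using le P unfolding nest_le_def by simp
    qed
  qed
  ultimately show ?thesis using that by blast
qed

lemma flip_max_nest: "(N, M) \<in> flip \<Longrightarrow> max_nest N \<and> max_nest M \<and> N \<noteq> M"
  by (auto simp: flip_def)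

text \<open>Each flip makes the finite set of nestings above strictly smaller, so flipping towards
  \<open>N'\<close> ends there.\<close>

lemma flip_rtrancl_iff:
  assumes "max_nest N" "max_nest N'"
  shows "(N, N') \<in> flip\<^sup>* \<longleftrightarrow> nest_le N N'"
proof
  assume "(N, N') \<in> flip\<^sup>*"
  then show "nest_le N N'"
    by (induction rule: rtrancl_induct) (auto intro: nest_le_refl nest_le_trans flip_nest_le)
next
  assume "nest_le N N'"
  then show "(N, N') \<in> flip\<^sup>*" using assms(1)
  proof (induction "card {M. max_nest M \<and> nest_le N M}" arbitrary: N rule: less_induct)
    case less
    show ?case
    proof (cases "N = N'")
      case False
      obtain M where M: "(N, M) \<in> flip" "nest_le M N'"
        using exists_flip_below[OF less.prems(2) assms(2) less.prems(1) False] .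
      note M' = flip_max_nest[OF M(1)]
      have NM: "nest_le N M" by (rule flip_nest_le[OF M(1)])
      have "{K. max_nest K \<and> nest_le M K} \<subset> {K. max_nest K \<and> nest_le N K}"
      proof
        show "{K. max_nest K \<and> nest_le M K} \<subseteq> {K. max_nest K \<and> nest_le N K}"
          using NM nest_le_trans by blast
        have "\<not> nest_le M N" using nest_le_antisym[of N M] M' NM by blast
        then show "{K. max_nest K \<and> nest_le M K} \<noteq> {K. max_nest K \<and> nest_le N K}"
          using less.prems(2) nest_le_refl by blast
      qed
      moreover have "finite {K. max_nest K \<and> nest_le N K}"
        using finite_max_nests by simp
      ultimately have "card {K. max_nest K \<and> nest_le M K} < card {K. max_nest K \<and> nest_le N K}"
        by (simp add: psubset_card_mono)
      from less.hyps[OF this M(2)] M' have "(M, N') \<in> flip\<^sup>*" by blast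
      with M(1) show ?thesis by (rule converse_rtrancl_into_rtrancl)
    qed simp
  qed
qed

end

section \<open>Hexagons and left modular elements\<close>

text \<open>Stated for a bare relation because it is applied to the order of a lattice, to its dual
  and to the order on the elements of a closure system.\<close>

lemma finite_total_least:
  assumes "finite A" "A \<noteq> {}"
    and "\<And>x y. x \<in> A \<Longrightarrow> y \<in> A \<Longrightarrow> r x y \<or> r y x"
    and "\<And>x y z. x \<in> A \<Longrightarrow> y \<in> A \<Longrightarrow> z \<in> A \<Longrightarrow> r x y \<Longrightarrow> r y z \<Longrightarrow> r x z"
  shows "\<exists>m\<in>A. \<forall>x\<in>A. r m x"
  using assms
proof (induction A rule: finite_ne_induct)
  case (singleton a)
  then show ?case by blast
next
  case (insert a A)
  have "\<exists>m\<in>A. \<forall>x\<in>A. r m x"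
    by (rule insert.IH) (use insert.prems in \<open>blast+\<close>)
  then obtain m where m: "m \<in> A" "\<forall>x\<in>A. r m x" by blast
  have aa: "r a a" using insert.prems(1)[of a a] by simp
  from insert.prems(1)[of a m] m(1) consider "r a m" | "r m a" by blast
  then show ?case
  proof cases
    case 1
    then have "r a x" if "x \<in> A" for x using insert.prems(2)[of a m x] m that by simp
    then show ?thesis using aa by simp
  next
    case 2
    then show ?thesis using m by blast
  qed
qed

context lattice
begin

lemma lless_iff: "x \<sqsubset> y \<longleftrightarrow> x \<sqsubseteq> y \<and> x \<noteq> y"
  by (simp add: lless_def eq_is_equal)

lemma le_join1: "x \<sqsubseteq> y \<Longrightarrow> x \<in> carrier L \<Longrightarrow> y \<in> carrier L \<Longrightarrow> z \<in> carrier L \<Longrightarrow> x \<sqsubseteq> y \<squnion> z"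
  by (rule le_trans[OF _ join_left]) simp_all

lemma le_join2: "x \<sqsubseteq> z \<Longrightarrow> x \<in> carrier L \<Longrightarrow> y \<in> carrier L \<Longrightarrow> z \<in> carrier L \<Longrightarrow> x \<sqsubseteq> y \<squnion> z"
  by (rule le_trans[OF _ join_right]) simp_all

lemma meet_le1: "x \<sqsubseteq> z \<Longrightarrow> x \<in> carrier L \<Longrightarrow> y \<in> carrier L \<Longrightarrow> z \<in> carrier L \<Longrightarrow> x \<sqinter> y \<sqsubseteq> z"
  by (rule le_trans[OF meet_left]) simp_all

lemma meet_le2: "y \<sqsubseteq> z \<Longrightarrow> x \<in> carrier L \<Longrightarrow> y \<in> carrier L \<Longrightarrow> z \<in> carrier L \<Longrightarrow> x \<sqinter> y \<sqsubseteq> z"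
  by (rule le_trans[OF meet_right]) simp_all

lemma meet_eq_right_iff: "x \<in> carrier L \<Longrightarrow> y \<in> carrier L \<Longrightarrow> y \<sqinter> x = x \<longleftrightarrow> x \<sqsubseteq> y"
  using le_iff_join[of x y] meet_comm[of L x y] by auto

lemma join_eq_left_iff: "x \<in> carrier L \<Longrightarrow> y \<in> carrier L \<Longrightarrow> y \<squnion> x = y \<longleftrightarrow> x \<sqsubseteq> y"
  using le_iff_meet[of x y] join_comm[of L x y] by auto

lemma left_modular_elementD:
  assumes "left_modular_element L u" "v \<in> carrier L" "w \<in> carrier L" "v \<sqsubseteq> w" "v \<noteq> w"
  shows "(v \<squnion> u) \<sqinter> w = v \<squnion> (u \<sqinter> w)"
  using assms unfolding left_modular_element_def lless_iff by blast

text \<open>If u projected to a or b, then \<open>c \<squnion> u\<close> would lie above a; the only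
  element of the interval above both a and c is q, so
  \<open>(c \<squnion> u) \<sqinter> d = d\<close>. On the other hand
  \<open>p \<squnion> (u \<sqinter> d)\<close> lies under both b and d, hence equals p, and
  \<open>c \<squnion> (u \<sqinter> d) = c\<close>. Left modularity would force c = d.\<close>

lemma hexagon_side:
  assumes car: "p \<in> carrier L" "a \<in> carrier L" "b \<in> carrier L" "c \<in> carrier L" "d \<in> carrier L"
      "q \<in> carrier L"
    and le: "p \<sqsubseteq> a" "a \<sqsubseteq> b" "b \<sqsubseteq> q" "p \<sqsubseteq> c" "c \<sqsubseteq> d" "d \<sqsubseteq> q" and ne: "c \<noteq> d"
    and int: "\<And>z. z \<in> carrier L \<Longrightarrow> p \<sqsubseteq> z \<Longrightarrow> z \<sqsubseteq> q \<Longrightarrow> z \<in> {p, a, b, c, d, q}"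
    and nle: "\<not> a \<sqsubseteq> d" "\<not> c \<sqsubseteq> b"
    and u: "left_modular_element L u"
  shows "p \<squnion> (u \<sqinter> q) \<notin> {a, b}"
proof
  assume "p \<squnion> (u \<sqinter> q) \<in> {a, b}"
  then obtain t where t: "t = p \<squnion> (u \<sqinter> q)" "a \<sqsubseteq> t" "t \<sqsubseteq> b" "t \<in> carrier L"
    using car le by auto
  have uc: "u \<in> carrier L" using u by (simp add: left_modular_element_def)
  note tr = le_trans
  have pd: "p \<sqsubseteq> d" and pb: "p \<sqsubseteq> b" and cq: "c \<sqsubseteq> q" and aq: "a \<sqsubseteq> q"
    using le car tr[of p c d] tr[of p a b] tr[of c d q] tr[of a b q] by simp_all
  have nine: "\<not> a \<sqsubseteq> p" "\<not> a \<sqsubseteq> c" "\<not> c \<sqsubseteq> p" "\<not> c \<sqsubseteq> a" "\<not> q \<sqsubseteq> b" "\<not> q \<sqsubseteq> d" "\<not> b \<sqsubseteq> d" "\<not> d \<sqsubseteq> b"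
    using le nle car pd pb cq aq tr[of a p d] tr[of a c d] tr[of c p b] tr[of c a b]
      tr[of c q b] tr[of a q d] tr[of a b d] tr[of c d b] by auto
  have "t \<sqsubseteq> p \<squnion> u"
    unfolding t(1) using car uc by (intro join_le join_left le_join2 meet_left) simp_all
  moreover have "p \<squnion> u \<sqsubseteq> c \<squnion> u"
    using car uc le by (intro join_le le_join1 join_right) simp_all
  ultimately have "a \<sqsubseteq> c \<squnion> u"
    using t car uc tr[of a t "p \<squnion> u"] tr[of a "p \<squnion> u" "c \<squnion> u"] by simp
  then have A: "a \<sqsubseteq> (c \<squnion> u) \<sqinter> q" using car uc aq by (simp add: meet_le)
  have C: "c \<sqsubseteq> (c \<squnion> u) \<sqinter> q" using car uc cq by (simp add: meet_le join_left)
  have "(c \<squnion> u) \<sqinter> q \<in> {p, a, b, c, d, q}"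
    using int[of "(c \<squnion> u) \<sqinter> q"] A car uc le(1) tr[of p a "(c \<squnion> u) \<sqinter> q"] by (simp add: meet_right)
  then have "(c \<squnion> u) \<sqinter> q = q" using A C nle nine by auto
  then have "q \<sqsubseteq> c \<squnion> u" using car uc by (simp add: meet_eq_right_iff)
  then have "d \<sqsubseteq> c \<squnion> u" using car uc le tr[of d q "c \<squnion> u"] by simp
  then have 1: "(c \<squnion> u) \<sqinter> d = d"
    using car uc by (simp add: meet_eq_right_iff)
  define s where "s = p \<squnion> (u \<sqinter> d)"
  have sc: "s \<in> carrier L" using car uc by (simp add: s_def)
  have sd: "s \<sqsubseteq> d" unfolding s_def using car uc pd by (simp add: join_le meet_right)
  have "u \<sqinter> d \<sqsubseteq> u \<sqinter> q"
    using car uc le by (intro meet_le meet_left meet_le2) simp_all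
  then have "s \<sqsubseteq> t" unfolding s_def t(1)
    using car uc by (intro join_le join_left le_join2) simp_all
  then have sb: "s \<sqsubseteq> b" using t sc car tr[of s t b] by simp
  have "s \<sqsubseteq> q" using sd le sc car tr[of s d q] by simp
  moreover have "p \<sqsubseteq> s" using car uc by (simp add: s_def join_left)
  ultimately have "s \<in> {p, a, b, c, d, q}" using int sc by blast
  then have "s = p" using sd sb nle nine by auto
  then have "u \<sqinter> d \<sqsubseteq> p" using car uc by (simp add: s_def join_eq_left_iff)
  then have "u \<sqinter> d \<sqsubseteq> c" using car uc le tr[of "u \<sqinter> d" p c] by simp
  then have "c \<squnion> (u \<sqinter> d) = c" using car uc by (simp add: join_eq_left_iff)
  then show False using left_modular_elementD[OF u car(4,5) le(5) ne] 1 ne by simp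
qed

lemma maxchainD:
  assumes "pred_on.maxchain (carrier L) (\<lambda>x y. x \<sqsubset> y) C"
  shows "C \<subseteq> carrier L" "x \<in> C \<Longrightarrow> y \<in> C \<Longrightarrow> x \<sqsubseteq> y \<or> y \<sqsubseteq> x"
proof -
  have C: "pred_on.chain (carrier L) (\<lambda>x y. x \<sqsubset> y) C"
    using assms by (simp only: pred_on.maxchain_def)
  then show CL: "C \<subseteq> carrier L" by (simp only: pred_on.chain_def)
  assume xy: "x \<in> C" "y \<in> C"
  show "x \<sqsubseteq> y \<or> y \<sqsubseteq> x"
    using pred_on.chain_total[OF C xy] xy CL by (auto simp: lless_iff)
qed

lemma maxchain_mem:
  assumes C: "pred_on.maxchain (carrier L) (\<lambda>x y. x \<sqsubset> y) C" and x: "x \<in> carrier L"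
    and cmp: "\<And>u. u \<in> C \<Longrightarrow> x \<sqsubseteq> u \<or> u \<sqsubseteq> x"
  shows "x \<in> C"
proof (rule ccontr)
  assume "x \<notin> C"
  moreover have "pred_on.chain (carrier L) (\<lambda>x y. x \<sqsubset> y) (insert x C)"
    using C x cmp unfolding pred_on.maxchain_def pred_on.chain_def lless_iff by auto
  ultimately show False using C unfolding pred_on.maxchain_def by blast
qed

text \<open>On the chain the projection F takes only the values p and q. Let x be the last chain
  element sent to p and y the first one sent to q. Maximality puts
  \<open>(x \<squnion> a) \<sqinter> y\<close> at x or at y; the first contradicts left modularity
  of y for p < a, the second that of x for a < q.\<close>

lemma hexagon_not_left_modular:
  assumes fin: "finite (carrier L)"
    and car: "p \<in> carrier L" "a \<in> carrier L" "b \<in> carrier L" "c \<in> carrier L" "d \<in> carrier L"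
      "q \<in> carrier L"
    and le: "p \<sqsubseteq> a" "a \<sqsubseteq> b" "b \<sqsubseteq> q" "p \<sqsubseteq> c" "c \<sqsubseteq> d" "d \<sqsubseteq> q" and ne: "a \<noteq> b" "c \<noteq> d"
    and int: "\<And>z. z \<in> carrier L \<Longrightarrow> p \<sqsubseteq> z \<Longrightarrow> z \<sqsubseteq> q \<Longrightarrow> z \<in> {p, a, b, c, d, q}"
    and nle: "\<not> a \<sqsubseteq> d" "\<not> c \<sqsubseteq> b"
  shows "\<not> left_modular L"
proof
  assume "left_modular L"
  then obtain C where C: "pred_on.maxchain (carrier L) (\<lambda>x y. x \<sqsubset> y) C"
    and lm: "\<And>u. u \<in> C \<Longrightarrow> left_modular_element L u"
    unfolding left_modular_def by blast
  note CL = maxchainD(1)[OF C] and tot = maxchainD(2)[OF C]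
  note tr = le_trans
  have aq: "a \<sqsubseteq> q" and pd: "p \<sqsubseteq> d" using le car tr[of a b q] tr[of p c d] by simp_all
  have cq: "c \<sqsubseteq> q" using le car tr[of c d q] by simp
  have pq: "p \<sqsubseteq> q" using aq le car tr[of p a q] by simp
  have neq: "p \<noteq> q" "a \<noteq> q" "p \<noteq> a" using aq cq pd le nle car tr[of a q d] tr[of c q b] by auto
  define F where "F u = p \<squnion> (u \<sqinter> q)" for u
  have F: "F u = p \<or> F u = q" if u: "u \<in> C" for u
  proof -
    have uc: "u \<in> carrier L" using u CL by auto
    have "F u \<in> {p, a, b, c, d, q}"
      using int[of "F u"] car uc pq unfolding F_def by (simp add: join_left join_le meet_right)
    moreover have "F u \<notin> {a, b}" unfolding F_def
      using hexagon_side[OF car le ne(2) int nle lm[OF u]] .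
    moreover have "F u \<notin> {c, d}" unfolding F_def
      using hexagon_side[OF car(1,4,5,2,3,6) le(4-6,1-3) ne(1) _ nle(2,1) lm[OF u]] int by blast
    ultimately show ?thesis by blast
  qed
  have F2: "F u = (p \<squnion> u) \<sqinter> q" if u: "u \<in> C" for u
    unfolding F_def using left_modular_elementD[OF lm[OF u] car(1,6) pq neq(1)] by simp
  have finC: "finite C" using CL fin finite_subset by blast
  have trC: "x \<sqsubseteq> z" if "x \<in> C" "y \<in> C" "z \<in> C" "x \<sqsubseteq> y" "y \<sqsubseteq> z" for x y z
    using tr[of x y z] that CL by auto
  have least: "\<exists>m\<in>A. \<forall>x\<in>A. m \<sqsubseteq> x" if "A \<subseteq> C" "A \<noteq> {}" for A
  proof (rule finite_total_least)
    show "finite A" "A \<noteq> {}" using that finC finite_subset by blast+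
    show "x \<sqsubseteq> y \<or> y \<sqsubseteq> x" if "x \<in> A" "y \<in> A" for x y
      using tot[of x y] that \<open>A \<subseteq> C\<close> by auto
    show "x \<sqsubseteq> z" if "x \<in> A" "y \<in> A" "z \<in> A" "x \<sqsubseteq> y" "y \<sqsubseteq> z" for x y z
      using trC[of x y z] that \<open>A \<subseteq> C\<close> by auto
  qed
  have greatest: "\<exists>m\<in>A. \<forall>x\<in>A. x \<sqsubseteq> m" if "A \<subseteq> C" "A \<noteq> {}" for A
  proof (rule finite_total_least)
    show "finite A" "A \<noteq> {}" using that finC finite_subset by blast+
    show "y \<sqsubseteq> x \<or> x \<sqsubseteq> y" if "x \<in> A" "y \<in> A" for x y
      using tot[of x y] that \<open>A \<subseteq> C\<close> by auto
    show "z \<sqsubseteq> x" if "x \<in> A" "y \<in> A" "z \<in> A" "y \<sqsubseteq> x" "z \<sqsubseteq> y" for x y z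
      using trC[of z y x] that \<open>A \<subseteq> C\<close> by auto
  qed
  have Cne: "C \<noteq> {}" using maxchain_mem[OF C car(1)] by auto
  obtain m where m: "m \<in> C" "\<forall>x\<in>C. m \<sqsubseteq> x"
    using least[OF subset_refl Cne] by blast
  obtain M where M: "M \<in> C" "\<forall>x\<in>C. x \<sqsubseteq> M"
    using greatest[OF subset_refl Cne] by blast
  define A where "A = {u\<in>C. F u = p}"
  define B where "B = {u\<in>C. F u = q}"
  have AB: "C = A \<union> B" "A \<inter> B = {}" using F neq by (auto simp: A_def B_def)
  have mc: "m \<in> carrier L" "M \<in> carrier L" using m M CL by auto
  \<comment> \<open>Lying under the least element of the chain, this element is comparable with all
    of it; lying under p, it is sent to p. Dually \<open>q \<squnion> M\<close> is sent to q, so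
    both fibres of F are nonempty.\<close>
  have "p \<sqinter> m \<in> C"
  proof (rule maxchain_mem[OF C])
    fix u assume "u \<in> C"
    then show "p \<sqinter> m \<sqsubseteq> u \<or> u \<sqsubseteq> p \<sqinter> m"
      using m CL mc car meet_le2[of m u p] by auto
  qed (use mc car in simp)
  moreover have "F (p \<sqinter> m) = p"
  proof -
    have "(p \<sqinter> m) \<sqinter> q \<sqsubseteq> p" using mc car by (intro meet_le1 meet_left) simp_all
    then show ?thesis unfolding F_def using mc car by (simp add: join_eq_left_iff)
  qed
  ultimately have "A \<noteq> {}" by (auto simp: A_def)
  have "q \<squnion> M \<in> C"
  proof (rule maxchain_mem[OF C])
    fix u assume "u \<in> C"
    then show "q \<squnion> M \<sqsubseteq> u \<or> u \<sqsubseteq> q \<squnion> M"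
      using M CL mc car le_join2[of u M q] by auto
  qed (use mc car in simp)
  moreover have "F (q \<squnion> M) = q"
  proof -
    have "(q \<squnion> M) \<sqinter> q = q" using mc car by (simp add: meet_eq_right_iff join_left)
    then show ?thesis unfolding F_def using pq car by (simp add: le_iff_meet)
  qed
  ultimately have "B \<noteq> {}" by (auto simp: B_def)
  obtain x where x: "x \<in> A" "\<forall>y\<in>A. y \<sqsubseteq> x"
    using greatest[OF _ \<open>A \<noteq> {}\<close>] AB(1) by blast
  obtain y where y: "y \<in> B" "\<forall>z\<in>B. y \<sqsubseteq> z"
    using least[OF _ \<open>B \<noteq> {}\<close>] AB(1) by blast
  have xC: "x \<in> C" "F x = p" and yC: "y \<in> C" "F y = q" using x y by (auto simp: A_def B_def)
  have xc: "x \<in> carrier L" and yc: "y \<in> carrier L" using xC yC CL by auto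
  have "(p \<squnion> y) \<sqinter> q = q" using F2[OF yC(1)] yC(2) by simp
  then have qy: "q \<sqsubseteq> p \<squnion> y" using car yc by (simp add: meet_eq_right_iff)
  have xq: "x \<sqinter> q \<sqsubseteq> p" using xC(2) car xc unfolding F_def by (simp add: join_eq_left_iff)
  have nqx: "\<not> q \<sqsubseteq> p \<squnion> x"
  proof
    assume "q \<sqsubseteq> p \<squnion> x"
    then have "(p \<squnion> x) \<sqinter> q = q" using car xc by (simp add: meet_eq_right_iff)
    then show False using F2[OF xC(1)] xC(2) neq(1) by simp
  qed
  have xy: "x \<sqsubseteq> y"
  proof (rule ccontr)
    assume "\<not> x \<sqsubseteq> y"
    then have "y \<sqsubseteq> x" using tot xC yC by blast
    then have "p \<squnion> y \<sqsubseteq> p \<squnion> x"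
      using car xc yc by (intro join_le join_left le_join2) simp_all
    then show False using nqx qy car xc yc tr[of q "p \<squnion> y" "p \<squnion> x"] by simp
  qed
  define z where "z = (x \<squnion> a) \<sqinter> y"
  have zc: "z \<in> carrier L" using car xc yc by (simp add: z_def)
  have xz: "x \<sqsubseteq> z" unfolding z_def using car xc yc xy by (simp add: meet_le join_left)
  have zy: "z \<sqsubseteq> y" unfolding z_def using car xc yc by (simp add: meet_right)
  have "z \<in> C"
  proof (rule maxchain_mem[OF C zc])
    fix u assume u: "u \<in> C"
    then have uc: "u \<in> carrier L" using CL by auto
    from u AB(1) have "u \<in> A \<or> u \<in> B" by auto
    then show "z \<sqsubseteq> u \<or> u \<sqsubseteq> z"
      using x(2) y(2) xz zy tr[of u x z] tr[of z y u] uc zc xc yc by auto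
  qed
  then have "z \<in> A \<or> z \<in> B" using AB by auto
  then have "z = x \<or> z = y" using x(2) y(2) xz zy xc yc zc le_antisym[of x z] le_antisym[of y z] by auto
  then show False
  proof
    assume zx: "z = x"
    have "y \<sqinter> a \<sqsubseteq> z" unfolding z_def using car xc yc
      by (intro meet_le le_join2 meet_left meet_right) simp_all
    then have "y \<sqinter> a \<sqsubseteq> x \<sqinter> q"
      unfolding zx using car xc yc aq by (simp add: meet_le meet_le2)
    then have "y \<sqinter> a \<sqsubseteq> p" using xq car xc yc tr[of "y \<sqinter> a" "x \<sqinter> q" p] by simp
    then have "p \<squnion> (y \<sqinter> a) = p" using car yc by (simp add: join_eq_left_iff)
    moreover have "a \<sqsubseteq> p \<squnion> y" using qy aq car yc tr[of a q "p \<squnion> y"] by simp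
    then have "(p \<squnion> y) \<sqinter> a = a" using car yc by (simp add: meet_eq_right_iff)
    ultimately show False
      using left_modular_elementD[OF lm[OF yC(1)] car(1,2) le(1) neq(3)] neq(3) by simp
  next
    assume "z = y"
    then have "y \<sqsubseteq> x \<squnion> a" unfolding z_def using car xc yc by (simp add: meet_eq_right_iff)
    moreover have "p \<sqsubseteq> x \<squnion> a" using car xc le by (simp add: le_join2)
    ultimately have "p \<squnion> y \<sqsubseteq> x \<squnion> a" using car xc yc by (simp add: join_le)
    then have "q \<sqsubseteq> a \<squnion> x"
      using qy car xc yc tr[of q "p \<squnion> y" "x \<squnion> a"] join_comm[of L a x] by simp
    then have "(a \<squnion> x) \<sqinter> q = q" using car xc by (simp add: meet_eq_right_iff)
    moreover have "a \<squnion> (x \<sqinter> q) = a"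
      using xq le car xc tr[of "x \<sqinter> q" p a] by (simp add: join_eq_left_iff)
    ultimately show False
      using left_modular_elementD[OF lm[OF xC(1)] car(2,6) aq neq(2)] neq(2) by simp
  qed
qed

end

section \<open>Closure systems with a left modular chain\<close>

text \<open>Unions of members need not be members. The assumption \<open>join_before\<close>
  supplies those needed for left modularity and for meet-irreducibles: with the predecessors of the
  first element at which \<open>v\<close> and \<open>w\<close> differ.\<close>

locale ordered_closure_system =
  fixes K :: "'e set set" and E :: "'e set" and lt :: "'e \<Rightarrow> 'e \<Rightarrow> bool"
  assumes finite_E: "finite E"
    and K_sub: "A \<in> K \<Longrightarrow> A \<subseteq> E"
    and E_in: "E \<in> K"
    and Int_in: "A \<in> K \<Longrightarrow> B \<in> K \<Longrightarrow> A \<inter> B \<in> K"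
    and lt_trans: "a \<in> E \<Longrightarrow> b \<in> E \<Longrightarrow> c \<in> E \<Longrightarrow> lt a b \<Longrightarrow> lt b c \<Longrightarrow> lt a c"
    and lt_irrefl: "a \<in> E \<Longrightarrow> \<not> lt a a"
    and lt_total: "a \<in> E \<Longrightarrow> b \<in> E \<Longrightarrow> a \<noteq> b \<Longrightarrow> lt a b \<or> lt b a"
    and before_in: "q \<in> E \<Longrightarrow> {e\<in>E. lt e q} \<in> K"
    and upto_in: "q \<in> E \<Longrightarrow> insert q {e\<in>E. lt e q} \<in> K"
    and join_before: "v \<in> K \<Longrightarrow> w \<in> K \<Longrightarrow> v \<subseteq> w \<Longrightarrow> q \<in> w - v \<Longrightarrow>
          \<forall>e\<in>w - v. \<not> lt e q \<Longrightarrow> v \<union> {e\<in>E. lt e q} \<in> K"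
    and max_avoiding: "q \<in> E \<Longrightarrow> \<exists>m\<in>K. {e\<in>E. lt e q} \<subseteq> m \<and> q \<notin> m \<and>
          (\<forall>y\<in>K. {e\<in>E. lt e q} \<subseteq> y \<longrightarrow> q \<notin> y \<longrightarrow> y \<subseteq> m)"
begin

definition before :: "'e \<Rightarrow> 'e set" where
  "before q = {e\<in>E. lt e q}"

definition cov :: "'e set \<Rightarrow> 'e set \<Rightarrow> bool" where
  "cov A B \<longleftrightarrow> A \<in> K \<and> B \<in> K \<and> A \<subset> B \<and> \<not> (\<exists>C\<in>K. A \<subset> C \<and> C \<subset> B)"

definition gen :: "'e set \<Rightarrow> 'e set" where
  "gen A = \<Inter>{B\<in>K. A \<subseteq> B}"

lemma lt_asym: "a \<in> E \<Longrightarrow> b \<in> E \<Longrightarrow> lt a b \<Longrightarrow> \<not> lt b a"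
  using lt_trans lt_irrefl by blast

lemma finite_K: "finite K"
  by (rule finite_subset[of _ "Pow E"]) (use K_sub finite_E in auto)

lemma exists_first:
  assumes "D \<subseteq> E" "D \<noteq> {}"
  obtains q where "q \<in> D" "\<forall>e\<in>D. \<not> lt e q" "before q \<inter> D = {}"
proof -
  have "\<exists>q\<in>D. \<forall>e\<in>D. q = e \<or> lt q e"
  proof (rule finite_total_least)
    show "finite D" "D \<noteq> {}" using assms finite_E finite_subset by blast+
    show "(x = y \<or> lt x y) \<or> (y = x \<or> lt y x)" if "x \<in> D" "y \<in> D" for x y
      using lt_total[of x y] that assms(1) by auto
    show "x = z \<or> lt x z" if "x \<in> D" "y \<in> D" "z \<in> D" "x = y \<or> lt x y" "y = z \<or> lt y z" for x y z
      using lt_trans[of x y z] that assms(1) by auto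
  qed
  then obtain q where q: "q \<in> D" "\<And>e. e \<in> D \<Longrightarrow> q = e \<or> lt q e" by blast
  have "\<not> lt e q" if "e \<in> D" for e
    using q(2)[OF that] lt_asym[of e q] lt_irrefl[of q] q(1) that assms(1) by auto
  then show ?thesis using that[of q] q(1) by (auto simp: before_def)
qed

lemma Inter_in: "F \<subseteq> K \<Longrightarrow> F \<noteq> {} \<Longrightarrow> \<Inter>F \<in> K"
proof -
  assume "F \<subseteq> K" "F \<noteq> {}"
  moreover have "finite F" using \<open>F \<subseteq> K\<close> finite_K finite_subset by blast
  moreover have "finite G \<Longrightarrow> G \<noteq> {} \<Longrightarrow> G \<subseteq> K \<Longrightarrow> \<Inter>G \<in> K" for G
    by (induction G rule: finite_ne_induct) (auto intro: Int_in)
  ultimately show ?thesis by blast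
qed

lemma gen_in: "A \<subseteq> E \<Longrightarrow> gen A \<in> K"
  unfolding gen_def using E_in by (intro Inter_in) auto

lemma gen_sup: "A \<subseteq> gen A"
  unfolding gen_def by blast

lemma gen_least: "B \<in> K \<Longrightarrow> A \<subseteq> B \<Longrightarrow> gen A \<subseteq> B"
  unfolding gen_def by blast

section \<open>Join-irreducible and meet-irreducible members\<close>

lemma exists_cov_above:
  assumes "A \<in> K" "B \<in> K" "A \<subset> B"
  obtains C where "cov A C" "C \<subseteq> B"
proof -
  let ?F = "{C\<in>K. A \<subset> C \<and> C \<subseteq> B}"
  have "finite ?F" "?F \<noteq> {}" using finite_K assms by auto
  from finite_has_minimal[OF this] obtain C where C: "C \<in> ?F" "\<forall>D\<in>?F. D \<subseteq> C \<longrightarrow> C = D" ..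
  have "\<not> (\<exists>D\<in>K. A \<subset> D \<and> D \<subset> C)"
  proof
    assume "\<exists>D\<in>K. A \<subset> D \<and> D \<subset> C"
    then obtain D where D: "D \<in> K" "A \<subset> D" "D \<subset> C" by blast
    then have "D \<in> ?F" using C(1) by auto
    then show False using C(2) D(3) by blast
  qed
  then have "cov A C" using C(1) assms(1) unfolding cov_def by blast
  then show ?thesis using that C(1) by blast
qed

lemma exists_cov_below:
  assumes "A \<in> K" "B \<in> K" "A \<subset> B"
  obtains C where "cov C B" "A \<subseteq> C"
proof -
  let ?F = "{C\<in>K. A \<subseteq> C \<and> C \<subset> B}"
  have "finite ?F" "?F \<noteq> {}" using finite_K assms by auto
  from finite_has_maximal[OF this] obtain C where C: "C \<in> ?F" "\<forall>D\<in>?F. C \<subseteq> D \<longrightarrow> C = D" ..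
  have "\<not> (\<exists>D\<in>K. C \<subset> D \<and> D \<subset> B)"
  proof
    assume "\<exists>D\<in>K. C \<subset> D \<and> D \<subset> B"
    then obtain D where D: "D \<in> K" "C \<subset> D" "D \<subset> B" by blast
    then have "D \<in> ?F" using C(1) by auto
    then show False using C(2) D(2) by blast
  qed
  then have "cov C B" using C(1) assms(2) unfolding cov_def by blast
  then show ?thesis using that C(1) by blast
qed

text \<open>The last element of \<open>gen {q}\<close> is q, and intersecting with the predecessors
  of q removes just q; this gives the unique lower cover, and q can be read off. Conversely, an
  element of A outside its unique lower cover generates A, since otherwise the member it generates
  would lie in that cover.\<close>

lemma card_join_irr: "card {A\<in>K. \<exists>!B. cov B A} = card E"
proof -
  have gen_q: "gen {q} \<subseteq> insert q (before q)" "q \<in> gen {q}" "gen {q} \<in> K" if "q \<in> E" for q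
    using gen_least[OF upto_in[OF that], of "{q}"] gen_sup[of "{q}"] gen_in[of "{q}"] that
    by (auto simp: before_def)
  have "bij_betw (\<lambda>q. gen {q}) E {A\<in>K. \<exists>!B. cov B A}"
    unfolding bij_betw_def
  proof
    show "inj_on (\<lambda>q. gen {q}) E"
    proof (rule inj_onI)
      fix q r assume qr: "q \<in> E" "r \<in> E" "gen {q} = gen {r}"
      then have "q = r \<or> lt q r" "r = q \<or> lt r q"
        using gen_q[of q] gen_q[of r] by (auto simp: before_def)
      then show "q = r" using lt_asym qr by blast
    qed
    show "(\<lambda>q. gen {q}) ` E = {A\<in>K. \<exists>!B. cov B A}"
    proof (intro equalityI subsetI)
      fix A assume "A \<in> (\<lambda>q. gen {q}) ` E"
      then obtain q where q: "q \<in> E" "A = gen {q}" by blast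
      have "A \<inter> before q \<in> K" using Int_in[OF gen_q(3)[OF q(1)] before_in[OF q(1)]] q(2)
        by (simp add: before_def)
      moreover have "A \<inter> before q = A - {q}"
        using gen_q(1)[OF q(1)] q lt_irrefl[OF q(1)] by (auto simp: before_def)
      ultimately have K': "A - {q} \<in> K" by simp
      have below: "B \<subseteq> A - {q}" if "B \<in> K" "B \<subset> A" for B
        using gen_least[OF that(1), of "{q}"] that q(2) by blast
      have "cov (A - {q}) A"
        unfolding cov_def using K' gen_q[OF q(1)] q(2) below by blast
      moreover have "B = A - {q}" if "cov B A" for B
        using that below[of B] K' gen_q(2)[OF q(1)] q(2) unfolding cov_def by blast
      ultimately show "A \<in> {A\<in>K. \<exists>!B. cov B A}" using gen_q(3)[OF q(1)] q(2) by blast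
    next
      fix A assume A: "A \<in> {A\<in>K. \<exists>!B. cov B A}"
      then obtain B where B: "cov B A" and uniq: "\<And>C. cov C A \<Longrightarrow> C = B" by blast
      then obtain q where q: "q \<in> A" "q \<notin> B" unfolding cov_def by blast
      have qE: "q \<in> E" using q(1) A K_sub by blast
      have "A = gen {q}"
      proof (rule ccontr)
        assume "A \<noteq> gen {q}"
        then have "gen {q} \<subset> A" using gen_least[of A "{q}"] A q(1) by blast
        then obtain C where "cov C A" "gen {q} \<subseteq> C"
          using exists_cov_below[OF gen_q(3)[OF qE]] A by blast
        then show False using uniq[of C] q(2) gen_q(2)[OF qE] by blast
      qed
      then show "A \<in> (\<lambda>q. gen {q}) ` E" using qE by blast
    qed
  qed
  then show ?thesis by (simp add: bij_betw_same_card)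
qed

definition avoid :: "'e \<Rightarrow> 'e set" where
  "avoid q = (SOME m. m \<in> K \<and> before q \<subseteq> m \<and> q \<notin> m \<and>
     (\<forall>y\<in>K. before q \<subseteq> y \<longrightarrow> q \<notin> y \<longrightarrow> y \<subseteq> m))"

lemma avoidD:
  assumes "q \<in> E"
  shows "avoid q \<in> K" "before q \<subseteq> avoid q" "q \<notin> avoid q"
    "\<And>y. y \<in> K \<Longrightarrow> before q \<subseteq> y \<Longrightarrow> q \<notin> y \<Longrightarrow> y \<subseteq> avoid q"
proof -
  have "\<exists>m. m \<in> K \<and> before q \<subseteq> m \<and> q \<notin> m \<and>
      (\<forall>y\<in>K. before q \<subseteq> y \<longrightarrow> q \<notin> y \<longrightarrow> y \<subseteq> m)"
    using max_avoiding[OF assms] unfolding before_def by blast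
  from someI_ex[OF this] show "avoid q \<in> K" "before q \<subseteq> avoid q" "q \<notin> avoid q"
    "\<And>y. y \<in> K \<Longrightarrow> before q \<subseteq> y \<Longrightarrow> q \<notin> y \<Longrightarrow> y \<subseteq> avoid q"
    unfolding avoid_def by blast+
qed

text \<open>The first element missing from \<open>avoid q\<close> is q, whence injectivity. If A has
  the unique upper cover B and q is the first element missing from A, then A is
  \<open>avoid q\<close>: otherwise B would also avoid q, and with p the first element of
  \<open>B - A\<close>, which comes after q, the member \<open>A \<union> before p\<close> would be
  larger than A without containing B.\<close>

lemma card_meet_irr: "card {A\<in>K. \<exists>!B. cov A B} = card E"
proof -
  have "bij_betw avoid E {A\<in>K. \<exists>!B. cov A B}"
    unfolding bij_betw_def
  proof
    show "inj_on avoid E"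
    proof (rule inj_onI)
      fix q r assume qr: "q \<in> E" "r \<in> E" "avoid q = avoid r"
      then have "\<not> lt q r" "\<not> lt r q"
        using avoidD(2,3)[of q] avoidD(2,3)[of r] by (auto simp: before_def)
      then show "q = r" using lt_total qr by blast
    qed
    show "avoid ` E = {A\<in>K. \<exists>!B. cov A B}"
    proof (intro equalityI subsetI)
      fix A assume "A \<in> avoid ` E"
      then obtain q where q: "q \<in> E" "A = avoid q" by blast
      note m = avoidD[OF q(1), folded q(2)]
      have above: "q \<in> B" if "B \<in> K" "A \<subset> B" for B
        using m(4)[of B] m(2) that by blast
      define G where "G = gen (insert q A)"
      have sub: "insert q A \<subseteq> E" using q(1) K_sub[OF m(1)] by simp
      have G: "G \<in> K" "A \<subset> G"
        using gen_in[OF sub] gen_sup[of "insert q A"] m(3) by (auto simp: G_def)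
      have Gmin: "G \<subseteq> B" if "B \<in> K" "A \<subset> B" for B
        using gen_least[OF that(1), of "insert q A"] above[OF that] that(2) by (auto simp: G_def)
      have "cov A G" unfolding cov_def using G Gmin m(1) by blast
      moreover have "B = G" if "cov A B" for B
        using that Gmin[of B] G unfolding cov_def by blast
      ultimately show "A \<in> {A\<in>K. \<exists>!B. cov A B}" using m(1) by blast
    next
      fix A assume A: "A \<in> {A\<in>K. \<exists>!B. cov A B}"
      then obtain B where B: "cov A B" and uniq: "\<And>C. cov A C \<Longrightarrow> C = B" by blast
      have AK: "A \<in> K" and BK: "B \<in> K" and AB: "A \<subset> B" using B by (auto simp: cov_def)
      have least: "B \<subseteq> C" if C: "C \<in> K" "A \<subset> C" for C
      proof -
        obtain D where D: "cov A D" "D \<subseteq> C" using exists_cov_above[OF AK C] .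
        then show ?thesis using uniq[OF D(1)] by simp
      qed
      have ne: "E - A \<noteq> {}" using AB K_sub[OF BK] by blast
      obtain q where q: "q \<in> E - A" "\<forall>e\<in>E - A. \<not> lt e q" "before q \<inter> (E - A) = {}"
        using exists_first[OF Diff_subset ne] .
      have qE: "q \<in> E" and bq: "before q \<subseteq> A" using q(1,3) by (auto simp: before_def)
      note m = avoidD[OF qE]
      have "A = avoid q"
      proof (rule ccontr)
        assume ne: "A \<noteq> avoid q"
        moreover have "A \<subseteq> avoid q" using m(4)[OF AK bq] q(1) by blast
        ultimately have "B \<subseteq> avoid q" using least[OF m(1)] by blast
        then have qB: "q \<notin> B" using m(3) by blast
        have D: "B - A \<subseteq> E" "B - A \<noteq> {}" using AB K_sub[OF BK] by auto
        obtain p where p: "p \<in> B - A" "\<forall>e\<in>B - A. \<not> lt e p" "before p \<inter> (B - A) = {}"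
          using exists_first[OF D] .
        have pE: "p \<in> E" using p(1) K_sub[OF BK] by blast
        have "\<not> lt p q" using bq p(1) pE by (auto simp: before_def)
        then have "lt q p" using lt_total[OF qE pE] p(1) qB by blast
        have J: "A \<union> before p \<in> K"
          using join_before[OF AK BK _ p(1,2)] AB unfolding before_def by blast
        moreover have "A \<subset> A \<union> before p" using \<open>lt q p\<close> q(1) by (auto simp: before_def)
        ultimately have "B \<subseteq> A \<union> before p" using least by blast
        then show False using p(1) lt_irrefl[OF pE] by (auto simp: before_def)
      qed
      then show "A \<in> avoid ` E" using qE by blast
    qed
  qed
  then show ?thesis by (simp add: bij_betw_same_card)
qed

text \<open>The initial segments of \<open>lt\<close> form the left modular chain.\<close>

definition flag :: "'e set set" where
  "flag = insert E (before ` E)"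

lemma flag_in: "flag \<subseteq> K"
  using E_in before_in by (auto simp: flag_def before_def)

lemma before_mono: "q \<in> E \<Longrightarrow> r \<in> E \<Longrightarrow> lt q r \<Longrightarrow> before q \<subset> before r"
  using lt_trans lt_irrefl unfolding before_def by blast

lemma flag_total: "A \<in> flag \<Longrightarrow> B \<in> flag \<Longrightarrow> A \<subset> B \<or> A = B \<or> B \<subset> A"
proof -
  have lt_E: "before q \<subset> E" if "q \<in> E" for q
    using lt_irrefl that unfolding before_def by blast
  have "before q \<subset> before r \<or> before q = before r \<or> before r \<subset> before q"
    if "q \<in> E" "r \<in> E" for q r
    using lt_total[OF that] before_mono that by blast
  then show "A \<in> flag \<Longrightarrow> B \<in> flag \<Longrightarrow> A \<subset> B \<or> A = B \<or> B \<subset> A"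
    using lt_E unfolding flag_def by blast
qed

lemma card_flag: "card flag = Suc (card E)"
proof -
  have "inj_on before E"
    using before_mono lt_total by (intro inj_onI) blast
  moreover have "E \<notin> before ` E"
    using lt_irrefl unfolding before_def by blast
  ultimately show ?thesis unfolding flag_def using finite_E by (simp add: card_image)
qed

lemma flag_avoids:
  assumes "u \<in> flag" "q \<in> E" "q \<notin> u"
  shows "u \<subseteq> before q"
proof -
  obtain r where r: "r \<in> E" "u = before r" using assms by (auto simp: flag_def)
  then have "r = q \<or> lt r q" using assms lt_total[of r q] by (auto simp: before_def)
  then show ?thesis using r assms(2) before_mono by blast
qed

section \<open>Transport of the closure system to a lattice\<close>

lemma chain_card_le:
  assumes "\<C> \<subseteq> Pow E" "\<And>A B. A \<in> \<C> \<Longrightarrow> B \<in> \<C> \<Longrightarrow> A \<subset> B \<or> A = B \<or> B \<subset> A"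
  shows "card \<C> \<le> Suc (card E)"
proof -
  have fin: "finite A" if "A \<in> \<C>" for A using assms(1) that finite_E finite_subset by blast
  have "inj_on card \<C>"
  proof (rule inj_onI)
    fix A B assume AB: "A \<in> \<C>" "B \<in> \<C>" "card A = card B"
    then show "A = B"
      using assms(2)[OF AB(1,2)] psubset_card_mono[OF fin[OF AB(1)], of B]
        psubset_card_mono[OF fin[OF AB(2)], of A] by auto
  qed
  moreover have "card ` \<C> \<subseteq> {..card E}"
    using assms(1) by (auto intro!: card_mono[OF finite_E])
  ultimately have "card \<C> \<le> card {..card E}" by (intro card_inj_on_le) auto
  then show ?thesis by simp
qed

theorem trim_of_order_embedding:
  fixes L :: "('a, 'b) gorder_scheme" and \<phi> :: "'a \<Rightarrow> 'e set"
  assumes eq: "eq L = (=)"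
    and le: "\<And>x y. x \<in> carrier L \<Longrightarrow> y \<in> carrier L \<Longrightarrow> x \<sqsubseteq>\<^bsub>L\<^esub> y \<longleftrightarrow> \<phi> x \<subseteq> \<phi> y"
    and bij: "bij_betw \<phi> (carrier L) K"
  shows "trim L"
proof -
  have inj: "\<phi> x = \<phi> y \<longleftrightarrow> x = y" if "x \<in> carrier L" "y \<in> carrier L" for x y
    using bij that unfolding bij_betw_def inj_on_def by blast
  have \<phi>K: "\<phi> x \<in> K" if "x \<in> carrier L" for x
    using bij that unfolding bij_betw_def by blast
  define \<psi> where "\<psi> = inv_into (carrier L) \<phi>"
  have \<psi>: "\<psi> A \<in> carrier L" "\<phi> (\<psi> A) = A" if "A \<in> K" for A
    using bij that unfolding \<psi>_def bij_betw_def by (metis inv_into_into f_inv_into_f)+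
  have less: "x \<sqsubset>\<^bsub>L\<^esub> y \<longleftrightarrow> \<phi> x \<subset> \<phi> y" if "x \<in> carrier L" "y \<in> carrier L" for x y
    using le[OF that] inj[OF that] by (auto simp: lless_def eq)
  have glb: "greatest L (\<psi> (\<phi> x \<inter> \<phi> y)) (Lower L {x, y})"
    if "x \<in> carrier L" "y \<in> carrier L" for x y
    using that \<psi>[OF Int_in[OF \<phi>K[OF that(1)] \<phi>K[OF that(2)]]] le
    unfolding greatest_def Lower_def by auto
  have gen2: "gen (\<phi> x \<union> \<phi> y) \<in> K" if "x \<in> carrier L" "y \<in> carrier L" for x y
    using gen_in[of "\<phi> x \<union> \<phi> y"] K_sub \<phi>K that by auto
  have lub: "least L (\<psi> (gen (\<phi> x \<union> \<phi> y))) (Upper L {x, y})"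
    if "x \<in> carrier L" "y \<in> carrier L" for x y
  proof -
    note G = \<psi>[OF gen2[OF that]] gen_sup[of "\<phi> x \<union> \<phi> y"]
    have *: "gen (\<phi> x \<union> \<phi> y) \<subseteq> \<phi> z"
      if "z \<in> carrier L" "x \<sqsubseteq>\<^bsub>L\<^esub> z" "y \<sqsubseteq>\<^bsub>L\<^esub> z" for z
      using gen_least[OF \<phi>K[OF that(1)], of "\<phi> x \<union> \<phi> y"] le that \<open>x \<in> carrier L\<close> \<open>y \<in> carrier L\<close>
      by simp
    have U: "Upper L {x, y} = {z\<in>carrier L. x \<sqsubseteq>\<^bsub>L\<^esub> z \<and> y \<sqsubseteq>\<^bsub>L\<^esub> z}"
      using that by (auto simp: Upper_def)
    show ?thesis
      unfolding least_def
    proof (intro conjI ballI)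
      show "Upper L {x, y} \<subseteq> carrier L" by (auto simp: U)
      show "\<psi> (gen (\<phi> x \<union> \<phi> y)) \<in> Upper L {x, y}" using that G le by (simp add: U)
      fix z assume "z \<in> Upper L {x, y}"
      then have z: "z \<in> carrier L" "x \<sqsubseteq>\<^bsub>L\<^esub> z" "y \<sqsubseteq>\<^bsub>L\<^esub> z" by (auto simp: U)
      show "\<psi> (gen (\<phi> x \<union> \<phi> y)) \<sqsubseteq>\<^bsub>L\<^esub> z" using le[OF G(1) z(1)] *[OF z] G(2) by simp
    qed
  qed
  interpret L: lattice L
  proof
    show "x .=\<^bsub>L\<^esub> x" for x by (simp add: eq)
    show "x .=\<^bsub>L\<^esub> y \<Longrightarrow> y .=\<^bsub>L\<^esub> x" for x y by (simp add: eq)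
    show "x .=\<^bsub>L\<^esub> y \<Longrightarrow> y .=\<^bsub>L\<^esub> z \<Longrightarrow> x .=\<^bsub>L\<^esub> z" for x y z by (simp add: eq)
    show "(.=\<^bsub>L\<^esub>) = (=)" by (simp add: eq)
    show "x \<sqsubseteq>\<^bsub>L\<^esub> x" if "x \<in> carrier L" for x using le that by simp
    show "x .=\<^bsub>L\<^esub> y" if "x \<sqsubseteq>\<^bsub>L\<^esub> y" "y \<sqsubseteq>\<^bsub>L\<^esub> x" "x \<in> carrier L" "y \<in> carrier L" for x y
    proof -
      have "\<phi> x = \<phi> y" using that(1,2) unfolding le[OF that(3,4)] le[OF that(4,3)] by (rule subset_antisym)
      then show ?thesis using inj[OF that(3,4)] unfolding eq by blast
    qed
    show "x \<sqsubseteq>\<^bsub>L\<^esub> z" if "x \<sqsubseteq>\<^bsub>L\<^esub> y" "y \<sqsubseteq>\<^bsub>L\<^esub> z" "x \<in> carrier L" "y \<in> carrier L" "z \<in> carrier L"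
      for x y z
      using that(1,2) unfolding le[OF that(3,4)] le[OF that(4,5)] le[OF that(3,5)] by (rule subset_trans)
    show "x \<sqsubseteq>\<^bsub>L\<^esub> z \<longleftrightarrow> y \<sqsubseteq>\<^bsub>L\<^esub> w" if "x .=\<^bsub>L\<^esub> y" "z .=\<^bsub>L\<^esub> w" for x y z w
      using that by (simp add: eq)
    show "\<exists>s. least L s (Upper L {x, y})" if "x \<in> carrier L" "y \<in> carrier L" for x y
      using lub[OF that] by blast
    show "\<exists>s. greatest L s (Lower L {x, y})" if "x \<in> carrier L" "y \<in> carrier L" for x y
      using glb[OF that] by blast
  qed
  have meet: "\<phi> (x \<sqinter>\<^bsub>L\<^esub> y) = \<phi> x \<inter> \<phi> y" if "x \<in> carrier L" "y \<in> carrier L" for x y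
  proof (rule L.meetI[OF _ that])
    fix i assume "greatest L i (Lower L {x, y})"
    then have "i = \<psi> (\<phi> x \<inter> \<phi> y)" using glb[OF that] L.greatest_unique by blast
    then show "\<phi> i = \<phi> x \<inter> \<phi> y" using \<psi>(2)[OF Int_in[OF \<phi>K \<phi>K]] that by simp
  qed
  have "finite (carrier L)" using bij finite_K bij_betw_finite by blast
  moreover have J: "card (join_irreducibles L) = card E" and M: "card (meet_irreducibles L) = card E"
  proof -
    have cb: "covered_by L x y \<longleftrightarrow> cov (\<phi> x) (\<phi> y)" if "x \<in> carrier L" "y \<in> carrier L" for x y
    proof -
      have "(\<exists>z\<in>carrier L. x \<sqsubset>\<^bsub>L\<^esub> z \<and> z \<sqsubset>\<^bsub>L\<^esub> y) \<longleftrightarrow> (\<exists>C\<in>K. \<phi> x \<subset> C \<and> C \<subset> \<phi> y)"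
        using less that \<psi> \<phi>K by metis
      then show ?thesis
        unfolding covered_by_def cov_def using less[OF that] that \<phi>K by blast
    qed
    have img: "\<phi> ` {x \<in> carrier L. P x} = {A\<in>K. Q A}"
      if "\<And>x. x \<in> carrier L \<Longrightarrow> P x \<longleftrightarrow> Q (\<phi> x)" for P Q
    proof -
      have "K = \<phi> ` carrier L" using bij by (simp add: bij_betw_def)
      then show ?thesis using that by auto
    qed
    have carr: "covered_by L x y \<Longrightarrow> x \<in> carrier L \<and> y \<in> carrier L" for x y
      by (simp add: covered_by_def)
    have "(\<exists>!y. covered_by L y x) \<longleftrightarrow> (\<exists>!B. cov B (\<phi> x))" if x: "x \<in> carrier L" for x
    proof
      assume "\<exists>!y. covered_by L y x"
      then obtain y where y: "covered_by L y x" "\<And>z. covered_by L z x \<Longrightarrow> z = y" by blast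
      show "\<exists>!B. cov B (\<phi> x)"
      proof (rule ex1I)
        show "cov (\<phi> y) (\<phi> x)" using y(1) cb carr by blast
        fix B assume B: "cov B (\<phi> x)"
        then have BK: "B \<in> K" by (simp add: cov_def)
        then have "covered_by L (\<psi> B) x" using B cb[OF \<psi>(1)[OF BK] x] \<psi>(2)[OF BK] by simp
        then have "\<psi> B = y" by (rule y(2))
        then show "B = \<phi> y" using \<psi>(2)[OF BK] by simp
      qed
    next
      assume "\<exists>!B. cov B (\<phi> x)"
      then obtain B where B: "cov B (\<phi> x)" "\<And>C. cov C (\<phi> x) \<Longrightarrow> C = B" by blast
      have BK: "B \<in> K" using B(1) by (simp add: cov_def)
      show "\<exists>!y. covered_by L y x"
      proof (rule ex1I)
        show "covered_by L (\<psi> B) x" using B(1) cb[OF \<psi>(1)[OF BK] x] \<psi>(2)[OF BK] by simp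
        fix y assume y: "covered_by L y x"
        then have "\<phi> y = B" using cb carr B(2) by blast
        then show "y = \<psi> B" using inj[of y "\<psi> B"] \<psi>[OF BK] carr[OF y] by simp
      qed
    qed
    then have "\<phi> ` join_irreducibles L = {A\<in>K. \<exists>!B. cov B A}"
      unfolding join_irreducibles_def by (rule img)
    moreover have "inj_on \<phi> (join_irreducibles L)"
      using bij unfolding bij_betw_def join_irreducibles_def by (auto intro: inj_on_subset)
    ultimately show "card (join_irreducibles L) = card E"
      using card_join_irr card_image[of \<phi> "join_irreducibles L"] by simp
    have "(\<exists>!y. covered_by L x y) \<longleftrightarrow> (\<exists>!B. cov (\<phi> x) B)" if x: "x \<in> carrier L" for x
    proof
      assume "\<exists>!y. covered_by L x y"
      then obtain y where y: "covered_by L x y" "\<And>z. covered_by L x z \<Longrightarrow> z = y" by blast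
      show "\<exists>!B. cov (\<phi> x) B"
      proof (rule ex1I)
        show "cov (\<phi> x) (\<phi> y)" using y(1) cb carr by blast
        fix B assume B: "cov (\<phi> x) B"
        then have BK: "B \<in> K" by (simp add: cov_def)
        then have "covered_by L x (\<psi> B)" using B cb[OF x \<psi>(1)[OF BK]] \<psi>(2)[OF BK] by simp
        then have "\<psi> B = y" by (rule y(2))
        then show "B = \<phi> y" using \<psi>(2)[OF BK] by simp
      qed
    next
      assume "\<exists>!B. cov (\<phi> x) B"
      then obtain B where B: "cov (\<phi> x) B" "\<And>C. cov (\<phi> x) C \<Longrightarrow> C = B" by blast
      have BK: "B \<in> K" using B(1) by (simp add: cov_def)
      show "\<exists>!y. covered_by L x y"
      proof (rule ex1I)
        show "covered_by L x (\<psi> B)" using B(1) cb[OF x \<psi>(1)[OF BK]] \<psi>(2)[OF BK] by simp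
        fix y assume y: "covered_by L x y"
        then have "\<phi> y = B" using cb carr B(2) by blast
        then show "y = \<psi> B" using inj[of y "\<psi> B"] \<psi>[OF BK] carr[OF y] by simp
      qed
    qed
    then have "\<phi> ` meet_irreducibles L = {A\<in>K. \<exists>!B. cov A B}"
      unfolding meet_irreducibles_def by (rule img)
    moreover have "inj_on \<phi> (meet_irreducibles L)"
      using bij unfolding bij_betw_def meet_irreducibles_def by (auto intro: inj_on_subset)
    ultimately show "card (meet_irreducibles L) = card E"
      using card_meet_irr card_image[of \<phi> "meet_irreducibles L"] by simp
  qed
  define F where "F = \<psi> ` flag"
  have chain_bound: "card C \<le> Suc (card E)"
    if C: "pred_on.chain (carrier L) (\<lambda>x y. x \<sqsubset>\<^bsub>L\<^esub> y) C" for C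
  proof -
    have CL: "C \<subseteq> carrier L" using C by (simp only: pred_on.chain_def)
    have "card (\<phi> ` C) \<le> Suc (card E)"
    proof (rule chain_card_le)
      show "\<phi> ` C \<subseteq> Pow E" using CL \<phi>K K_sub by blast
      fix A B assume "A \<in> \<phi> ` C" "B \<in> \<phi> ` C"
      then obtain x y where xy: "x \<in> C" "y \<in> C" "A = \<phi> x" "B = \<phi> y" by blast
      then show "A \<subset> B \<or> A = B \<or> B \<subset> A"
        using pred_on.chain_total[OF C xy(1,2)] less[of x y] less[of y x] CL by auto
    qed
    moreover have "inj_on \<phi> C" using bij CL unfolding bij_betw_def by (auto intro: inj_on_subset)
    ultimately show ?thesis by (simp add: card_image)
  qed
  have F: "pred_on.chain (carrier L) (\<lambda>x y. x \<sqsubset>\<^bsub>L\<^esub> y) F"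
  proof (rule pred_on.chainI)
    show "F \<subseteq> carrier L" using \<psi>(1) flag_in by (auto simp: F_def)
    fix x y assume "x \<in> F" "y \<in> F"
    then obtain A B where AB: "A \<in> flag" "B \<in> flag" "x = \<psi> A" "y = \<psi> B" by (auto simp: F_def)
    then have K: "A \<in> K" "B \<in> K" using flag_in by auto
    show "(\<lambda>x y. x \<sqsubset>\<^bsub>L\<^esub> y)\<^sup>=\<^sup>= x y \<or> (\<lambda>x y. x \<sqsubset>\<^bsub>L\<^esub> y)\<^sup>=\<^sup>= y x"
      using flag_total[OF AB(1,2)] less[OF \<psi>(1)[OF K(1)] \<psi>(1)[OF K(2)]]
        less[OF \<psi>(1)[OF K(2)] \<psi>(1)[OF K(1)]] \<psi>(2)[OF K(1)] \<psi>(2)[OF K(2)] AB(3,4) by auto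
  qed
  have "inj_on \<psi> flag" using \<psi>(2) flag_in by (intro inj_onI) (metis subsetD)
  then have cardF: "card F = Suc (card E)" by (simp add: F_def card_image card_flag)
  \<comment> \<open>A chain of subsets of E has at most one member more than E has elements, and F
    attains this bound; the length is one less. The same bound makes F a maximal chain
    below.\<close>
  have "height L = card E"
    unfolding height_def
  proof (rule Max_eqI)
    let ?H = "{card C - 1 |C. pred_on.chain (carrier L) (\<lambda>x y. x \<sqsubset>\<^bsub>L\<^esub> y) C}"
    show bound: "y \<le> card E" if "y \<in> ?H" for y using that chain_bound by fastforce
    then have "?H \<subseteq> {..card E}" by blast
    then show "finite ?H" using finite_subset by blast
    show "card E \<in> ?H" using F cardF by force
  qed
  then have "extremal L" unfolding extremal_def using J M by simp
  moreover have "left_modular L"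
    unfolding left_modular_def
  proof (intro exI[of _ F] conjI ballI)
    have "\<not> (\<exists>S. pred_on.chain (carrier L) (\<lambda>x y. x \<sqsubset>\<^bsub>L\<^esub> y) S \<and> F \<subset> S)"
    proof
      assume "\<exists>S. pred_on.chain (carrier L) (\<lambda>x y. x \<sqsubset>\<^bsub>L\<^esub> y) S \<and> F \<subset> S"
      then obtain S where S: "pred_on.chain (carrier L) (\<lambda>x y. x \<sqsubset>\<^bsub>L\<^esub> y) S" "F \<subset> S" by blast
      have "S \<subseteq> carrier L" using S(1) by (simp only: pred_on.chain_def)
      then have "finite S" using \<open>finite (carrier L)\<close> finite_subset by blast
      then have "card F < card S" using S(2) by (rule psubset_card_mono)
      then show False using chain_bound[OF S(1)] cardF by simp
    qed
    then show "pred_on.maxchain (carrier L) (\<lambda>x y. x \<sqsubset>\<^bsub>L\<^esub> y) F"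
      using F unfolding pred_on.maxchain_def by blast
    fix u assume "u \<in> F"
    then obtain U where U: "U \<in> flag" "u = \<psi> U" by (auto simp: F_def)
    then have u: "u \<in> carrier L" "\<phi> u = U" using \<psi> flag_in by auto
    show "left_modular_element L u"
      unfolding left_modular_element_def
    proof (intro conjI ballI impI u(1))
      fix v w assume v: "v \<in> carrier L" and w: "w \<in> carrier L" and "v \<sqsubset>\<^bsub>L\<^esub> w"
      then have vw: "v \<sqsubseteq>\<^bsub>L\<^esub> w" by (simp add: lless_def)
      define x y where "x = v \<squnion>\<^bsub>L\<^esub> (u \<sqinter>\<^bsub>L\<^esub> w)" and "y = (v \<squnion>\<^bsub>L\<^esub> u) \<sqinter>\<^bsub>L\<^esub> w"
      have xy: "x \<in> carrier L" "y \<in> carrier L" using u(1) v w by (simp_all add: x_def y_def)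
      have "x \<sqsubseteq>\<^bsub>L\<^esub> y" unfolding x_def y_def using u(1) v w vw
        by (intro L.join_le L.meet_le L.join_left L.le_join2 L.meet_left L.meet_right) simp_all
      then have sub: "\<phi> x \<subseteq> \<phi> y" using le xy by simp
      \<comment> \<open>Let q be the first element of the difference. It is not in U, so U consists
        of predecessors of q. Adjoining all of these to \<open>\<phi> x\<close> gives a member above
        \<open>v\<close> and \<open>u\<close> that still misses q, although q belongs to their
        join.\<close>
      have "\<phi> x = \<phi> y"
      proof (rule ccontr)
        assume "\<phi> x \<noteq> \<phi> y"
        then have D: "\<phi> y - \<phi> x \<subseteq> E" "\<phi> y - \<phi> x \<noteq> {}"
          using sub K_sub[OF \<phi>K[OF xy(2)]] by auto
        obtain q where q: "q \<in> \<phi> y - \<phi> x" "\<forall>e\<in>\<phi> y - \<phi> x. \<not> lt e q"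
            "before q \<inter> (\<phi> y - \<phi> x) = {}"
          using exists_first[OF D] .
        have qE: "q \<in> E" using q(1) K_sub[OF \<phi>K[OF xy(2)]] by blast
        have "q \<in> \<phi> w" using q(1) u(1) v w by (simp add: y_def meet)
        moreover have "\<phi> u \<inter> \<phi> w \<subseteq> \<phi> x"
          using le[of "u \<sqinter>\<^bsub>L\<^esub> w" x] L.join_right[of v "u \<sqinter>\<^bsub>L\<^esub> w"] u(1) v w xy
          by (simp add: x_def meet)
        ultimately have "q \<notin> U" using q(1) u(2) by blast
        then have Uq: "U \<subseteq> before q" using flag_avoids U(1) qE by blast
        define Z where "Z = \<phi> x \<union> before q"
        have Z: "Z \<in> K" unfolding Z_def before_def
          using join_before[OF \<phi>K[OF xy(1)] \<phi>K[OF xy(2)] sub q(1,2)] .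
        have "v \<sqsubseteq>\<^bsub>L\<^esub> x" unfolding x_def using u(1) v w by (simp add: L.join_left)
        then have "v \<sqsubseteq>\<^bsub>L\<^esub> \<psi> Z" using le[of v x] le[of v "\<psi> Z"] \<psi>[OF Z] v xy by (auto simp: Z_def)
        moreover have "u \<sqsubseteq>\<^bsub>L\<^esub> \<psi> Z" using le[of u "\<psi> Z"] \<psi>[OF Z] u Uq by (auto simp: Z_def)
        ultimately have "v \<squnion>\<^bsub>L\<^esub> u \<sqsubseteq>\<^bsub>L\<^esub> \<psi> Z" using \<psi>(1)[OF Z] u(1) v by (simp add: L.join_le)
        then have "\<phi> (v \<squnion>\<^bsub>L\<^esub> u) \<subseteq> Z" using le[of "v \<squnion>\<^bsub>L\<^esub> u" "\<psi> Z"] \<psi>[OF Z] u(1) v by simp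
        moreover have "q \<in> \<phi> (v \<squnion>\<^bsub>L\<^esub> u)" using q(1) u(1) v w by (simp add: y_def meet)
        ultimately show False using q(1) lt_irrefl[OF qE] by (auto simp: Z_def before_def)
      qed
      then show "(v \<squnion>\<^bsub>L\<^esub> u) \<sqinter>\<^bsub>L\<^esub> w = v \<squnion>\<^bsub>L\<^esub> (u \<sqinter>\<^bsub>L\<^esub> w)"
        using inj[OF xy] by (simp add: x_def y_def)
    qed
  qed
  ultimately show ?thesis
    unfolding trim_def using L.lattice_axioms by blast
qed

end

section \<open>Closed inversion sets\<close>

definition pairs :: "nat \<Rightarrow> (nat \<times> nat) set" where
  "pairs n = {(i, j). 0 < i \<and> i < j \<and> j \<le> n}"

text \<open>Sets satisfying the closure conditions are inversion sets of permutations: their complements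
  are transitive, too.\<close>

definition inv_closed :: "nat \<Rightarrow> nat \<Rightarrow> (nat \<times> nat) set \<Rightarrow> bool" where
  "inv_closed n a S \<longleftrightarrow> S \<subseteq> pairs n \<and>
     (\<forall>i j k. (i, j) \<in> S \<longrightarrow> (j, k) \<in> S \<longrightarrow> (i, k) \<in> S) \<and>
     (\<forall>i j k. (i, k) \<in> S \<longrightarrow> i < j \<longrightarrow> j < k \<longrightarrow>
        (if j \<le> a \<and> a < k then (j, k) \<in> S else (i, j) \<in> S))"

text \<open>Pairs with ends on different legs come first, by increasing \<open>j\<close> and then decreasing \<open>i\<close>;
  the other pairs follow lexicographically. All initial segments are closed, which gives a maximal
  chain of length \<open>n (n - 1) / 2\<close>.\<close>

definition pair_before :: "nat \<Rightarrow> nat \<times> nat \<Rightarrow> nat \<times> nat \<Rightarrow> bool" where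
  "pair_before a p q \<longleftrightarrow>
     (case (p, q) of ((i, j), (i', j')) \<Rightarrow>
        if i \<le> a \<and> a < j
        then i' \<le> a \<and> a < j' \<longrightarrow> j < j' \<or> j = j' \<and> i' < i
        else \<not> (i' \<le> a \<and> a < j') \<and> (i < i' \<or> i = i' \<and> j < j'))"

lemma inv_closedD:
  assumes "inv_closed n a S"
  shows "S \<subseteq> pairs n"
    and "(i, j) \<in> S \<Longrightarrow> 0 < i \<and> i < j \<and> j \<le> n"
    and "(i, j) \<in> S \<Longrightarrow> (j, k) \<in> S \<Longrightarrow> (i, k) \<in> S"
    and "(i, k) \<in> S \<Longrightarrow> i < j \<Longrightarrow> j < k \<Longrightarrow> j \<le> a \<Longrightarrow> a < k \<Longrightarrow> (j, k) \<in> S"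
    and "(i, k) \<in> S \<Longrightarrow> i < j \<Longrightarrow> j < k \<Longrightarrow> a < j \<or> k \<le> a \<Longrightarrow> (i, j) \<in> S"
proof -
  show sub: "S \<subseteq> pairs n" using assms unfolding inv_closed_def by blast
  then show "(i, j) \<in> S \<Longrightarrow> 0 < i \<and> i < j \<and> j \<le> n" by (auto simp: pairs_def)
  show "(i, j) \<in> S \<Longrightarrow> (j, k) \<in> S \<Longrightarrow> (i, k) \<in> S"
    using assms unfolding inv_closed_def by blast
  have C: "(i, k) \<in> S \<longrightarrow> i < j \<longrightarrow> j < k \<longrightarrow>
        (if j \<le> a \<and> a < k then (j, k) \<in> S else (i, j) \<in> S)"
    using assms unfolding inv_closed_def by blast
  show "(i, k) \<in> S \<Longrightarrow> i < j \<Longrightarrow> j < k \<Longrightarrow> j \<le> a \<Longrightarrow> a < k \<Longrightarrow> (j, k) \<in> S"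
    using C by simp
  show "(i, k) \<in> S \<Longrightarrow> i < j \<Longrightarrow> j < k \<Longrightarrow> a < j \<or> k \<le> a \<Longrightarrow> (i, j) \<in> S"
    using C by (auto split: if_splits)
qed

lemma inv_closedI:
  assumes "\<And>i j. (i, j) \<in> S \<Longrightarrow> 0 < i \<and> i < j \<and> j \<le> n"
    and "\<And>i j k. i < j \<Longrightarrow> j < k \<Longrightarrow> (i, j) \<in> S \<Longrightarrow> (j, k) \<in> S \<Longrightarrow> (i, k) \<in> S"
    and "\<And>i j k. (i, k) \<in> S \<Longrightarrow> i < j \<Longrightarrow> j < k \<Longrightarrow> j \<le> a \<Longrightarrow> a < k \<Longrightarrow> (j, k) \<in> S"
    and "\<And>i j k. (i, k) \<in> S \<Longrightarrow> i < j \<Longrightarrow> j < k \<Longrightarrow> a < j \<or> k \<le> a \<Longrightarrow> (i, j) \<in> S"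
  shows "inv_closed n a S"
  unfolding inv_closed_def
proof (intro conjI allI impI)
  show "S \<subseteq> pairs n" using assms(1) by (auto simp: pairs_def)
  show "(i, k) \<in> S" if "(i, j) \<in> S" "(j, k) \<in> S" for i j k
    using assms(2)[of i j k] assms(1)[OF that(1)] assms(1)[OF that(2)] that by simp
  show "if j \<le> a \<and> a < k then (j, k) \<in> S else (i, j) \<in> S"
    if "(i, k) \<in> S" "i < j" "j < k" for i j k
    using assms(3)[OF that] assms(4)[OF that] by (cases "j \<le> a"; cases "a < k") auto
qed

lemma pairs_closed: "inv_closed n a (pairs n)"
  by (rule inv_closedI) (auto simp: pairs_def)

lemma inv_closed_Int:
  assumes S: "inv_closed n a S" and T: "inv_closed n a T"
  shows "inv_closed n a (S \<inter> T)"
proof (rule inv_closedI)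
  show "0 < i \<and> i < j \<and> j \<le> n" if "(i, j) \<in> S \<inter> T" for i j
    using that inv_closedD(2)[OF S, of i j] by simp
  show "(i, k) \<in> S \<inter> T" if "(i, j) \<in> S \<inter> T" "(j, k) \<in> S \<inter> T" for i j k
    using that inv_closedD(3)[OF S, of i j k] inv_closedD(3)[OF T, of i j k] by simp
  show "(j, k) \<in> S \<inter> T" if "(i, k) \<in> S \<inter> T" "i < j" "j < k" "j \<le> a" "a < k" for i j k
    using that inv_closedD(4)[OF S, of i k j] inv_closedD(4)[OF T, of i k j] by simp
  show "(i, j) \<in> S \<inter> T" if "(i, k) \<in> S \<inter> T" "i < j" "j < k" "a < j \<or> k \<le> a" for i j k
    using that inv_closedD(5)[OF S, of i k j] inv_closedD(5)[OF T, of i k j] by simp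
qed

text \<open>For i < j < k the pair (i, k) stands between (i, j) and (j, k), as in a reflection
  order, which makes initial segments transitive. The pair that closure derives from (i, k) alone is
  the first of the three.\<close>

lemma before_closed: "inv_closed n a {e \<in> pairs n. pair_before a e q}"
  by (cases q, rule inv_closedI) (auto simp: pairs_def pair_before_def split: if_splits)

lemma upto_closed:
  assumes "q \<in> pairs n"
  shows "inv_closed n a (insert q {e \<in> pairs n. pair_before a e q})"
proof -
  obtain x y where "q = (x, y)" by (cases q)
  then show ?thesis using assms
    by (intro inv_closedI) (auto simp: pairs_def pair_before_def split: if_splits)
qed

text \<open>The rules with one premise pass to unions, so only transitivity for one pair of v and
  one pair preceding q is at stake. Pairs of w that precede q already lie in v, which turns closure
  of w into membership in v.\<close>

lemma join_before_closed:
  assumes v: "inv_closed n a v" and w: "inv_closed n a w" and vw: "v \<subseteq> w"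
    and q: "q \<in> w - v" and first: "\<forall>e\<in>w - v. \<not> pair_before a e q"
  shows "inv_closed n a (v \<union> {e \<in> pairs n. pair_before a e q})"
proof -
  obtain i f where qe: "q = (i, f)" by (cases q)
  have qv: "(i, f) \<notin> v" and qw: "(i, f) \<in> w" using q qe by auto
  have early: "e \<in> v" if "e \<in> w" "pair_before a e (i, f)" for e
    using that first qe by blast
  have if_: "0 < i" "i < f" "f \<le> n" using inv_closedD(2)[OF w qw] by auto
  define X where "X = {e \<in> pairs n. pair_before a e q}"
  have X: "inv_closed n a X" unfolding X_def by (rule before_closed)
  have X_iff: "(x, y) \<in> X \<longleftrightarrow> 0 < x \<and> x < y \<and> y \<le> n \<and> pair_before a (x, y) (i, f)" for x y
    by (auto simp: X_def pairs_def qe)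
  have XvT: "(x, z) \<in> v \<union> X" if xy: "(x, y) \<in> X" and yz: "(y, z) \<in> v" for x y z
  proof -
    have b: "0 < x" "x < y" "y < z" "z \<le> n" "pair_before a (x, y) (i, f)"
      using xy inv_closedD(2)[OF v yz] by (auto simp: X_iff)
    show ?thesis
    proof (cases "i \<le> a \<and> a < f")
      case cross: True
      then have c: "x \<le> a" "a < y" "y < f \<or> y = f \<and> i < x"
        using b by (auto simp: pair_before_def split: if_splits)
      consider "z < f" | "y = f" "i < x" | "y < f" "f \<le> z" using c(3) by linarith
      then show ?thesis
      proof cases
        case 1
        then show ?thesis using b c cross by (auto simp: X_iff pair_before_def)
      next
        case 2
        then have "(x, f) \<in> w" using inv_closedD(4)[OF w qw, of x] c(1) cross b by auto
        then have "(x, f) \<in> v" using early[of "(x, f)"] b 2 by auto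
        then show ?thesis using inv_closedD(3)[OF v] yz 2 by blast
      next
        case 3
        \<comment> \<open>This case is impossible: closure would put (i, f) into v.\<close>
        have "(i, y) \<in> w" using inv_closedD(5)[OF w qw, of y] c cross 3 by auto
        moreover have "pair_before a (i, y) (i, f)" using c cross 3 by (auto simp: pair_before_def)
        ultimately have "(i, z) \<in> v" using early inv_closedD(3)[OF v _ yz] by blast
        moreover have "f = z \<or> f < z" using 3 by auto
        ultimately have "(i, f) \<in> v" using inv_closedD(5)[OF v, of i z f] if_ cross by auto
        then show ?thesis using qv by simp
      qed
    next
      case noncross: False
      show ?thesis
      proof (cases "x \<le> a \<and> a < z \<or> x < i")
        case True
        then show ?thesis using b noncross by (auto simp: X_iff pair_before_def)
      next
        case False
        then have c: "x = i" "y < f" using b noncross by (auto simp: pair_before_def split: if_splits)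
        then have "(i, y) \<in> w" using inv_closedD(5)[OF w qw, of y] b noncross by auto
        then have "(i, y) \<in> v" using early[of "(i, y)"] b c by auto
        then show ?thesis using inv_closedD(3)[OF v _ yz] c by blast
      qed
    qed
  qed
  have vXT: "(x, z) \<in> v \<union> X" if xy: "(x, y) \<in> v" and yz: "(y, z) \<in> X" for x y z
  proof -
    have b: "0 < x" "x < y" "y < z" "z \<le> n" "pair_before a (y, z) (i, f)"
      using yz inv_closedD(2)[OF v xy] by (auto simp: X_iff)
    show ?thesis
    proof (cases "i \<le> a \<and> a < f")
      case cross: True
      then have c: "y \<le> a" "a < z" "z < f \<or> z = f \<and> i < y"
        using b by (auto simp: pair_before_def split: if_splits)
      from c(3) show ?thesis
      proof
        assume "z < f"
        then show ?thesis using b c cross by (auto simp: X_iff pair_before_def)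
      next
        assume z: "z = f \<and> i < y"
        then have "(y, f) \<in> w" using inv_closedD(4)[OF w qw, of y] c(1) cross b by auto
        then have "(y, f) \<in> v" using early[of "(y, f)"] b z by auto
        then show ?thesis using inv_closedD(3)[OF v xy] z by blast
      qed
    next
      case noncross: False
      then show ?thesis using b by (auto simp: X_iff pair_before_def split: if_splits)
    qed
  qed
  have "inv_closed n a (v \<union> X)"
  proof (rule inv_closedI)
    show "0 < i \<and> i < j \<and> j \<le> n" if "(i, j) \<in> v \<union> X" for i j
      using that inv_closedD(2)[OF v] inv_closedD(2)[OF X] by blast
    show "(i, k) \<in> v \<union> X" if "(i, j) \<in> v \<union> X" "(j, k) \<in> v \<union> X" for i j k
      using that inv_closedD(3)[OF v] inv_closedD(3)[OF X] XvT vXT by blast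
    show "(j, k) \<in> v \<union> X" if "(i, k) \<in> v \<union> X" "i < j" "j < k" "j \<le> a" "a < k" for i j k
      using that inv_closedD(4)[OF v, of i k j] inv_closedD(4)[OF X, of i k j] by blast
    show "(i, j) \<in> v \<union> X" if "(i, k) \<in> v \<union> X" "i < j" "j < k" "a < j \<or> k \<le> a" for i j k
      using that inv_closedD(5)[OF v, of i k j] inv_closedD(5)[OF X, of i k j] by blast
  qed
  then show ?thesis by (simp add: X_def)
qed

lemma max_avoiding_closed:
  assumes q: "q \<in> pairs n"
  shows "\<exists>m\<in>Collect (inv_closed n a). {e \<in> pairs n. pair_before a e q} \<subseteq> m \<and> q \<notin> m \<and>
    (\<forall>y\<in>Collect (inv_closed n a). {e \<in> pairs n. pair_before a e q} \<subseteq> y \<longrightarrow> q \<notin> y \<longrightarrow> y \<subseteq> m)"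
proof -
  obtain i f where qe: "q = (i, f)" by (cases q)
  have if_: "0 < i" "i < f" "f \<le> n" using q qe by (auto simp: pairs_def)
  \<comment> \<open>A pair is bad if it forces (i, f) in the presence of the predecessors of (i, f).
    When i and f are on different legs, a pair around (i, f) does so by the one-premise rules, and a
    pair within one leg after composition with an earlier (y, f) or (i, x). When they are on the
    same leg, composition with (i, x) gives (i, y), which is then shortened to (i, f).\<close>
  define bad where "bad x y \<longleftrightarrow>
      (if i \<le> a \<and> a < f
       then x \<le> a \<and> a < y \<and> x \<le> i \<and> f \<le> y \<or> y \<le> a \<and> x \<le> i \<and> i < y \<or> a < x \<and> x < f \<and> f \<le> y
       else \<not> (x \<le> a \<and> a < y) \<and> i \<le> x \<and> x < f \<and> f \<le> y)" for x y
  define m where "m = {(x, y). (x, y) \<in> pairs n \<and> \<not> bad x y}"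
  have "inv_closed n a m"
    by (rule inv_closedI) (auto simp: m_def pairs_def bad_def split: if_splits)
  moreover have "{e \<in> pairs n. pair_before a e q} \<subseteq> m"
    by (auto simp: m_def bad_def pair_before_def qe split: if_splits)
  moreover have "q \<notin> m" using if_ by (auto simp: m_def bad_def qe)
  moreover have "S \<subseteq> m"
    if S: "inv_closed n a S" and before: "{e \<in> pairs n. pair_before a e q} \<subseteq> S" and qS: "q \<notin> S" for S
  proof (rule subrelI)
    fix x y assume xy: "(x, y) \<in> S"
    note b = inv_closedD(2)[OF S xy]
    have early: "(x', y') \<in> S" if "0 < x'" "x' < y'" "y' \<le> n" "pair_before a (x', y') (i, f)" for x' y'
      using before that qe by (auto simp: pairs_def)
    have nS: "(i, f) \<notin> S" using qS qe by simp
    have "\<not> bad x y"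
    proof
      assume bad: "bad x y"
      show False
      proof (cases "i \<le> a \<and> a < f")
        case cross: True
        have ncr: "\<not> (x' \<le> i \<and> f \<le> y')" if "(x', y') \<in> S" for x' y'
        proof
          assume c: "x' \<le> i \<and> f \<le> y'"
          have "(i, y') \<in> S"
            using that c inv_closedD(4)[OF S that, of i] cross by (cases "x' = i") auto
          then have "(i, f) \<in> S"
            using c inv_closedD(5)[OF S, of i y' f] cross if_ by (cases "y' = f") auto
          then show False using nS by simp
        qed
        from bad cross consider "x \<le> i" "f \<le> y" | "y \<le> a" "x \<le> i" "i < y" | "a < x" "x < f" "f \<le> y"
          by (auto simp: bad_def)
        then show False
        proof cases
          case 1
          then show ?thesis using ncr xy by blast
        next
          case 2
          then have "(y, f) \<in> S" using early[of y f] b cross if_ by (auto simp: pair_before_def)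
          then show ?thesis using inv_closedD(3)[OF S xy] ncr 2 by blast
        next
          case 3
          then have "(i, x) \<in> S" using early[of i x] b cross if_ by (auto simp: pair_before_def)
          then show ?thesis using inv_closedD(3)[OF S _ xy] ncr 3 by blast
        qed
      next
        case noncross: False
        then have c: "\<not> (x \<le> a \<and> a < y)" "i \<le> x" "x < f" "f \<le> y"
          using bad by (auto simp: bad_def)
        have "(i, y) \<in> S"
        proof (cases "x = i")
          case False
          then have "(i, x) \<in> S" using early[of i x] b c noncross if_ by (auto simp: pair_before_def)
          then show ?thesis using inv_closedD(3)[OF S _ xy] by blast
        qed (use xy in simp)
        then have "(i, f) \<in> S"
          using c inv_closedD(5)[OF S, of i y f] noncross if_ by (cases "y = f") auto
        then show False using nS by simp
      qed
    qed
    then show "(x, y) \<in> m" using b by (simp add: m_def pairs_def)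
  qed
  ultimately show ?thesis by blast
qed

lemma finite_pairs: "finite (pairs n)"
  by (rule finite_subset[of _ "{0..n} \<times> {0..n}"]) (auto simp: pairs_def)

lemma inv_closed_system:
  "ordered_closure_system (Collect (inv_closed n a)) (pairs n) (pair_before a)"
proof
  show "finite (pairs n)" by (rule finite_pairs)
  show "A \<subseteq> pairs n" if "A \<in> Collect (inv_closed n a)" for A
    using that inv_closedD(1) by blast
  show "pairs n \<in> Collect (inv_closed n a)" by (simp add: pairs_closed)
  show "A \<inter> B \<in> Collect (inv_closed n a)"
    if "A \<in> Collect (inv_closed n a)" "B \<in> Collect (inv_closed n a)" for A B
    using that inv_closed_Int by simp
  show "pair_before a p r" if "pair_before a p q" "pair_before a q r" for p q r
    using that by (cases p; cases q; cases r) (auto simp: pair_before_def split: if_splits)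
  show "\<not> pair_before a p p" for p by (cases p) (auto simp: pair_before_def)
  show "pair_before a p q \<or> pair_before a q p" if "p \<noteq> q" for p q
    using that by (cases p; cases q) (auto simp: pair_before_def)
  show "{e \<in> pairs n. pair_before a e q} \<in> Collect (inv_closed n a)" for q
    by (simp add: before_closed)
  show "insert q {e \<in> pairs n. pair_before a e q} \<in> Collect (inv_closed n a)" if "q \<in> pairs n" for q
    using upto_closed[OF that] by simp
  show "v \<union> {e \<in> pairs n. pair_before a e q} \<in> Collect (inv_closed n a)"
    if "v \<in> Collect (inv_closed n a)" "w \<in> Collect (inv_closed n a)" "v \<subseteq> w" "q \<in> w - v"
      "\<forall>e\<in>w - v. \<not> pair_before a e q" for v w q
    using join_before_closed[of n a v w q] that by simp
  show "\<exists>m\<in>Collect (inv_closed n a). {e \<in> pairs n. pair_before a e q} \<subseteq> m \<and> q \<notin> m \<and>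
      (\<forall>y\<in>Collect (inv_closed n a). {e \<in> pairs n. pair_before a e q} \<subseteq> y \<longrightarrow> q \<notin> y \<longrightarrow> y \<subseteq> m)"
    if "q \<in> pairs n" for q
    by (rule max_avoiding_closed[OF that])
qed

section \<open>Paths\<close>

context parent_tree
begin

definition heaviest :: "(nat \<Rightarrow> nat) \<Rightarrow> nat set \<Rightarrow> nat" where
  "heaviest w P = (SOME e. e \<in> inner P \<and> (\<forall>k\<in>inner P. w k \<le> w e))"

lemma inner_pos: "conn P \<Longrightarrow> inner P \<subseteq> {1..n}"
  using innerD(3,4) by fastforce

lemma heaviest:
  assumes "big P"
  shows "heaviest w P \<in> inner P" "k \<in> inner P \<Longrightarrow> w k \<le> w (heaviest w P)"
proof -
  have "finite (inner P)" "inner P \<noteq> {}"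
    using assms conn_finite unfolding big_def inner_def by auto
  then have "\<exists>e. e \<in> inner P \<and> (\<forall>k\<in>inner P. w k \<le> w e)"
    using Max_in[of "w ` inner P"] Max_ge[of "w ` inner P"] by fastforce
  from someI_ex[OF this]
  show "heaviest w P \<in> inner P" "k \<in> inner P \<Longrightarrow> w k \<le> w (heaviest w P)"
    unfolding heaviest_def by blast+
qed

lemma heaviest_eqI:
  assumes w: "inj_on w {1..n}" and P: "big P" and e: "e \<in> inner P" "\<And>k. k \<in> inner P \<Longrightarrow> w k \<le> w e"
  shows "heaviest w P = e"
proof -
  have "w (heaviest w P) = w e"
    using heaviest(1)[OF P, where w = w] heaviest(2)[OF P e(1), where w = w] heaviest(1)[OF P, where w = w] e(2) by (simp add: le_antisym)
  then show ?thesis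
    using w heaviest(1)[OF P, where w = w] e(1) inner_pos[OF big_conn[OF P]] unfolding inj_on_def by blast
qed

text \<open>The heaviest edge of a subtree stays heaviest in every smaller subtree containing it.
  Injective weights are the source of the explicitly built nestings: ranks for inversion sets, and
  the six orders on a claw.\<close>

lemma heaviest_choice:
  assumes w: "inj_on w {1..n}"
  shows "choice (heaviest w)"
  unfolding choice_def
proof (intro conjI allI impI)
  show "heaviest w P \<in> inner P" if "big P" for P by (rule heaviest(1)[OF that])
  fix P Q assume P: "big P" and Q: "big Q" "Q \<subseteq> P" and e: "heaviest w P \<in> inner Q"
  show "heaviest w Q = heaviest w P"
  proof (rule heaviest_eqI[OF w Q(1) e])
    fix k assume "k \<in> inner Q"
    then have "k \<in> inner P" using inner_mono[OF big_conn[OF Q(1)] big_conn[OF P] Q(2)] by blast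
    then show "w k \<le> w (heaviest w P)" by (rule heaviest(2)[OF P])
  qed
qed

text \<open>The edges determine the root: the parent of the least edge of P is not itself an edge of
  P, so it is the root of P, and it lies in Q as an end of an edge of Q.\<close>

lemma inner_subset:
  assumes P: "big P" and Q: "conn Q" and sub: "inner P \<subseteq> inner Q"
  shows "P \<subseteq> Q"
proof
  note cP = big_conn[OF P]
  define e where "e = Min (inner P)"
  have fin: "finite (inner P)" using conn_finite[OF cP] by (simp add: inner_def)
  have e: "e \<in> inner P" using Min_in[OF fin] P by (simp add: e_def big_def)
  have "par e \<notin> inner P"
    using innerD(5)[OF cP e] Min_le[OF fin, of "par e"] by (auto simp: e_def)
  then have "par e = Min P" using innerD(2)[OF cP e] by (simp add: inner_def)
  then have "Min P \<in> Q" using innerD(2)[OF Q] e sub by fastforce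
  then show "x \<in> Q" if "x \<in> P" for x
    using that sub by (cases "x = Min P") (auto simp: inner_def)
qed

end

text \<open>The number \<open>a\<close> is the length of the first leg; \<open>a = n\<close> leaves
  the second leg empty. The parent is the preceding number except where the second leg
  starts.\<close>

locale path_tree = parent_tree +
  fixes a :: nat
  assumes a_le: "a \<le> n"
    and par_pred: "0 < v \<Longrightarrow> v \<le> n \<Longrightarrow> v \<noteq> Suc a \<Longrightarrow> par v = v - 1"
    and par_root: "a < n \<Longrightarrow> par (Suc a) = 0"
begin

text \<open>The vertices \<open>1..a\<close> and \<open>a+1..n\<close> are the two legs hanging from the root. The edges of \<open>path i j\<close> are
  those between (and including) the edges \<open>i\<close> and \<open>j\<close>, and \<open>(i, j)\<close> is an inversion if the top edge
  of this path lies on the side of \<open>i\<close>.\<close>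

definition path_inner :: "nat \<Rightarrow> nat \<Rightarrow> nat set" where
  "path_inner i j = (if i \<le> a \<and> a < j then {1..i} \<union> {Suc a..j} else {i..j})"

definition path :: "nat \<Rightarrow> nat \<Rightarrow> nat set" where
  "path i j = (if i \<le> a \<and> a < j then {0..i} \<union> {Suc a..j} else insert (par i) {i..j})"

definition bound :: "nat \<Rightarrow> nat \<Rightarrow> nat" where
  "bound i j = (if i \<le> a \<and> a < j then a else i)"

definition inversions :: "nat set set \<Rightarrow> (nat \<times> nat) set" where
  "inversions N = {(i, j) \<in> pairs n. top N (path i j) \<le> bound i j}"

lemma path:
  assumes "0 < i" "i < j" "j \<le> n"
  shows "big (path i j)" "inner (path i j) = path_inner i j"
proof -
  have "conn (path i j) \<and> inner (path i j) = path_inner i j"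
  proof (cases "i \<le> a \<and> a < j")
    case True
    have "conn (path i j) \<and> Min (path i j) = 0"
    proof (rule connI)
      show "path i j \<subseteq> {0..n}" "0 \<in> path i j" using assms True by (auto simp: path_def)
      fix v assume v: "v \<in> path i j" "v \<noteq> 0"
      then have "0 < v" "v \<le> n" using assms True by (auto simp: path_def)
      then show "par v \<in> path i j \<and> 0 < v"
        using par_pred[of v] par_root v True assms by (cases "v = Suc a") (auto simp: path_def)
    qed
    then show ?thesis using True by (auto simp: path_def path_inner_def inner_def)
  next
    case False
    have less: "par i < i" using par_less[of i] assms by auto
    have "conn (path i j) \<and> Min (path i j) = par i"
    proof (rule connI)
      show "path i j \<subseteq> {0..n}" "par i \<in> path i j" using assms False less by (auto simp: path_def)
      fix v assume v: "v \<in> path i j" "v \<noteq> par i"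
      then have v': "i \<le> v" "v \<le> j" using False by (auto simp: path_def)
      show "par v \<in> path i j \<and> 0 < v"
        using par_pred[of v] v' False assms by (cases "v = i") (auto simp: path_def)
    qed
    then show ?thesis using False less by (auto simp: path_def path_inner_def inner_def)
  qed
  then show "big (path i j)" "inner (path i j) = path_inner i j"
    using assms unfolding big_def by (auto simp: path_inner_def)
qed

text \<open>Climbing from the larger of two edges on one leg passes everything between them. With
  edges on both legs, climbing reaches the start of the second leg, so the subtree is rooted at 0
  and also contains the first leg from its start.\<close>

lemma path_inner_subset:
  assumes P: "conn P" and e: "e \<in> inner P" "e' \<in> inner P" "e < e'"
  shows "path_inner e e' \<subseteq> inner P"
proof -
  have Me: "Min P < e" using innerD(6)[OF P e(1)] .
  have down: "v \<in> inner P" if "v \<le> w" "w \<in> inner P" "Min P < v" "w \<le> a \<or> a < v" for v w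
    using that
  proof (induction w rule: dec_induct)
    case (step m)
    have D: "0 < Suc m" "Suc m \<le> n" "par (Suc m) \<in> P" using innerD[OF P step.prems(1)] by auto
    have "par (Suc m) = m" using par_pred[OF D(1,2)] step.hyps step.prems(3) by auto
    then have "m \<in> inner P" using D(3) step.hyps step.prems(2) by (auto simp: inner_def)
    then show ?case using step.IH step.prems by auto
  qed simp
  show ?thesis
  proof (cases "e \<le> a \<and> a < e'")
    case False
    then show ?thesis using down[of _ e'] e Me by (auto simp: path_inner_def)
  next
    case True
    have right: "v \<in> inner P" if "Suc a \<le> v" "v \<le> e'" for v
      using down[of v e'] e(2) that Me True by auto
    have "par (Suc a) \<in> P" "Suc a \<le> n"
      using right[of "Suc a"] True innerD[OF P, of "Suc a"] by auto
    then have "Min P = 0" using conn_Min_le[OF P, of 0] par_root by auto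
    then have "v \<in> inner P" if "1 \<le> v" "v \<le> e" for v
      using down[of v e] e(1) that True by auto
    then show ?thesis using right True by (auto simp: path_inner_def)
  qed
qed

lemma mem_path_inner:
  "v \<in> path_inner i j \<longleftrightarrow>
     (if i \<le> a \<and> a < j then 0 < v \<and> v \<le> i \<or> a < v \<and> v \<le> j else i \<le> v \<and> v \<le> j)"
  by (auto simp: path_inner_def)

lemma path_top:
  assumes N: "max_nest N" and ij: "0 < i" "i < j" "j \<le> n"
  shows "top N (path i j) \<in> path_inner i j"
    and "0 < x \<Longrightarrow> x < y \<Longrightarrow> y \<le> n \<Longrightarrow> (\<forall>v. v \<in> path_inner x y \<longrightarrow> v \<in> path_inner i j) \<Longrightarrow>
      top N (path i j) \<in> path_inner x y \<Longrightarrow> top N (path x y) = top N (path i j)"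
proof -
  note p = path[OF ij]
  show "top N (path i j) \<in> path_inner i j" using top_inner[OF N p(1)] p(2) by simp
  assume xy: "0 < x" "x < y" "y \<le> n" "\<forall>v. v \<in> path_inner x y \<longrightarrow> v \<in> path_inner i j"
    "top N (path i j) \<in> path_inner x y"
  note p' = path[OF xy(1-3)]
  have "path x y \<subseteq> path i j"
    using inner_subset[OF p'(1) big_conn[OF p(1)]] p(2) p'(2) xy(4) by auto
  then show "top N (path x y) = top N (path i j)"
    using choice_sub[OF top_choice[OF N] p(1) big_conn[OF p'(1)]] xy(5) p'(2) by simp
qed

text \<open>Each rule compares the tops of two paths, one inside the other: a top edge that still
  belongs to the shorter path remains its top. Which of the three paths for i < j < k contains the
  other two depends on the legs, whence the two forms of the one-premise rule.\<close>

lemma inversions_closed: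
  assumes N: "max_nest N"
  shows "inv_closed n a (inversions N)"
proof (rule inv_closedI)
  let ?t = "\<lambda>i j. top N (path i j)"
  note T = path_top[OF N]
  have inv_iff: "(i, j) \<in> inversions N \<longleftrightarrow> 0 < i \<and> i < j \<and> j \<le> n \<and> ?t i j \<le> bound i j" for i j
    by (auto simp: inversions_def pairs_def)
  show "0 < i \<and> i < j \<and> j \<le> n" if "(i, j) \<in> inversions N" for i j
    using that by (auto simp: inv_iff)
  show "(i, k) \<in> inversions N"
    if less: "i < j" "j < k" and ij: "(i, j) \<in> inversions N" and jk: "(j, k) \<in> inversions N" for i j k
  proof -
    have b: "0 < i" "j \<le> n" "k \<le> n" "?t i j \<le> bound i j" "?t j k \<le> bound j k"
      using ij jk by (auto simp: inv_iff)
    have ik: "?t i k \<in> path_inner i k" using T(1)[of i k] b less by auto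
    have jk_in: "?t j k \<in> path_inner j k" using T(1)[of j k] b less by auto
    have "?t i k \<le> bound i k"
    proof (rule ccontr)
      assume x: "\<not> ?t i k \<le> bound i k"
      show False
      proof (cases "i \<le> a \<and> a < k \<and> j \<le> a")
        case False
        show ?thesis
        proof (cases "?t i k \<le> j")
          case True
          then have "?t i j = ?t i k" using T(2)[of i k i j] ik x b less False
            by (auto simp: mem_path_inner bound_def split: if_splits)
          then show ?thesis using b(4) x less False by (auto simp: bound_def split: if_splits)
        next
          case xj: False
          have leg: "\<not> (j \<le> a \<and> a < k)" using False less by auto
          have "\<forall>v. v \<in> path_inner j k \<longrightarrow> v \<in> path_inner i k"
            using leg less by (auto simp: mem_path_inner)
          moreover have "?t i k \<in> path_inner j k"
            using leg xj ik by (auto simp: mem_path_inner split: if_splits)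
          ultimately have "?t j k = ?t i k" using T(2)[of i k j k] b less by simp
          then show ?thesis using b(5) xj leg by (simp add: bound_def)
        qed
      next
        case True
        \<comment> \<open>Here i and j lie on the first leg and k on the second, so the path of (j,
          k) contains the other two.\<close>
        then have ja: "?t j k \<le> a" "1 \<le> ?t j k" "?t j k \<le> j"
          using b(5) jk_in less by (auto simp: bound_def mem_path_inner)
        show ?thesis
        proof (cases "?t j k \<le> i")
          case ti: True
          have "?t i k = ?t j k" using T(2)[of j k i k] b less True ti ja
            by (auto simp: mem_path_inner)
          then show ?thesis using ja x True by (auto simp: bound_def)
        next
          case False
          have "?t i j = ?t j k" using T(2)[of j k i j] b less True False ja
            by (auto simp: mem_path_inner)
          then show ?thesis using b(4) False True by (auto simp: bound_def)
        qed
      qed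
    qed
    then show ?thesis using b less by (auto simp: inv_iff)
  qed
  show "(j, k) \<in> inversions N"
    if ik: "(i, k) \<in> inversions N" and less: "i < j" "j < k" "j \<le> a" "a < k" for i j k
  proof -
    have b: "0 < i" "k \<le> n" "?t i k \<le> bound i k" using ik by (auto simp: inv_iff)
    have ia: "?t i k \<le> a" using b(3) less by (auto simp: bound_def)
    have ik_in: "?t i k \<in> path_inner i k" using T(1)[of i k] b less by auto
    have jk_in: "?t j k \<in> path_inner j k" using T(1)[of j k] b less by auto
    have "?t j k \<le> a"
    proof (rule ccontr)
      assume "\<not> ?t j k \<le> a"
      then have "?t i k = ?t j k" using T(2)[of j k i k] jk_in b less by (auto simp: mem_path_inner)
      then show False using ia \<open>\<not> ?t j k \<le> a\<close> by simp
    qed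
    then show ?thesis using b less by (auto simp: inv_iff bound_def)
  qed
  show "(i, j) \<in> inversions N"
    if ik: "(i, k) \<in> inversions N" and less: "i < j" "j < k" and leg: "a < j \<or> k \<le> a" for i j k
  proof -
    have b: "0 < i" "k \<le> n" "?t i k \<le> bound i k" using ik by (auto simp: inv_iff)
    have ik_in: "?t i k \<in> path_inner i k" using T(1)[of i k] b less by auto
    have "?t i j = ?t i k"
      using T(2)[of i k i j] ik_in b less leg by (auto simp: mem_path_inner bound_def split: if_splits)
    then show ?thesis using b less leg by (auto simp: inv_iff bound_def split: if_splits)
  qed
qed

text \<open>Paths detect the order: if the tops of P satisfy \<open>e < e'\<close>, the path from
  \<open>e\<close> to \<open>e'\<close> lies in P and keeps both tops, so the pair is an inversion
  of N but not of \<open>N'\<close>.\<close>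

lemma nest_le_iff_inversions:
  assumes N: "max_nest N" and N': "max_nest N'"
  shows "nest_le N N' \<longleftrightarrow> inversions N \<subseteq> inversions N'"
proof
  assume le: "nest_le N N'"
  show "inversions N \<subseteq> inversions N'"
  proof (rule subrelI)
    fix i j assume ij: "(i, j) \<in> inversions N"
    then have b: "0 < i" "i < j" "j \<le> n" "top N (path i j) \<le> bound i j"
      by (auto simp: inversions_def pairs_def)
    then have "top N' (path i j) \<le> top N (path i j)"
      using le path(1) unfolding nest_le_def by blast
    then show "(i, j) \<in> inversions N'" using b by (auto simp: inversions_def pairs_def)
  qed
next
  assume sub: "inversions N \<subseteq> inversions N'"
  show "nest_le N N'"
    unfolding nest_le_def
  proof (intro allI impI)
    fix P assume P: "big P"
    note cP = big_conn[OF P]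
    define e e' where "e = top N P" and "e' = top N' P"
    have e: "e \<in> inner P" and e': "e' \<in> inner P"
      using top_inner[OF N P] top_inner[OF N' P] by (simp_all add: e_def e'_def)
    have "e' \<le> e"
    proof (rule ccontr)
      assume "\<not> e' \<le> e"
      then have less: "0 < e" "e < e'" "e' \<le> n"
        using innerD(3)[OF cP e] innerD(4)[OF cP e'] by auto
      note p = path[OF less]
      have "path e e' \<subseteq> P"
        using inner_subset[OF p(1) cP] path_inner_subset[OF cP e e' less(2)] p(2) by simp
      moreover have "e \<in> path_inner e e'" "e' \<in> path_inner e e'"
        using less by (auto simp: path_inner_def)
      ultimately have t: "top N (path e e') = e" "top N' (path e e') = e'"
        using choice_sub[OF top_choice[OF N] P big_conn[OF p(1)]]
          choice_sub[OF top_choice[OF N'] P big_conn[OF p(1)]] p(2)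
        by (simp_all add: e_def e'_def)
      have "(e, e') \<in> inversions N" using t(1) less by (auto simp: inversions_def pairs_def bound_def)
      then have "(e, e') \<in> inversions N'" using sub by blast
      then show False using t(2) less by (auto simp: inversions_def bound_def split: if_splits)
    qed
    then show "top N' P \<le> top N P" by (simp add: e_def e'_def)
  qed
qed

text \<open>A closed set is the inversion set of a linear order on the edges, and cutting the
  heaviest edge first in this order produces the nesting. Several orders can produce the same
  nesting; closure singles out the one whose inversions are those read off from the tops.\<close>

lemma inversions_surj:
  assumes n: "0 < n" and S: "inv_closed n a S"
  shows "\<exists>N. max_nest N \<and> inversions N = S"
proof -
  note C = inv_closedD[OF S]
  define above where "above i j \<longleftrightarrow> (if i < j then (i, j) \<in> S else j < i \<and> (j, i) \<notin> S)" for i j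
  have above_total: "above i j \<or> above j i" if "i \<noteq> j" for i j
    using that by (auto simp: above_def)
  have above_irrefl: "\<not> above i i" for i by (simp add: above_def)
  have above_asym: "\<not> (above i j \<and> above j i)" for i j by (auto simp: above_def)
  \<comment> \<open>Three of the six relative positions of i, j, k reduce to transitivity of S. The
    other three need transitivity of the complement, which is the contrapositive of the one-premise
    rules.\<close>
  have above_trans: "above i k" if ij: "above i j" and jk: "above j k" for i j k
  proof -
    have "i \<noteq> j" "j \<noteq> k" "i \<noteq> k" using ij jk above_irrefl above_asym by auto
    then consider "i < j" "j < k" | "i < k" "k < j" | "j < i" "i < k"
      | "j < k" "k < i" | "k < i" "i < j" | "k < j" "j < i" by linarith
    then show ?thesis
    proof cases
      case 1
      then show ?thesis using C(3)[of i j k] ij jk by (simp add: above_def)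
    next
      case 2
      then show ?thesis using C(4)[of i j k] C(5)[of i j k] ij jk
        by (cases "k \<le> a \<and> a < j") (auto simp: above_def not_le not_less)
    next
      case 3
      then show ?thesis using C(4)[of j k i] C(5)[of j k i] ij jk
        by (cases "i \<le> a \<and> a < k") (auto simp: above_def not_le not_less)
    next
      case 4
      then show ?thesis using C(3)[of j k i] ij jk by (auto simp: above_def)
    next
      case 5
      then show ?thesis using C(3)[of k i j] ij jk by (auto simp: above_def)
    next
      case 6
      then show ?thesis using C(4)[of k i j] C(5)[of k i j] ij jk
        by (cases "j \<le> a \<and> a < i") (auto simp: above_def not_le not_less)
    qed
  qed
  define w where "w i = card {k\<in>{1..n}. above i k}" for i
  have w_mono: "w j < w i" if "above i j" "j \<in> {1..n}" for i j
    unfolding w_def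
  proof (rule psubset_card_mono)
    show "{k\<in>{1..n}. above j k} \<subset> {k\<in>{1..n}. above i k}"
      using that above_trans above_irrefl by blast
  qed simp
  have w: "inj_on w {1..n}"
  proof (rule inj_onI, rule ccontr)
    fix i j assume "i \<in> {1..n}" "j \<in> {1..n}" "w i = w j" "i \<noteq> j"
    then show False using above_total[of i j] w_mono[of i j] w_mono[of j i] by auto
  qed
  define N where "N = of_choice (heaviest w)"
  have N: "max_nest N" unfolding N_def by (rule of_choice_max_nest[OF heaviest_choice[OF w] n])
  have "(i, j) \<in> inversions N \<longleftrightarrow> (i, j) \<in> S" for i j
  proof (cases "0 < i \<and> i < j \<and> j \<le> n")
    case False
    then show ?thesis using C(2) by (auto simp: inversions_def pairs_def)
  next
    case ij: True
    define e where "e = top N (path i j)"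
    note p = path[of i j]
    have bp: "big (path i j)" using p(1) ij by blast
    have "e = heaviest w (path i j)"
      unfolding e_def N_def by (rule top_of_choice[OF heaviest_choice[OF w] n bp])
    then have e: "e \<in> path_inner i j" and e_max: "\<And>k. k \<in> path_inner i j \<Longrightarrow> w k \<le> w e"
      using heaviest[OF bp, where w = w] p(2) ij by auto
    have inv: "(i, j) \<in> inversions N \<longleftrightarrow> e \<le> bound i j"
      using ij by (auto simp: inversions_def pairs_def e_def)
    have e_pos: "e \<in> {1..n}" using e ij by (auto simp: path_inner_def split: if_splits)
    have not_above: "\<not> above k e" if "k \<in> path_inner i j" for k
      using w_mono[OF _ e_pos, of k] e_max[OF that] by auto
    have ends: "i \<in> path_inner i j" "j \<in> path_inner i j" using ij by (auto simp: path_inner_def)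
    show ?thesis
    proof
      assume ijS: "(i, j) \<in> S"
      \<comment> \<open>A heaviest edge on the side of j would lie below i by closure of S.\<close>
      have "e \<le> bound i j"
      proof (rule ccontr)
        assume "\<not> e \<le> bound i j"
        then have "(i, e) \<in> S" "i < e"
          using e ijS C(5)[of i j e] ij
          by (cases "e = j"; auto simp: bound_def path_inner_def split: if_splits)+
        then show False using not_above[OF ends(1)] by (simp add: above_def)
      qed
      then show "(i, j) \<in> inversions N" using inv by simp
    next
      assume "(i, j) \<in> inversions N"
      then have le: "e \<le> bound i j" using inv by simp
      show "(i, j) \<in> S"
      proof (rule ccontr)
        assume nS: "(i, j) \<notin> S"
        have "e < j" using le ij by (auto simp: bound_def split: if_splits)
        then have "(e, j) \<in> S" using not_above[OF ends(2)] by (auto simp: above_def)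
        \<comment> \<open>If \<open>e\<close> is not i, both lie on the first leg with
          \<open>e\<close> closer to the root, and the rule for different legs moves (e, j) to (i,
          j).\<close>
        moreover have "e = i \<or> e < i \<and> i \<le> a \<and> a < j"
          using le e ij by (auto simp: bound_def path_inner_def split: if_splits)
        ultimately show False using C(4)[of e j i] nS ij by auto
      qed
    qed
  qed
  then show ?thesis using N by auto
qed

lemma trim_path:
  fixes L :: "(nat set set, 'b) gorder_scheme"
  assumes n: "0 < n" and carrier: "carrier L = {N. max_nest N}" and eq: "eq L = (=)"
    and le: "\<And>N N'. max_nest N \<Longrightarrow> max_nest N' \<Longrightarrow> N \<sqsubseteq>\<^bsub>L\<^esub> N' \<longleftrightarrow> nest_le N N'"
  shows "trim L"
proof -
  interpret inv_sets: ordered_closure_system "Collect (inv_closed n a)" "pairs n" "pair_before a"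
    by (rule inv_closed_system)
  show ?thesis
  proof (rule inv_sets.trim_of_order_embedding[OF eq])
    show "N \<sqsubseteq>\<^bsub>L\<^esub> N' \<longleftrightarrow> inversions N \<subseteq> inversions N'"
      if "N \<in> carrier L" "N' \<in> carrier L" for N N'
      using that le nest_le_iff_inversions by (simp add: carrier)
    show "bij_betw inversions (carrier L) (Collect (inv_closed n a))"
      unfolding bij_betw_def
    proof
      show "inj_on inversions (carrier L)"
      proof (rule inj_onI)
        fix N N' assume "N \<in> carrier L" "N' \<in> carrier L" and inv: "inversions N = inversions N'"
        then have NN': "max_nest N" "max_nest N'" by (auto simp: carrier)
        show "N = N'"
          by (rule nest_le_antisym[OF NN'])
            (use inv nest_le_iff_inversions[OF NN'] nest_le_iff_inversions[OF NN'(2,1)] in simp_all)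
      qed
      show "inversions ` carrier L = Collect (inv_closed n a)"
      proof (intro equalityI subsetI)
        fix S assume "S \<in> inversions ` carrier L"
        then show "S \<in> Collect (inv_closed n a)" using inversions_closed by (auto simp: carrier)
      next
        fix S assume "S \<in> Collect (inv_closed n a)"
        then show "S \<in> inversions ` carrier L" using inversions_surj[OF n, of S] by (auto simp: carrier)
      qed
    qed
  qed
qed

end

section \<open>Vertices of degree three\<close>

text \<open>An edge at \<open>v\<close> is either the edge to its parent, which is named
  \<open>v\<close>, or an edge to a child. This covers the root with three children and any other
  vertex with two.\<close>

locale tree_claw = parent_tree +
  fixes v x\<^sub>1 x\<^sub>2 x\<^sub>3 :: nat
  assumes less: "0 < x\<^sub>1" "x\<^sub>1 < x\<^sub>2" "x\<^sub>2 < x\<^sub>3" "x\<^sub>3 \<le> n"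
    and claw: "x \<in> {x\<^sub>1, x\<^sub>2, x\<^sub>3} \<Longrightarrow> x = v \<or> par x = v"
begin

definition claw_edges :: "nat set" where
  "claw_edges = {x\<^sub>1, x\<^sub>2, x\<^sub>3}"

definition star :: "nat set \<Rightarrow> nat set" where
  "star A = A \<union> par ` A"

lemma star:
  assumes "A \<subseteq> claw_edges" "A \<noteq> {}"
  shows "big (star A)" "inner (star A) = A"
proof -
  have pos: "0 < x \<and> x \<le> n \<and> par x < x \<and> (x = v \<or> par x = v)" if "x \<in> A" for x
    using that assms(1) less par_less[of x] claw[of x] by (auto simp: claw_edges_def)
  have "conn (star A) \<and> inner (star A) = A"
  proof (cases "v \<in> A")
    case True
    have eq: "star A = insert (par v) A"
      using True pos by (auto simp: star_def)
    have "conn (star A) \<and> Min (star A) = par v"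
    proof (rule connI)
      show "star A \<subseteq> {0..n}" using pos[OF True] pos by (auto simp: eq)
      fix y assume "y \<in> star A" "y \<noteq> par v"
      then show "par y \<in> star A \<and> 0 < y" using pos[of y] True by (auto simp: eq)
    qed (simp add: eq)
    moreover have "par v \<notin> A"
      using pos[OF True] pos[of "par v"] by auto
    ultimately show ?thesis by (auto simp: inner_def eq)
  next
    case False
    have par: "par x = v" if "x \<in> A" for x using pos[OF that] that False by auto
    then have eq: "star A = insert v A" using assms(2) by (auto simp: star_def)
    have "v \<le> n" using assms(2) pos par by fastforce
    have "conn (star A) \<and> Min (star A) = v"
    proof (rule connI)
      show "star A \<subseteq> {0..n}" using \<open>v \<le> n\<close> pos by (auto simp: eq)
      fix y assume "y \<in> star A" "y \<noteq> v"
      then show "par y \<in> star A \<and> 0 < y" using pos[of y] par[of y] by (auto simp: eq)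
    qed (simp add: eq)
    then show ?thesis using False by (auto simp: inner_def eq)
  qed
  then show "big (star A)" "inner (star A) = A" using assms(2) by (auto simp: big_def)
qed

lemma star_unique:
  assumes "big P" "inner P \<subseteq> claw_edges"
  shows "P = star (inner P)"
proof -
  have "inner P \<noteq> {}" using assms(1) by (simp add: big_def)
  note s = star[OF assms(2) this]
  show ?thesis
    using inner_subset[OF assms(1) big_conn[OF s(1)]] inner_subset[OF s(1) big_conn[OF assms(1)]] s(2)
    by auto
qed

text \<open>The tubes outside the claw are fixed by giving all other edges larger weights. The six orders
  on the three edges of the claw then yield a hexagon, which is an interval because \<open>nest_le\<close> is the
  componentwise order on top edges.\<close>

definition agrees :: "nat set set \<Rightarrow> bool" where
  "agrees N \<longleftrightarrow> max_nest N \<and>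
     (\<forall>P. big P \<longrightarrow> \<not> inner P \<subseteq> claw_edges \<longrightarrow> top N P = Max (inner P - claw_edges))"

definition tops :: "nat set set \<Rightarrow> nat \<times> nat \<times> nat \<times> nat" where
  "tops N = (top N (star {x\<^sub>1, x\<^sub>2}), top N (star {x\<^sub>1, x\<^sub>3}), top N (star {x\<^sub>2, x\<^sub>3}),
     top N (star {x\<^sub>1, x\<^sub>2, x\<^sub>3}))"

text \<open>The shift by 3 puts every other edge above the claw, whose weights will be 0, 1, 2 in
  some order, and keeps the weights distinct.\<close>

definition hex_weight :: "nat \<Rightarrow> nat \<Rightarrow> nat \<Rightarrow> nat \<Rightarrow> nat" where
  "hex_weight i j k x =
     (if x = x\<^sub>1 then i else if x = x\<^sub>2 then j else if x = x\<^sub>3 then k else x + 3)"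

definition hex_nest :: "nat \<Rightarrow> nat \<Rightarrow> nat \<Rightarrow> nat set set" where
  "hex_nest i j k = of_choice (heaviest (hex_weight i j k))"

lemma nest_le_iff_tops:
  assumes N: "agrees N" "tops N = (a, b, c, d)" and M: "agrees M" "tops M = (a', b', c', d')"
  shows "nest_le N M \<longleftrightarrow> a' \<le> a \<and> b' \<le> b \<and> c' \<le> c \<and> d' \<le> d"
proof
  have subs: "{x\<^sub>1, x\<^sub>2} \<subseteq> claw_edges" "{x\<^sub>1, x\<^sub>3} \<subseteq> claw_edges" "{x\<^sub>2, x\<^sub>3} \<subseteq> claw_edges"
    "{x\<^sub>1, x\<^sub>2, x\<^sub>3} \<subseteq> claw_edges" by (auto simp: claw_edges_def)
  note s = star(1)[OF subs(1)] star(1)[OF subs(2)] star(1)[OF subs(3)] star(1)[OF subs(4)]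
  show "a' \<le> a \<and> b' \<le> b \<and> c' \<le> c \<and> d' \<le> d" if "nest_le N M"
    using that s N(2) M(2) unfolding nest_le_def tops_def by auto
  assume le: "a' \<le> a \<and> b' \<le> b \<and> c' \<le> c \<and> d' \<le> d"
  show "nest_le N M"
    unfolding nest_le_def
  proof (intro allI impI)
    fix P assume P: "big P"
    have NM: "max_nest N" "max_nest M" using N(1) M(1) by (simp_all add: agrees_def)
    show "top M P \<le> top N P"
    proof (cases "inner P \<subseteq> claw_edges")
      case False
      then show ?thesis using N(1) M(1) P by (simp add: agrees_def)
    next
      case True
      have "inner P \<noteq> {}" using P by (simp add: big_def)
      moreover have "inner P \<in> Pow {x\<^sub>1, x\<^sub>2, x\<^sub>3}" using True by (simp add: claw_edges_def)
      ultimately consider x where "inner P = {x}" | "inner P = {x\<^sub>1, x\<^sub>2}" | "inner P = {x\<^sub>1, x\<^sub>3}"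
        | "inner P = {x\<^sub>2, x\<^sub>3}" | "inner P = {x\<^sub>1, x\<^sub>2, x\<^sub>3}"
        unfolding Pow_insert Pow_empty by auto
      then show ?thesis
      proof cases
        case 1
        then show ?thesis using top_inner[OF NM(1) P] top_inner[OF NM(2) P] by simp
      qed (use le star_unique[OF P True] N(2) M(2) in \<open>auto simp: tops_def\<close>)
    qed
  qed
qed

lemma agrees_eqI: "agrees N \<Longrightarrow> agrees M \<Longrightarrow> tops N = tops M \<Longrightarrow> N = M"
  using nest_le_iff_tops[of N _ _ _ _ M] nest_le_iff_tops[of M _ _ _ _ N]
  by (intro nest_le_antisym) (auto simp: agrees_def tops_def)

lemma hex_nest:
  assumes w: "i < 3" "j < 3" "k < 3" "i \<noteq> j" "i \<noteq> k" "j \<noteq> k"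
  shows "agrees (hex_nest i j k)"
    and "tops (hex_nest i j k) =
      (if i < j then x\<^sub>2 else x\<^sub>1, if i < k then x\<^sub>3 else x\<^sub>1, if j < k then x\<^sub>3 else x\<^sub>2,
       if i < j then if j < k then x\<^sub>3 else x\<^sub>2 else if i < k then x\<^sub>3 else x\<^sub>1)"
proof -
  have n: "0 < n" using less by linarith
  have inj: "inj_on (hex_weight i j k) {1..n}"
    using w by (auto simp: inj_on_def hex_weight_def split: if_splits)
  note ch = heaviest_choice[OF inj]
  have top: "top (hex_nest i j k) P = e"
    if "big P" "e \<in> inner P" "\<And>y. y \<in> inner P \<Longrightarrow> hex_weight i j k y \<le> hex_weight i j k e" for P e
    unfolding hex_nest_def using top_of_choice[OF ch n that(1)] heaviest_eqI[OF inj that] by simp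
  have "top (hex_nest i j k) P = Max (inner P - claw_edges)"
    if P: "big P" "\<not> inner P \<subseteq> claw_edges" for P
  proof (rule top[OF P(1)])
    have fin: "finite (inner P - claw_edges)"
      using conn_finite[OF big_conn[OF P(1)]] by (simp add: inner_def)
    have M: "Max (inner P - claw_edges) \<in> inner P - claw_edges"
      by (rule Max_in[OF fin]) (use P(2) in auto)
    then show "Max (inner P - claw_edges) \<in> inner P" by simp
    fix y assume y: "y \<in> inner P"
    have wM: "hex_weight i j k (Max (inner P - claw_edges)) = Max (inner P - claw_edges) + 3"
      using M by (auto simp: hex_weight_def claw_edges_def)
    show "hex_weight i j k y \<le> hex_weight i j k (Max (inner P - claw_edges))"
    proof (cases "y \<in> claw_edges")
      case True
      then show ?thesis using w unfolding wM by (auto simp: hex_weight_def claw_edges_def)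
    next
      case False
      then have "y \<le> Max (inner P - claw_edges)" using y fin by simp
      then show ?thesis using False unfolding wM by (auto simp: hex_weight_def claw_edges_def)
    qed
  qed
  then show "agrees (hex_nest i j k)"
    using of_choice_max_nest[OF ch n] by (simp add: agrees_def hex_nest_def)
  have s: "top (hex_nest i j k) (star A) = e"
    if "A \<subseteq> claw_edges" "e \<in> A" "\<forall>y\<in>A. hex_weight i j k y \<le> hex_weight i j k e" for A e
    using top[OF star(1)[of A]] star(2)[of A] that by auto
  have hw: "hex_weight i j k x\<^sub>1 = i" "hex_weight i j k x\<^sub>2 = j" "hex_weight i j k x\<^sub>3 = k"
    using less by (auto simp: hex_weight_def)
  show "tops (hex_nest i j k) =
      (if i < j then x\<^sub>2 else x\<^sub>1, if i < k then x\<^sub>3 else x\<^sub>1, if j < k then x\<^sub>3 else x\<^sub>2,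
       if i < j then if j < k then x\<^sub>3 else x\<^sub>2 else if i < k then x\<^sub>3 else x\<^sub>1)"
    unfolding tops_def prod.inject
    by (intro conjI; rule s) (auto simp: claw_edges_def hw)
qed

text \<open>The top edge of the full star is also the top of the two pairs containing it, and the
  remaining pair is free: 3 times 2 possibilities.\<close>

lemma tops_cases:
  assumes N: "max_nest N"
  shows "tops N \<in> {(x\<^sub>2, x\<^sub>3, x\<^sub>3, x\<^sub>3), (x\<^sub>2, x\<^sub>3, x\<^sub>2, x\<^sub>2), (x\<^sub>2, x\<^sub>1, x\<^sub>2, x\<^sub>2), (x\<^sub>1, x\<^sub>3, x\<^sub>3, x\<^sub>3),
    (x\<^sub>1, x\<^sub>1, x\<^sub>3, x\<^sub>1), (x\<^sub>1, x\<^sub>1, x\<^sub>2, x\<^sub>1)}"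
proof -
  have mem: "top N (star A) \<in> A" if "A \<subseteq> claw_edges" "A \<noteq> {}" for A
    using top_inner[OF N star(1)[OF that]] star(2)[OF that] by simp
  have sub: "top N (star B) = top N (star A)"
    if "A \<subseteq> claw_edges" "B \<subseteq> A" "top N (star A) \<in> B" for A B
  proof -
    have B: "B \<subseteq> claw_edges" "B \<noteq> {}" "A \<noteq> {}" using that by auto
    have "star B \<subseteq> star A" using that(2) by (auto simp: star_def)
    then show ?thesis
      using choice_sub[OF top_choice[OF N] star(1)[OF that(1) B(3)] big_conn[OF star(1)[OF B(1,2)]]]
        that(3) star(2)[OF B(1,2)] by simp
  qed
  let ?X = "{x\<^sub>1, x\<^sub>2, x\<^sub>3}"
  define s t u e where "s = top N (star {x\<^sub>1, x\<^sub>2})" and "t = top N (star {x\<^sub>1, x\<^sub>3})"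
    and "u = top N (star {x\<^sub>2, x\<^sub>3})" and "e = top N (star ?X)"
  note defs = s_def t_def u_def e_def
  have s: "s \<in> {x\<^sub>1, x\<^sub>2}" and t: "t \<in> {x\<^sub>1, x\<^sub>3}" and u: "u \<in> {x\<^sub>2, x\<^sub>3}" and "e \<in> ?X"
    unfolding defs by (rule mem; auto simp: claw_edges_def)+
  have st: "e \<in> {x\<^sub>1, x\<^sub>2} \<Longrightarrow> s = e" "e \<in> {x\<^sub>1, x\<^sub>3} \<Longrightarrow> t = e" "e \<in> {x\<^sub>2, x\<^sub>3} \<Longrightarrow> u = e"
    unfolding defs by (rule sub; auto simp: claw_edges_def)+
  from \<open>e \<in> ?X\<close> consider "e = x\<^sub>1" | "e = x\<^sub>2" | "e = x\<^sub>3" by auto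
  then have "(s, t, u, e) \<in> {(x\<^sub>2, x\<^sub>3, x\<^sub>3, x\<^sub>3), (x\<^sub>2, x\<^sub>3, x\<^sub>2, x\<^sub>2), (x\<^sub>2, x\<^sub>1, x\<^sub>2, x\<^sub>2), (x\<^sub>1, x\<^sub>3, x\<^sub>3, x\<^sub>3),
    (x\<^sub>1, x\<^sub>1, x\<^sub>3, x\<^sub>1), (x\<^sub>1, x\<^sub>1, x\<^sub>2, x\<^sub>1)}"
  proof cases
    case 1
    then show ?thesis using st(1,2) u by auto
  next
    case 2
    then show ?thesis using st(1,3) t by auto
  next
    case 3
    then show ?thesis using st(2,3) s by auto
  qed
  then show ?thesis by (simp only: tops_def defs)
qed

lemma not_left_modular_claw:
  fixes L :: "(nat set set, 'b) gorder_scheme"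
  assumes L: "lattice L" and carrier: "carrier L = {N. max_nest N}"
    and le: "\<And>N N'. max_nest N \<Longrightarrow> max_nest N' \<Longrightarrow> N \<sqsubseteq>\<^bsub>L\<^esub> N' \<longleftrightarrow> nest_le N N'"
  shows "\<not> left_modular L"
proof -
  \<comment> \<open>The arguments are the weights of the three edges, so \<open>p\<close> prefers
    greater edges throughout and \<open>q\<close> smaller ones. Each step along a side of the
    hexagon swaps two adjacent weights.\<close>
  define p a b c d q where "p = hex_nest 0 1 2" and "a = hex_nest 0 2 1" and "b = hex_nest 1 2 0"
    and "c = hex_nest 1 0 2" and "d = hex_nest 2 0 1" and "q = hex_nest 2 1 0"
  have agr: "agrees p" "agrees a" "agrees b" "agrees c" "agrees d" "agrees q"
    unfolding p_def a_def b_def c_def d_def q_def by (rule hex_nest(1); simp)+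
  have t: "tops p = (x\<^sub>2, x\<^sub>3, x\<^sub>3, x\<^sub>3)" "tops a = (x\<^sub>2, x\<^sub>3, x\<^sub>2, x\<^sub>2)" "tops b = (x\<^sub>2, x\<^sub>1, x\<^sub>2, x\<^sub>2)"
    "tops c = (x\<^sub>1, x\<^sub>3, x\<^sub>3, x\<^sub>3)" "tops d = (x\<^sub>1, x\<^sub>1, x\<^sub>3, x\<^sub>1)" "tops q = (x\<^sub>1, x\<^sub>1, x\<^sub>2, x\<^sub>1)"
    unfolding p_def a_def b_def c_def d_def q_def by (simp_all add: hex_nest(2))
  have mn: "max_nest N" if "agrees N" for N using that by (simp add: agrees_def)
  have le': "N \<sqsubseteq>\<^bsub>L\<^esub> M \<longleftrightarrow> nest_le N M" if "agrees N" "agrees M" for N M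
    using le mn that by blast
  note cmp = le'[OF agr(1,2)] le'[OF agr(2,3)] le'[OF agr(3,6)] le'[OF agr(1,4)] le'[OF agr(4,5)]
    le'[OF agr(5,6)] le'[OF agr(2,5)] le'[OF agr(4,3)]
  note cmp' = nest_le_iff_tops[OF agr(1) t(1) agr(2) t(2)] nest_le_iff_tops[OF agr(2) t(2) agr(3) t(3)]
    nest_le_iff_tops[OF agr(3) t(3) agr(6) t(6)] nest_le_iff_tops[OF agr(1) t(1) agr(4) t(4)]
    nest_le_iff_tops[OF agr(4) t(4) agr(5) t(5)] nest_le_iff_tops[OF agr(5) t(5) agr(6) t(6)]
    nest_le_iff_tops[OF agr(2) t(2) agr(5) t(5)] nest_le_iff_tops[OF agr(4) t(4) agr(3) t(3)]
  show ?thesis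
  proof (rule lattice.hexagon_not_left_modular[OF L])
    show "finite (carrier L)" using finite_max_nests by (simp add: carrier)
    show "p \<in> carrier L" "a \<in> carrier L" "b \<in> carrier L" "c \<in> carrier L" "d \<in> carrier L"
      "q \<in> carrier L" using agr mn by (simp_all add: carrier)
    show "p \<sqsubseteq>\<^bsub>L\<^esub> a" "a \<sqsubseteq>\<^bsub>L\<^esub> b" "b \<sqsubseteq>\<^bsub>L\<^esub> q" "p \<sqsubseteq>\<^bsub>L\<^esub> c" "c \<sqsubseteq>\<^bsub>L\<^esub> d" "d \<sqsubseteq>\<^bsub>L\<^esub> q"
      "\<not> a \<sqsubseteq>\<^bsub>L\<^esub> d" "\<not> c \<sqsubseteq>\<^bsub>L\<^esub> b"
      using less unfolding cmp cmp' by simp_all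
    show "a \<noteq> b" "c \<noteq> d" using t less by auto
    fix z assume z: "z \<in> carrier L" "p \<sqsubseteq>\<^bsub>L\<^esub> z" "z \<sqsubseteq>\<^bsub>L\<^esub> q"
    have mz: "max_nest z" using z(1) by (simp add: carrier)
    have "nest_le p z" "nest_le z q" using z le mz mn agr by (simp_all add: carrier)
    \<comment> \<open>Outside the claw \<open>p\<close> and \<open>q\<close> have equal tops, so
      every nesting between them has the same ones.\<close>
    moreover have "top q P = top p P" if "big P" "\<not> inner P \<subseteq> claw_edges" for P
      using agr(1,6) that by (simp add: agrees_def)
    ultimately have "top z P = top p P" if "big P" "\<not> inner P \<subseteq> claw_edges" for P
      using that unfolding nest_le_def by (metis le_antisym)
    then have az: "agrees z" using mz agr(1) by (simp add: agrees_def)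
    have "tops z = tops p \<or> tops z = tops a \<or> tops z = tops b \<or> tops z = tops c \<or>
        tops z = tops d \<or> tops z = tops q"
      using tops_cases[OF mz] unfolding t by blast
    then consider "z = p" | "z = a" | "z = b" | "z = c" | "z = d" | "z = q"
      using agr[THEN agrees_eqI[OF az]] by argo
    then show "z \<in> {p, a, b, c, d, q}" by cases simp_all
  qed
qed

end

section \<open>Plane trees\<close>

lemma num_vertices_pos: "0 < num_vertices T"
  by (cases T) simp

lemma tree_edges_bounds:
  "(x, y) \<in> tree_edges r T \<Longrightarrow> r \<le> x \<and> x < y \<and> y < r + num_vertices T"
  "p < r \<Longrightarrow> (x, y) \<in> forest_edges p r ts \<Longrightarrow>
    (x = p \<or> r \<le> x) \<and> x < y \<and> r \<le> y \<and> y < r + sum_list (map num_vertices ts)"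
proof (induction r T and p r ts rule: tree_edges_forest_edges.induct)
  case (1 r ts)
  then show ?case by fastforce
next
  case (3 p r t ts)
  then show ?case using num_vertices_pos[of t] by fastforce
qed simp

lemma ex1_parent:
  "r < v \<Longrightarrow> v < r + num_vertices T \<Longrightarrow> \<exists>!x. (x, v) \<in> tree_edges r T"
  "p < r \<Longrightarrow> r \<le> v \<Longrightarrow> v < r + sum_list (map num_vertices ts) \<Longrightarrow> \<exists>!x. (x, v) \<in> forest_edges p r ts"
proof (induction r T and p r ts rule: tree_edges_forest_edges.induct)
  case (1 r ts)
  then show ?case by simp
next
  case (2 p r)
  then show ?case by simp
next
  case (3 p r t ts)
  let ?s = "r + num_vertices t"
  have tree: "r < v \<and> v < ?s" if "(x, v) \<in> tree_edges r t" for x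
    using tree_edges_bounds(1)[OF that] by simp
  have forest: "?s \<le> v" if "(x, v) \<in> forest_edges p ?s ts" for x
    using tree_edges_bounds(2)[OF _ that] 3(3) by simp
  consider "v = r" | "r < v" "v < ?s" | "?s \<le> v" using 3(4) by linarith
  then show ?case
  proof cases
    case 1
    have "(x, v) \<in> forest_edges p r (t # ts) \<longleftrightarrow> x = p" for x
      using tree[of x] forest[of x] 1 num_vertices_pos[of t] by auto
    then show ?thesis by simp
  next
    case 2
    have "(x, v) \<in> forest_edges p r (t # ts) \<longleftrightarrow> (x, v) \<in> tree_edges r t" for x
      using forest[of x] 2 by auto
    then show ?thesis using 3(1) 2 by simp
  next
    case c: 3
    have "(x, v) \<in> forest_edges p r (t # ts) \<longleftrightarrow> (x, v) \<in> forest_edges p ?s ts" for x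
      using tree[of x] c num_vertices_pos[of t] by auto
    then show ?thesis using 3 c by simp
  qed
qed

lemma root_reaches:
  "r \<le> v \<Longrightarrow> v < r + num_vertices T \<Longrightarrow> (r, v) \<in> (tree_edges r T)\<^sup>*"
  "r \<le> v \<Longrightarrow> v < r + sum_list (map num_vertices ts) \<Longrightarrow> (p, v) \<in> (forest_edges p r ts)\<^sup>*"
proof (induction r T and p r ts rule: tree_edges_forest_edges.induct)
  case (1 r ts)
  then show ?case by (cases "v = r") auto
next
  case (2 p r)
  then show ?case by simp
next
  case (3 p r t ts)
  show ?case
  proof (cases "v < r + num_vertices t")
    case True
    then have "(r, v) \<in> (tree_edges r t)\<^sup>*" using 3 by simp
    then have "(r, v) \<in> (forest_edges p r (t # ts))\<^sup>*"
      by (rule rtrancl_mono[THEN subsetD, rotated]) auto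
    then show ?thesis by (rule converse_rtrancl_into_rtrancl[rotated]) simp
  next
    case False
    then have "(p, v) \<in> (forest_edges p (r + num_vertices t) ts)\<^sup>*" using 3 by simp
    then show ?thesis by (rule rtrancl_mono[THEN subsetD, rotated]) auto
  qed
qed

text \<open>The next vertex in preorder is either the first child of \<open>v\<close> or the root of
  the next sibling subtree after one that ends with \<open>v\<close>. This is all that is taken from
  the preorder besides parents preceding children.\<close>

lemma preorder_parent:
  "r \<le> v \<Longrightarrow> Suc v < r + num_vertices T \<Longrightarrow>
    \<exists>u. (u, Suc v) \<in> tree_edges r T \<and> (u, v) \<in> (tree_edges r T)\<^sup>*"
  "r \<le> v \<Longrightarrow> Suc v < r + sum_list (map num_vertices ts) \<Longrightarrow>
    \<exists>u. (u, Suc v) \<in> forest_edges p r ts \<and> (u, v) \<in> (forest_edges p r ts)\<^sup>*"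
proof (induction r T and p r ts rule: tree_edges_forest_edges.induct)
  case (1 r ts)
  show ?case
  proof (cases "v = r")
    case True
    then obtain t us where "ts = t # us" using 1 by (cases ts) auto
    then have "(r, Suc v) \<in> tree_edges r (Node ts)" using True by simp
    then show ?thesis using True by blast
  next
    case False
    then show ?thesis using 1 by simp
  qed
next
  case (2 p r)
  then show ?case by simp
next
  case (3 p r t ts)
  let ?F = "forest_edges p r (t # ts)" and ?s = "r + num_vertices t"
  have sub: "(tree_edges r t)\<^sup>* \<subseteq> ?F\<^sup>*" "(forest_edges p ?s ts)\<^sup>* \<subseteq> ?F\<^sup>*"
    by (rule rtrancl_mono; auto)+
  consider "Suc v < ?s" | "Suc v = ?s" | "?s \<le> v" by linarith
  then show ?case
  proof cases
    case 1
    then obtain u where "(u, Suc v) \<in> tree_edges r t" "(u, v) \<in> (tree_edges r t)\<^sup>*"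
      using 3 by blast
    then show ?thesis using sub by auto
  next
    case 2
    then obtain t' us where "ts = t' # us" using 3(4) by (cases ts) auto
    then have "(p, Suc v) \<in> ?F" using 2 by simp
    moreover have "(r, v) \<in> (tree_edges r t)\<^sup>*" using root_reaches(1)[OF 3(3), of t] 2 by simp
    then have "(r, v) \<in> ?F\<^sup>*" using sub by auto
    then have "(p, v) \<in> ?F\<^sup>*" by (rule converse_rtrancl_into_rtrancl[rotated]) simp
    ultimately show ?thesis by blast
  next
    case c: 3
    then obtain u where "(u, Suc v) \<in> forest_edges p ?s ts" "(u, v) \<in> (forest_edges p ?s ts)\<^sup>*"
      using 3 by auto
    then show ?thesis using sub by auto
  qed
qed

section \<open>From plane trees to parent functions\<close>

definition parent :: "plane_tree \<Rightarrow> nat \<Rightarrow> nat" where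
  "parent T v = (THE p. (p, v) \<in> edges T)"

lemma parent:
  assumes "0 < v" "v < num_vertices T"
  shows "(parent T v, v) \<in> edges T" "(p, v) \<in> edges T \<Longrightarrow> p = parent T v" "parent T v < v"
proof -
  have ex: "\<exists>!p. (p, v) \<in> edges T"
    unfolding edges_def using ex1_parent(1)[of 0 v T] assms by simp
  show p: "(parent T v, v) \<in> edges T" unfolding parent_def by (rule theI'[OF ex])
  show "(p, v) \<in> edges T \<Longrightarrow> p = parent T v" using ex p by blast
  show "parent T v < v" using tree_edges_bounds(1)[OF p[unfolded edges_def]] by simp
qed

context
  fixes T :: plane_tree and n :: nat
  assumes num: "num_vertices T = Suc n"
begin

interpretation tree: parent_tree n "parent T"
  by unfold_locales (simp add: parent(3) num)

lemma edges_eq: "edges T = tree.arcs"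
proof -
  have "(p, v) \<in> edges T \<longleftrightarrow> (p, v) \<in> tree.arcs" for p v
  proof
    assume e: "(p, v) \<in> edges T"
    then have "0 < v" "v \<le> n"
      using tree_edges_bounds(1)[of p v 0 T] by (auto simp: edges_def num)
    then show "(p, v) \<in> tree.arcs" using parent(2)[OF _ _ e] by (auto simp: tree.arcs_def num)
  qed (auto simp: tree.arcs_def num intro: parent(1))
  then show ?thesis by auto
qed

lemma vertices_eq: "vertices T = {0..n}"
  by (auto simp: vertices_def num)

lemma covered_by_tree_iff: "covered_by (tree_poset T) v w \<longleftrightarrow> (v, w) \<in> edges T"
proof -
  have less: "x \<sqsubset>\<^bsub>tree_poset T\<^esub> y \<longleftrightarrow> tree.desc x y \<and> x \<noteq> y" for x y
    by (simp add: lless_def tree_poset_def edges_eq tree.desc_def)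
  have carrier: "carrier (tree_poset T) = {0..n}"
    by (simp add: tree_poset_def vertices_eq)
  show ?thesis
  proof
    assume c: "covered_by (tree_poset T) v w"
    then have vw: "tree.desc v w" "v \<noteq> w" "w \<le> n"
      by (auto simp: covered_by_def less carrier)
    then have w: "0 < w" using tree.desc_le[OF vw(1)] by simp
    have "w < num_vertices T" using vw(3) num by simp
    note p = parent[OF w this]
    have d: "tree.desc v (parent T w)" using tree.desc_parD vw by blast
    have "tree.desc (parent T w) w" using tree.desc_par w vw(3) by blast
    then have "parent T w = v" using c d p(3) vw(3) by (auto simp: covered_by_def less carrier)
    then show "(v, w) \<in> edges T" using p(1) by simp
  next
    assume e: "(v, w) \<in> edges T"
    then have w: "0 < w" "w \<le> n" "v = parent T w"
      by (auto simp: edges_eq tree.arcs_def)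
    have "\<not> (tree.desc v z \<and> v \<noteq> z \<and> tree.desc z w \<and> z \<noteq> w)" for z
    proof
      assume z: "tree.desc v z \<and> v \<noteq> z \<and> tree.desc z w \<and> z \<noteq> w"
      then have "tree.desc z v" using tree.desc_parD w(3) by auto
      then show False using z tree.desc_le[of v z] tree.desc_le[of z v] by simp
    qed
    then show "covered_by (tree_poset T) v w"
      using w tree.desc_par[of w] parent(3)[of w T] num by (auto simp: covered_by_def less carrier)
  qed
qed

text \<open>A walk inside S starting at a vertex v can leave the descendants of v only through the
  parent of v. If that parent were missing from S, the minimum of S would descend from v and could
  not be smaller.\<close>

lemma tube_iff_conn: "tube T S \<longleftrightarrow> tree.conn S"
proof
  assume t: "tube T S"
  let ?R = "(edges T \<union> (edges T)\<inverse>) \<inter> S \<times> S"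
  have S: "S \<subseteq> {0..n}" "S \<noteq> {}"
    and con: "\<And>u v. u \<in> S \<Longrightarrow> v \<in> S \<Longrightarrow> (u, v) \<in> ?R\<^sup>*"
    using t by (auto simp: tube_def vertices_eq)
  have fin: "finite S" using S(1) finite_subset by blast
  have "parent T v \<in> S" if v: "v \<in> S" "v \<noteq> Min S" for v
  proof (rule ccontr)
    assume np: "parent T v \<notin> S"
    have "tree.desc v x" if "(v, x) \<in> ?R\<^sup>*" for x
      using that
    proof (induction rule: rtrancl_induct)
      case (step y z)
      from step(2) have yz: "y \<in> S" "z \<in> S" "(y, z) \<in> edges T \<or> (z, y) \<in> edges T" by auto
      from yz(3) show ?case
      proof
        assume "(y, z) \<in> edges T"
        then have "tree.desc y z" by (auto simp: edges_eq tree.desc_def)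
        then show ?thesis using step.IH tree.desc_trans by blast
      next
        assume "(z, y) \<in> edges T"
        then have "z = parent T y" by (auto simp: edges_eq tree.arcs_def)
        then show ?thesis using tree.desc_parD[OF step.IH] np yz(2) by blast
      qed
    qed simp
    then have "v \<le> Min S" using con[OF v(1) Min_in[OF fin S(2)]] tree.desc_le by blast
    then show False using Min_le[OF fin v(1)] v(2) by simp
  qed
  then show "tree.conn S" using S by (auto simp: tree.conn_def)
next
  assume c: "tree.conn S"
  let ?R = "(edges T \<union> (edges T)\<inverse>) \<inter> S \<times> S"
  have "(Min S, v) \<in> ?R\<^sup>*" if "v \<in> S" for v
    using that
  proof (induction v rule: less_induct)
    case (less v)
    show ?case
    proof (cases "v = Min S")
      case False
      then have "v \<in> tree.inner S" using less.prems by (simp add: tree.inner_def)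
      note D = tree.innerD[OF c this]
      have "(parent T v, v) \<in> ?R" using D parent(1)[of v T] num by auto
      then show ?thesis using less.IH[OF D(5,2)] by (rule rtrancl_into_rtrancl[rotated])
    qed simp
  qed
  moreover have "sym ?R" by (auto simp: sym_def)
  then have "sym (?R\<^sup>*)" by (rule sym_rtrancl)
  ultimately have "(u, v) \<in> ?R\<^sup>*" if "u \<in> S" "v \<in> S" for u v
    using that by (meson rtrancl_trans symD)
  then show "tube T S" using c by (auto simp: tube_def tree.conn_def vertices_eq)
qed

lemma nesting_iff: "nesting T N \<longleftrightarrow> tree.nest N"
  unfolding nesting_def tree.nest_def vertices_eq tube_iff_conn tree.big_iff_card by simp

lemma maximal_nestings_eq: "maximal_nestings T = {N. tree.max_nest N}"
  unfolding maximal_nestings_def tree.max_nest_def nesting_iff by simp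

lemma flip_up_eq: "flip_up T = tree.flip"
  unfolding flip_up_def tree.flip_def maximal_nestings_eq by simp

lemma operahedron_lattice_simps:
  "carrier (operahedron_lattice T) = {N. tree.max_nest N}"
  "eq (operahedron_lattice T) = (=)"
  "tree.max_nest N \<Longrightarrow> tree.max_nest N' \<Longrightarrow>
     N \<sqsubseteq>\<^bsub>operahedron_lattice T\<^esub> N' \<longleftrightarrow> tree.nest_le N N'"
  by (simp_all add: operahedron_lattice_def maximal_nestings_eq flip_up_eq tree.flip_rtrancl_iff)

lemma not_trim_claw:
  assumes "0 < x" "x < y" "y < z" "z \<le> n"
    and "\<forall>u\<in>{x, y, z}. u = v \<or> parent T u = v"
  shows "\<not> trim (operahedron_lattice T)"
proof
  assume "trim (operahedron_lattice T)"
  then have L: "lattice (operahedron_lattice T)" "left_modular (operahedron_lattice T)"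
    by (simp_all add: trim_def)
  interpret claw: tree_claw "n" "parent T" v x y z
    by unfold_locales (use assms in auto)
  show False
    using claw.not_left_modular_claw[OF L(1) operahedron_lattice_simps(1,3)] L(2) by blast
qed

text \<open>The parent of \<open>Suc v\<close> is \<open>v\<close> or an ancestor of
  \<open>v\<close>. If it were neither \<open>v\<close> nor the root, it would have two children:
  \<open>Suc v\<close> and the one on the way to \<open>v\<close>. So the numbering runs down one
  leg, returns to the root at most once and runs down the other.\<close>

lemma trim_two_legs:
  assumes pos: "0 < n"
    and root: "card {w. covered_by (tree_poset T) 0 w} \<le> 2"
    and other: "\<forall>v \<in> vertices T - {0}. card {w. covered_by (tree_poset T) v w} \<le> 1"
  shows "trim (operahedron_lattice T)"
proof -
  define children where "children v = {w. 0 < w \<and> w \<le> n \<and> parent T w = v}" for v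
  have children: "{w. covered_by (tree_poset T) v w} = children v" for v
    by (auto simp: covered_by_tree_iff edges_eq tree.arcs_def children_def)
  have fin: "finite (children v)" for v
    by (rule finite_subset[of _ "{0..n}"]) (auto simp: children_def)
  have one: "w = w'" if "w \<in> children v" "w' \<in> children v" "0 < v" "v \<le> n" for v w w'
  proof -
    have "card (children v) \<le> 1" using other that(3,4) by (simp add: children vertices_eq)
    then show ?thesis using card_le_Suc0_iff_eq[OF fin[of v]] that(1,2) by auto
  qed
  have par: "parent T (Suc v) = v \<or> parent T (Suc v) = 0" if v: "0 < v" "Suc v \<le> n" for v
  proof (rule ccontr)
    assume np: "\<not> ?thesis"
    let ?u = "parent T (Suc v)"
    obtain u where u: "(u, Suc v) \<in> edges T" "(u, v) \<in> (edges T)\<^sup>*"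
      using preorder_parent(1)[of 0 v T] v num by (auto simp: edges_def)
    then have "u = ?u" using parent(2)[of "Suc v"] v num by auto
    then have d: "tree.desc ?u v" using u(2) by (simp add: edges_eq tree.desc_def)
    \<comment> \<open>Climbing from x meets a child of the ancestor. For x = v this child is at most
      v, hence different from \<open>Suc v\<close>.\<close>
    have "\<exists>c\<in>children ?u. c \<le> x" if "tree.desc ?u x" "x \<noteq> ?u" "x \<le> n" for x
      using that
    proof (induction x rule: less_induct)
      case (less x)
      then have x: "0 < x" using tree.desc_le[of ?u x] by simp
      have "x < num_vertices T" using less.prems(3) num by simp
      note p = parent(3)[OF x this]
      show ?case
      proof (cases "parent T x = ?u")
        case True
        then show ?thesis using x less.prems by (auto simp: children_def)
      next
        case False
        then obtain c where c: "c \<in> children ?u" "c \<le> parent T x"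
          using less.IH[OF p tree.desc_parD] less.prems p by auto
        moreover have "c \<le> x" using c(2) p by simp
        ultimately show ?thesis by blast
      qed
    qed
    from this[OF d] np v obtain c where c: "c \<in> children ?u" "c \<le> v" by auto
    moreover have "Suc v \<in> children ?u" using v by (simp add: children_def)
    moreover have "0 < ?u" "?u \<le> n" using np parent(3)[of "Suc v" T] v num by auto
    ultimately have "c = Suc v" using one by blast
    then show False using c(2) by simp
  qed
  have par1: "parent T 1 = 0" using parent(3)[of 1 T] pos num by simp
  \<comment> \<open>The last vertex before the second child of the root; with no second child the
    second leg is empty, encoded by the value n.\<close>
  define a where "a = (if \<exists>v. 0 < v \<and> Suc v \<le> n \<and> parent T (Suc v) = 0
    then SOME v. 0 < v \<and> Suc v \<le> n \<and> parent T (Suc v) = 0 else n)"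
  have a: "a = n \<and> \<not> (\<exists>v. 0 < v \<and> Suc v \<le> n \<and> parent T (Suc v) = 0) \<or>
      0 < a \<and> Suc a \<le> n \<and> parent T (Suc a) = 0"
    unfolding a_def by (smt (verit, best) someI_ex)
  have uniq: "v = a" if v: "0 < v" "Suc v \<le> n" "parent T (Suc v) = 0" for v
  proof (rule ccontr)
    assume "v \<noteq> a"
    moreover have "0 < a" "Suc a \<le> n" "parent T (Suc a) = 0" using a v by auto
    ultimately have "{1, Suc v, Suc a} \<subseteq> children 0" "card {1, Suc v, Suc a} = 3"
      using v par1 by (auto simp: children_def)
    then have "3 \<le> card (children 0)" using card_mono[OF fin] by metis
    then show False using root by (simp add: children)
  qed
  interpret path: path_tree n "parent T" a
  proof
    show "a \<le> n" using a by auto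
    show "parent T (Suc a) = 0" if "a < n" using a that by auto
    show "parent T v = v - 1" if "0 < v" "v \<le> n" "v \<noteq> Suc a" for v
      using that par[of "v - 1"] uniq[of "v - 1"] par1 by (cases "v = 1") auto
  qed
  show ?thesis
    by (rule path.trim_path[OF pos operahedron_lattice_simps])
qed

end

text \<open>This serves the one-vertex tree, which has no nestings. The empty order has height 0 by
  truncated subtraction, and its empty chain is maximal.\<close>

lemma trim_empty:
  assumes "carrier L = {}" "eq L = (=)"
  shows "trim L"
proof -
  have "lattice L" by unfold_locales (simp_all add: assms)
  moreover have chain: "pred_on.chain (carrier L) (\<lambda>x y. x \<sqsubset>\<^bsub>L\<^esub> y) C \<longleftrightarrow> C = {}" for C
    by (auto simp: pred_on.chain_def assms)
  then have "height L = 0" by (simp add: height_def)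
  moreover have "join_irreducibles L = {}" "meet_irreducibles L = {}"
    by (simp_all add: join_irreducibles_def meet_irreducibles_def assms)
  moreover have "left_modular L"
    unfolding left_modular_def pred_on.maxchain_def chain by auto
  ultimately show ?thesis by (simp add: trim_def extremal_def assms)
qed

lemma ordered_triple:
  fixes A :: "nat set"
  assumes "3 \<le> card A"
  obtains x y z where "x \<in> A" "y \<in> A" "z \<in> A" "x < y" "y < z"
proof -
  obtain B where B: "B \<subseteq> A" "card B = 3" using obtain_subset_with_card_n[OF assms] by metis
  have fin: "finite B" using B(2) card.infinite by fastforce
  define l where "l = sorted_list_of_set B"
  have l: "length l = 3" "sorted_wrt (<) l" "set l \<subseteq> A"
    using B fin by (simp_all add: l_def)
  then have "l ! 0 < l ! 1" "l ! 1 < l ! 2" by (auto simp: sorted_wrt_iff_nth_less)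
  moreover have "l ! 0 \<in> A" "l ! 1 \<in> A" "l ! 2 \<in> A" using l by (auto intro!: subsetD[OF l(3)])
  ultimately show ?thesis using that by blast
qed

theorem theorem1p4:
  fixes T :: plane_tree
  shows "trim (operahedron_lattice T) \<longleftrightarrow>
           card {w. covered_by (tree_poset T) 0 w} \<le> 2 \<and>
           (\<forall>v \<in> vertices T - {0}. card {w. covered_by (tree_poset T) v w} \<le> 1)"
proof -
  obtain n where num: "num_vertices T = Suc n" using num_vertices_pos[of T] gr0_conv_Suc by blast
  note cov = covered_by_tree_iff[OF num]
  show ?thesis
  proof (cases "0 < n")
    case False
    then have edges: "edges T = {}"
      using tree_edges_bounds(1)[of _ _ 0 T] by (fastforce simp: edges_def num)
    have "card (vertices T) \<le> 1" using False by (simp add: vertices_def num)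
    then have "\<not> nesting T N" for N by (fastforce simp: nesting_def)
    then have "maximal_nestings T = {}" unfolding maximal_nestings_def by blast
    then have "trim (operahedron_lattice T)"
      by (intro trim_empty) (simp_all add: operahedron_lattice_def)
    then show ?thesis by (simp add: cov edges)
  next
    case True
    have mem: "0 < w \<and> w \<le> n \<and> parent T w = v"
      if "w \<in> {w. covered_by (tree_poset T) v w}" for v w
    proof -
      have e: "(v, w) \<in> edges T" using that by (simp add: cov)
      then have "0 < w" "w \<le> n"
        using tree_edges_bounds(1)[of v w 0 T] by (auto simp: edges_def num)
      then show ?thesis using parent(2)[OF _ _ e] num by simp
    qed
    show ?thesis
    proof
      assume trim: "trim (operahedron_lattice T)"
      show "card {w. covered_by (tree_poset T) 0 w} \<le> 2 \<and>
          (\<forall>v \<in> vertices T - {0}. card {w. covered_by (tree_poset T) v w} \<le> 1)"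
      proof (intro conjI ballI; rule ccontr)
        assume "\<not> card {w. covered_by (tree_poset T) 0 w} \<le> 2"
        then have "3 \<le> card {w. covered_by (tree_poset T) 0 w}" by simp
        then obtain x y z where xyz: "x \<in> {w. covered_by (tree_poset T) 0 w}"
          "y \<in> {w. covered_by (tree_poset T) 0 w}" "z \<in> {w. covered_by (tree_poset T) 0 w}"
          "x < y" "y < z" by (rule ordered_triple)
        show False
          using not_trim_claw[OF num, of x y z 0] mem[OF xyz(1)] mem[OF xyz(2)] mem[OF xyz(3)] xyz(4,5) trim
          by auto
      next
        fix v assume v: "v \<in> vertices T - {0}"
        let ?C = "{w. covered_by (tree_poset T) v w}"
        assume "\<not> card ?C \<le> 1"
        then have C2: "2 \<le> card ?C" by simp
        then have fin: "finite ?C" by (metis card.infinite not_numeral_le_zero)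
        have gt: "v < w" if "w \<in> ?C" for w using mem[OF that] parent(3)[of w T] num by auto
        then have "v \<notin> ?C" by blast
        \<comment> \<open>A vertex other than the root also has the edge to its parent, named by the
          vertex itself, so two children give three incident edges.\<close>
        then have "3 \<le> card (insert v ?C)" using C2 fin by simp
        then obtain x y z where xyz: "x \<in> insert v ?C" "y \<in> insert v ?C" "z \<in> insert v ?C"
          "x < y" "y < z" by (rule ordered_triple)
        have claw: "0 < u \<and> u \<le> n \<and> (u = v \<or> parent T u = v)"
          if "u \<in> insert v ?C" for u
          using that mem[of u v] v by (auto simp: vertices_def num)
        show False
          using not_trim_claw[OF num, of x y z v] claw[OF xyz(1)] claw[OF xyz(2)] claw[OF xyz(3)] xyz(4,5) trim
          by auto
      qed
    next
      assume "card {w. covered_by (tree_poset T) 0 w} \<le> 2 \<and>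
          (\<forall>v \<in> vertices T - {0}. card {w. covered_by (tree_poset T) v w} \<le> 1)"
      then show "trim (operahedron_lattice T)" using trim_two_legs[OF num True] by blast
    qed
  qed
qed

end
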